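(* Let $A$ be a real JBW$^*$-algebra and let $M$ be a closed subspace of $A$. Then $M$ is an $M$-summand of $A$ if and only if $M$ is a weak$^*$-closed (Jordan) ideal of $A$.
   Context: A real JB$^*$-algebra is a norm-closed real JB$^*$-subalgebra of a (complex) JB$^*$-algebra (closed under the Jordan product and the involution); a real JBW$^*$-algebra is a real JB$^*$-algebra which is a dual Banach space (weak$^*$ topology given by its unique predual). A (Jordan) ideal of a real JB$^*$-algebra $A$ is a closed subspace $I$ with $I\circ A\subseteq I$. A projection $P$ on a Banach space $V$ is an $M$-projection if $\|x\|=\max\{\|Px\|,\|x-Px\|\}$ for all $x\in V$; its image is called an $M$-summand. *)

theory Defs
  imports "HOL-Analysis.Analysis"
begin

class complex_banach = banach +
  fixes scaleC :: "complex \<Rightarrow> 'a \<Rightarrow> 'a"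
  assumes scaleC_add_right: "scaleC a (x + y) = scaleC a x + scaleC a y"
    and scaleC_add_left: "scaleC (a + b) x = scaleC a x + scaleC b x"
    and scaleC_scaleC: "scaleC a (scaleC b x) = scaleC (a * b) x"
    and scaleC_one: "scaleC 1 x = x"
    and scaleR_scaleC: "scaleR r x = scaleC (complex_of_real r) x"
    and norm_scaleC: "norm (scaleC a x) = cmod a * norm x"

definition jordan_triple :: "('a \<Rightarrow> 'a \<Rightarrow> 'a::real_vector) \<Rightarrow> 'a \<Rightarrow> 'a \<Rightarrow> 'a \<Rightarrow> 'a" where
  "jordan_triple jp a b c = jp (jp a b) c + jp (jp c b) a - jp (jp a c) b"

definition jbstar_algebra :: "('a::complex_banach \<Rightarrow> 'a \<Rightarrow> 'a) \<Rightarrow> ('a \<Rightarrow> 'a) \<Rightarrow> bool" where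
  "jbstar_algebra jp invol \<longleftrightarrow>
     (\<forall>x y z. jp (x + y) z = jp x z + jp y z) \<and>
     (\<forall>c x y. jp (scaleC c x) y = scaleC c (jp x y)) \<and>
     (\<forall>x y. jp x y = jp y x) \<and>
     (\<forall>x y. jp (jp x y) (jp x x) = jp x (jp y (jp x x))) \<and>
     (\<forall>x y. invol (x + y) = invol x + invol y) \<and>
     (\<forall>c x. invol (scaleC c x) = scaleC (cnj c) (invol x)) \<and>
     (\<forall>x. invol (invol x) = x) \<and>
     (\<forall>x y. invol (jp x y) = jp (invol x) (invol y)) \<and>
     (\<forall>x y. norm (jp x y) \<le> norm x * norm y) \<and>
     (\<forall>x. norm (jordan_triple jp x (invol x) x) = norm x ^ 3)"

definition real_jbstar_subalgebra ::
  "('a::complex_banach \<Rightarrow> 'a \<Rightarrow> 'a) \<Rightarrow> ('a \<Rightarrow> 'a) \<Rightarrow> 'a set \<Rightarrow> bool" where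
  "real_jbstar_subalgebra jp invol A \<longleftrightarrow>
     subspace A \<and> closed A \<and> (\<forall>x\<in>A. \<forall>y\<in>A. jp x y \<in> A) \<and> (\<forall>x\<in>A. invol x \<in> A)"

definition predual_iso :: "'a::real_normed_vector set \<Rightarrow> ('a \<Rightarrow> ('e::banach \<Rightarrow>\<^sub>L real)) \<Rightarrow> bool" where
  "predual_iso A Phi \<longleftrightarrow>
     (\<forall>x\<in>A. \<forall>y\<in>A. Phi (x + y) = Phi x + Phi y) \<and>
     (\<forall>r. \<forall>x\<in>A. Phi (r *\<^sub>R x) = r *\<^sub>R Phi x) \<and>
     bij_betw Phi A UNIV \<and>
     (\<forall>x\<in>A. norm (Phi x) = norm x)"

definition wstar_topology :: "'a set \<Rightarrow> ('a \<Rightarrow> ('e::real_normed_vector \<Rightarrow>\<^sub>L real)) \<Rightarrow> 'a topology" where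
  "wstar_topology A Phi =
     topology_generated_by {{x \<in> A. blinfun_apply (Phi x) e \<in> U} | e U. open U}"

definition jordan_ideal :: "('a::real_normed_vector \<Rightarrow> 'a \<Rightarrow> 'a) \<Rightarrow> 'a set \<Rightarrow> 'a set \<Rightarrow> bool" where
  "jordan_ideal jp A I \<longleftrightarrow>
     I \<subseteq> A \<and> subspace I \<and> closed I \<and> (\<forall>x\<in>I. \<forall>a\<in>A. jp x a \<in> I)"

definition M_projection :: "'a::real_normed_vector set \<Rightarrow> ('a \<Rightarrow> 'a) \<Rightarrow> bool" where
  "M_projection V P \<longleftrightarrow>
     P ` V \<subseteq> V \<and>
     (\<forall>x\<in>V. \<forall>y\<in>V. P (x + y) = P x + P y) \<and>
     (\<forall>r. \<forall>x\<in>V. P (r *\<^sub>R x) = r *\<^sub>R P x) \<and>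
     (\<forall>x\<in>V. P (P x) = P x) \<and>
     (\<forall>x\<in>V. norm x = max (norm (P x)) (norm (x - P x)))"

definition M_summand :: "'a::real_normed_vector set \<Rightarrow> 'a set \<Rightarrow> bool" where
  "M_summand V M \<longleftrightarrow> (\<exists>P. M_projection V P \<and> M = P ` V)"

end

theory Submission
  imports Defs "HOL-Computational_Algebra.Polynomial"
begin

text \<open>
  Both directions use only the triple product \<open>{x y z}\<close>, the identity
  \<open>norm {x x x} = norm x ^ 3\<close>, and real polynomials in operators that behave like
  multiplications.

  If \<open>P\<close> is an M-projection, then its range and kernel are invariant under every bounded triple
  derivation \<open>D\<close>, because \<open>1 + s D\<close> is isometric to first order. This makes the range
  self-adjoint. For self-adjoint \<open>m\<close>, \<open>n\<close> in the range and in the kernel, a second order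
  expansion of \<open>norm (x + c (x - x\<^sup>3))\<close> at \<open>x = m + t n\<close> shows that
  \<open>m \<mapsto> P (n (n m))\<close> and all its powers are skew operators, hence zero, and \<open>m n = 0\<close>
  follows. The range is weak* closed since a functional composed with the complementary projection
  is, by compactness and the Hahn-Banach theorem, approximable by elements of the predual.

  Conversely, an extreme point \<open>u\<close> of the unit ball of a weak* closed ideal satisfies
  \<open>L\<^sup>2 u = u\<close> for \<open>L x = {u u x}\<close>. It splits into two orthogonal parts, and the M-projection is a
  polynomial in the difference of their box operators.
\<close>

subsection \<open>Bounds improved by a cube map\<close>

text \<open>No spectral theory stands behind the estimates. Sharp bounds come from a crude one with
  some constant \<open>B\<close>, valid on a whole family that is stable under cubing. Because norms
  of cubes are known exactly, applying the crude bound to cubes improves its constant, and the best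
  constant b satisfies b^3 \<le> c b. The obstacle on the way from summands to ideals is that
  \<open>A\<close> is only a real space. Multiplication by a self-adjoint element generates
  isometries only after a factor \<open>\<i>\<close>, and this factor leads out of \<open>A\<close>,
  where nothing is known about \<open>P\<close>. The derivations at hand that respect
  \<open>A\<close> are multiplications by skew elements and commutators of self-adjoint
  multiplications. Products of self-adjoint elements are reached only through second-order
  expansions, which is why errors of second and third order are tracked with explicit
  constants.\<close>

lemma cube_improve:
  fixes u v :: "'s \<Rightarrow> real"
  assumes nn: "\<And>s. s \<in> S \<Longrightarrow> 0 \<le> u s \<and> 0 \<le> v s" and c: "0 \<le> c"
    and step: "\<And>s. s \<in> S \<Longrightarrow> \<exists>s'\<in>S. u s ^ 3 \<le> c * u s' \<and> v s' \<le> v s ^ 3"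
    and bdd: "\<And>s. s \<in> S \<Longrightarrow> u s \<le> B * v s"
    and s: "s \<in> S"
  shows "u s \<le> sqrt c * v s"
proof -
  \<comment> \<open>\<open>T\<close> collects the admissible constants. The a priori bound
    \<open>B\<close> makes it nonempty, and its infimum \<open>b\<close> is again admissible because
    the bound is linear in the constant.\<close>
  define T where "T = {b. 0 \<le> b \<and> (\<forall>s\<in>S. u s \<le> b * v s)}"
  have T_ne: "max B 0 \<in> T"
  proof -
    have "u t \<le> max B 0 * v t" if "t \<in> S" for t
      using bdd[OF that] nn[OF that] mult_right_mono[of B "max B 0" "v t"] by linarith
    then show ?thesis unfolding T_def by simp
  qed
  have T_bdd: "bdd_below T"
    unfolding T_def by (rule bdd_belowI[of _ 0]) auto
  define b where "b = Inf T"
  have b0: "0 \<le> b"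
    unfolding b_def
  proof (rule cInf_greatest)
    show "T \<noteq> {}" using T_ne by blast
  qed (simp add: T_def)
  have bT: "u t \<le> b * v t" if t: "t \<in> S" for t
  proof (cases "v t = 0")
    case True
    then show ?thesis using bdd[OF t] by simp
  next
    case False
    then have vt: "v t > 0" using nn[OF t] by simp
    have "u t / v t \<le> b"
      unfolding b_def
    proof (rule cInf_greatest)
      show "T \<noteq> {}" using T_ne by blast
    qed (use vt t in \<open>simp add: T_def field_simps\<close>)
    then show ?thesis using vt by (simp add: field_simps)
  qed
  \<comment> \<open>The bound for \<open>s'\<close> with constant \<open>b\<close> is the cube of a
    bound for \<open>s\<close> with constant \<open>root 3 (c * b)\<close>, so minimality of
    \<open>b\<close> gives b^3 \<le> c b.\<close>
  have "root 3 (c * b) \<in> T"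
  proof -
    have "u t \<le> root 3 (c * b) * v t" if t: "t \<in> S" for t
    proof -
      obtain t' where t': "t' \<in> S" "u t ^ 3 \<le> c * u t'" "v t' \<le> v t ^ 3"
        using step[OF t] by blast
      have "u t ^ 3 \<le> c * (b * v t')"
        using t'(2) bT[OF t'(1)] c by (meson mult_left_mono order_trans)
      also have "\<dots> \<le> c * (b * v t ^ 3)"
        using t'(3) c b0 by (intro mult_left_mono) auto
      also have "\<dots> = (root 3 (c * b) * v t) ^ 3"
        by (simp add: power_mult_distrib odd_real_root_pow)
      finally show ?thesis
        using nn[OF t] c b0 by (subst (asm) power_mono_iff) auto
    qed
    then show ?thesis using c b0 by (simp add: T_def)
  qed
  then have "b \<le> root 3 (c * b)"
    unfolding b_def by (rule cInf_lower[OF _ T_bdd])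
  then have "b ^ 3 \<le> root 3 (c * b) ^ 3"
    using b0 by (intro power_mono) auto
  then have b3: "b ^ 3 \<le> c * b"
    by (simp add: odd_real_root_pow)
  have "b \<le> sqrt c"
  proof (cases "b = 0")
    case False
    then have "b * b ^ 2 \<le> b * c"
      using b3 by (simp add: power3_eq_cube power2_eq_square mult.commute mult.left_commute)
    then have "b ^ 2 \<le> c" using b0 False by simp
    then show ?thesis by (rule real_le_rsqrt)
  qed (use c in simp)
  then show ?thesis
    using bT[OF s] nn[OF s] by (meson mult_right_mono order_trans)
qed

subsection \<open>The Jordan triple product of a JB*-algebra\<close>

locale jbstar =
  fixes jp :: "'a::complex_banach \<Rightarrow> 'a \<Rightarrow> 'a" (infixl "\<odot>" 70) and invol :: "'a \<Rightarrow> 'a"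
  assumes jb: "jbstar_algebra jp invol"
begin

lemma comm: "x \<odot> y = y \<odot> x"
  and jordan: "(x \<odot> y) \<odot> (x \<odot> x) = x \<odot> (y \<odot> (x \<odot> x))"
  and jp_norm: "norm (x \<odot> y) \<le> norm x * norm y"
  and add_left: "(x + y) \<odot> z = x \<odot> z + y \<odot> z"
  and scaleC_left: "scaleC c x \<odot> y = scaleC c (x \<odot> y)"
  and invol_add: "invol (x + y) = invol x + invol y"
  and invol_scaleC: "invol (scaleC c x) = scaleC (cnj c) (invol x)"
  and invol_invol [simp]: "invol (invol x) = x"
  and invol_jp: "invol (x \<odot> y) = invol x \<odot> invol y"
  and cube_norm: "norm (jordan_triple jp x (invol x) x) = norm x ^ 3"
  using jb unfolding jbstar_algebra_def by blast+

lemma add_right: "x \<odot> (y + z) = x \<odot> y + x \<odot> z"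
  by (metis add_left comm)

lemma scaleC_right: "x \<odot> scaleC c y = scaleC c (x \<odot> y)"
  by (metis scaleC_left comm)

sublocale jp: bounded_bilinear jp
proof
  show "\<exists>K. \<forall>a b. norm (a \<odot> b) \<le> norm a * norm b * K"
    using jp_norm by (intro exI[of _ 1]) simp
qed (simp_all add: add_left add_right scaleR_scaleC scaleC_left scaleC_right)

sublocale invol: additive invol
  by unfold_locales (rule invol_add)

lemma invol_scaleR: "invol (r *\<^sub>R x) = r *\<^sub>R invol x"
  by (simp add: scaleR_scaleC invol_scaleC)

lemmas bil = jp.add_left jp.add_right jp.diff_left jp.diff_right jp.minus_left jp.minus_right
  jp.scaleR_left jp.scaleR_right

text \<open>Complete polarisation of the Jordan identity: its defect \<open>g\<close> is trilinear
  and symmetric in the last two arguments, so vanishing on the diagonal forces the symmetrised form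
  to vanish.\<close>

lemma jordan_linear:
  "((a \<odot> b) \<odot> d) \<odot> c + ((b \<odot> c) \<odot> d) \<odot> a + ((c \<odot> a) \<odot> d) \<odot> b =
   (a \<odot> b) \<odot> (d \<odot> c) + (b \<odot> c) \<odot> (d \<odot> a) + (c \<odot> a) \<odot> (d \<odot> b)" (is "?l = ?r")
proof -
  define g where "g x y z = (x \<odot> d) \<odot> (y \<odot> z) - x \<odot> (d \<odot> (y \<odot> z))" for x y z
  have g0: "g x x x = 0" for x
    using jordan by (simp add: g_def)
  have g_add: "g (x + x') y z = g x y z + g x' y z" "g x (y + y') z = g x y z + g x y' z"
    "g x y (z + z') = g x y z + g x y z'" for x x' y y' z z'
    by (simp_all add: g_def bil)
  have g_comm: "g x y z = g x z y" for x y z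
    by (simp add: g_def comm)
  have pol: "g x x y + g x y x + g y x x = 0" for x y
  proof -
    have minus: "g (- v) y z = - g v y z" "g y (- v) z = - g y v z" "g y z (- v) = - g y z v" for v y z
      by (simp_all add: g_def bil)
    have p: "g x x y + g x y x + g y x x + (g x y y + g y x y + g y y x) = 0" for y
      using g0[of "x + y"] unfolding g_add by (simp add: g0[of x] g0[of y] algebra_simps)
    \<comment> \<open>Replacing \<open>y\<close> by \<open>- y\<close> flips the part linear in
      \<open>y\<close> and keeps the quadratic part, which separates the two.\<close>
    have "(g x y y + g y x y + g y y x) - (g x x y + g x y x + g y x x) = 0"
      using p[of "- y"] unfolding minus by (simp add: algebra_simps)
    moreover have "2 *\<^sub>R u = (u + v) - (v - u)" for u v :: 'a
      by (simp add: scaleR_2)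
    ultimately have "2 *\<^sub>R (g x x y + g x y x + g y x x) = 0"
      using p[of y] by (metis diff_zero)
    then show ?thesis by simp
  qed
  have "2 *\<^sub>R (g a b c + g b c a + g c a b) = 0"
  proof -
    have "g (a + b) (a + b) c + g (a + b) c (a + b) + g c (a + b) (a + b) = 0"
      by (rule pol)
    then have "(g a a c + g a c a + g c a a) + (g b b c + g b c b + g c b b)
      + (g a b c + g b a c + g a c b + g b c a + g c a b + g c b a) = 0"
      unfolding g_add by (simp add: algebra_simps)
    then have "g a b c + g b a c + g a c b + g b c a + g c a b + g c b a = 0"
      by (simp only: pol add_0)
    then show ?thesis
      using g_comm[of a c b] g_comm[of b a c] g_comm[of c b a] by (simp add: scaleR_2 algebra_simps)
  qed
  then have "g a b c + g b c a + g c a b = 0" by simp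
  then show ?thesis
    by (simp add: g_def comm algebra_simps)
qed

abbreviation tri :: "'a \<Rightarrow> 'a \<Rightarrow> 'a \<Rightarrow> 'a" where
  "tri \<equiv> jordan_triple jp"

text \<open>A signed sum of three instances of the polarised Jordan identity. The minus sign in the
  middle slot is later absorbed by \<open>invol\<close>: for skew \<open>a\<close> the
  multiplication becomes a derivation of \<open>tr\<close>.\<close>

lemma jp_tri:
  "a \<odot> tri x y z = tri (a \<odot> x) y z - tri x (a \<odot> y) z + tri x y (a \<odot> z)"
proof -
  define J where "J p q r s = ((p \<odot> q) \<odot> s) \<odot> r + ((q \<odot> r) \<odot> s) \<odot> p + ((r \<odot> p) \<odot> s) \<odot> q
    - ((p \<odot> q) \<odot> (s \<odot> r) + (q \<odot> r) \<odot> (s \<odot> p) + (r \<odot> p) \<odot> (s \<odot> q))" for p q r s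
  have J0: "J p q r s = 0" for p q r s
    using jordan_linear[of p q s r] by (simp add: J_def)
  have "a \<odot> tri x y z - (tri (a \<odot> x) y z - tri x (a \<odot> y) z + tri x y (a \<odot> z))
    = J x y a z + J z y a x - J x z a y"
    unfolding J_def jordan_triple_def by (simp add: bil comm algebra_simps)
  then show ?thesis by (simp add: J0)
qed

lemma tri_bilinear:
  "tri (x + x') y z = tri x y z + tri x' y z"
  "tri x (y + y') z = tri x y z + tri x y' z"
  "tri x y (z + z') = tri x y z + tri x y z'"
  "tri (x - x') y z = tri x y z - tri x' y z"
  "tri x (y - y') z = tri x y z - tri x y' z"
  "tri x y (z - z') = tri x y z - tri x y z'"
  unfolding jordan_triple_def by (simp_all add: bil algebra_simps)

text \<open>\<open>tri a b\<close> is the multiplication by \<open>a \<odot> b\<close> plus the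
  commutator of the multiplications by \<open>a\<close> and \<open>b\<close>. In the middle slot
  \<open>jp_tri\<close> reverses the sign of the first and keeps that of the second, which produces
  \<open>tri b a\<close>.\<close>

lemma tri_identity:
  "tri a b (tri x y z) = tri (tri a b x) y z - tri x (tri b a y) z + tri x y (tri a b z)"
proof -
  have expand: "tri p q w = (p \<odot> q) \<odot> w + (p \<odot> (q \<odot> w) - q \<odot> (p \<odot> w))" for p q w
    unfolding jordan_triple_def by (simp add: bil comm algebra_simps)
  have *: "p \<odot> (q \<odot> tri x y z) =
      tri (p \<odot> (q \<odot> x)) y z - tri (q \<odot> x) (p \<odot> y) z + tri (q \<odot> x) y (p \<odot> z)
    - (tri (p \<odot> x) (q \<odot> y) z - tri x (p \<odot> (q \<odot> y)) z + tri x (q \<odot> y) (p \<odot> z))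
    + (tri (p \<odot> x) y (q \<odot> z) - tri x (p \<odot> y) (q \<odot> z) + tri x y (p \<odot> (q \<odot> z)))" for p q
    by (simp add: jp_tri bil)
  show ?thesis
    unfolding expand[of a b] expand[of b a] *[of a b] *[of b a] jp_tri[of "a \<odot> b"]
    by (simp add: tri_bilinear comm[of b a])
qed

text \<open>The triple product of the associated JB*-triple, conjugate linear in the middle;
  \<open>tri\<close> is its complex trilinear version, in which the algebraic identities are easier
  to prove.\<close>

definition tr :: "'a \<Rightarrow> 'a \<Rightarrow> 'a \<Rightarrow> 'a" where
  "tr x y z = tri x (invol y) z"

abbreviation cube :: "'a \<Rightarrow> 'a" where "cube x \<equiv> tr x x x"

lemma norm_cube: "norm (cube x) = norm x ^ 3"
  by (simp add: tr_def cube_norm)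

lemma tr_add:
  "tr (x + x') y z = tr x y z + tr x' y z"
  "tr x (y + y') z = tr x y z + tr x y' z"
  "tr x y (z + z') = tr x y z + tr x y z'"
  by (simp_all add: tr_def tri_bilinear invol_add)

lemma tr_scaleC:
  "tr (scaleC c x) y z = scaleC c (tr x y z)"
  "tr x (scaleC c y) z = scaleC (cnj c) (tr x y z)"
  "tr x y (scaleC c z) = scaleC c (tr x y z)"
proof -
  have diff: "scaleC c a + scaleC c b - scaleC c d = scaleC c (a + b - d)" for c a b d
    by (metis (no_types, lifting) add_diff_cancel add.commute diff_add_cancel scaleC_add_right)
  show "tr (scaleC c x) y z = scaleC c (tr x y z)"
    "tr x (scaleC c y) z = scaleC (cnj c) (tr x y z)"
    "tr x y (scaleC c z) = scaleC c (tr x y z)"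
    by (simp_all add: tr_def jordan_triple_def scaleC_left scaleC_right invol_scaleC diff)
qed

lemma tr_scaleR:
  "tr (r *\<^sub>R x) y z = r *\<^sub>R tr x y z"
  "tr x (r *\<^sub>R y) z = r *\<^sub>R tr x y z"
  "tr x y (r *\<^sub>R z) = r *\<^sub>R tr x y z"
  by (simp_all add: scaleR_scaleC tr_scaleC)

lemma tr_zero [simp]: "tr 0 y z = 0" "tr x 0 z = 0" "tr x y 0 = 0"
  using tr_scaleR(1)[of 0 0 y z] tr_scaleR(2)[of x 0 0 z] tr_scaleR(3)[of x y 0 0] by simp_all

lemma tr_minus: "tr (- x) y z = - tr x y z" "tr x (- y) z = - tr x y z" "tr x y (- z) = - tr x y z"
  using tr_scaleR(1)[of "-1" x y z] tr_scaleR(2)[of x "-1" y z] tr_scaleR(3)[of x y "-1" z] by simp_all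

lemma tr_diff:
  "tr (x - x') y z = tr x y z - tr x' y z"
  "tr x (y - y') z = tr x y z - tr x y' z"
  "tr x y (z - z') = tr x y z - tr x y z'"
  by (simp_all only: diff_conv_add_uminus tr_add tr_minus)

lemmas tr_lin = tr_add tr_diff tr_minus tr_scaleR

lemma tr_comm: "tr x y z = tr z y x"
  by (simp add: tr_def jordan_triple_def comm algebra_simps)

lemma invol_tri: "invol (tri x y z) = tri (invol x) (invol y) (invol z)"
  by (simp add: jordan_triple_def invol_add invol.diff invol_jp)

lemma tr_identity:
  "tr a b (tr x y z) = tr (tr a b x) y z - tr x (tr b a y) z + tr x y (tr a b z)"
  unfolding tr_def invol_tri invol_invol by (rule tri_identity)

lemma norm_tri: "norm (tri a b d) \<le> 3 * norm a * norm b * norm d"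
proof -
  have n3: "norm ((p \<odot> q) \<odot> r) \<le> norm p * norm q * norm r" for p q r
    by (meson jp_norm mult_right_mono norm_ge_zero order_trans)
  have "norm (tri a b d) \<le> norm ((a \<odot> b) \<odot> d + (d \<odot> b) \<odot> a) + norm ((a \<odot> d) \<odot> b)"
    unfolding jordan_triple_def by (rule norm_triangle_ineq4)
  also have "\<dots> \<le> norm ((a \<odot> b) \<odot> d) + norm ((d \<odot> b) \<odot> a) + norm ((a \<odot> d) \<odot> b)"
    by (intro add_right_mono norm_triangle_ineq)
  also have "\<dots> \<le> norm a * norm b * norm d + norm d * norm b * norm a + norm a * norm d * norm b"
    by (intro add_mono n3)
  finally show ?thesis by (simp add: algebra_simps)
qed

text \<open>The cube identity together with the triple estimate gives the factor 3. Since
  \<open>invol\<close> commutes with cubing, \<open>cube_improve\<close> lowers it to 1.\<close>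

lemma norm_invol [simp]: "norm (invol x) = norm x"
proof -
  have cube_invol: "cube (invol y) = invol (cube y)" for y
    by (simp add: tr_def invol_tri)
  have bound: "norm (invol y) \<le> 3 * norm y" for y
  proof (cases "y = 0")
    case False
    have "norm (invol y) ^ 3 \<le> 3 * norm (invol y) * norm y * norm (invol y)"
      using norm_tri[of "invol y" y "invol y"] norm_cube[of "invol y"] by (simp add: tr_def)
    then have "(norm (invol y))\<^sup>2 * norm (invol y) \<le> (norm (invol y))\<^sup>2 * (3 * norm y)"
      by (simp add: power3_eq_cube power2_eq_square algebra_simps)
    moreover have "invol y \<noteq> 0"
    proof
      assume "invol y = 0"
      then have "invol (invol y) = 0" by (simp only: invol.zero)
      then show False using False by simp
    qed
    ultimately show ?thesis by simp
  qed (simp add: invol.zero)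
  have le: "norm (invol y) \<le> norm y" for y
  proof -
    have "norm (invol y) \<le> sqrt 1 * norm y"
    proof (rule cube_improve[where S = UNIV and B = 3 and u = "\<lambda>y. norm (invol y)" and v = norm and c = 1])
      show "\<exists>s'\<in>UNIV. norm (invol s) ^ 3 \<le> 1 * norm (invol s') \<and> norm s' \<le> norm s ^ 3" for s :: 'a
      proof
        show "norm (invol s) ^ 3 \<le> 1 * norm (invol (cube s)) \<and> norm (cube s) \<le> norm s ^ 3"
          by (simp add: norm_cube flip: cube_invol)
      qed simp
      show "norm (invol s) \<le> 3 * norm s" for s
        by (rule bound)
    qed simp_all
    then show ?thesis by simp
  qed
  show ?thesis using le[of x] le[of "invol x"] by simp
qed

lemma norm_tr: "norm (tr a b d) \<le> 3 * norm a * norm b * norm d"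
  using norm_tri[of a "invol b" d] by (simp add: tr_def)

lemma norm_tr_le:
  assumes "norm a \<le> \<alpha>" "norm b \<le> \<beta>" "norm d \<le> \<gamma>"
  shows "norm (tr a b d) \<le> 3 * \<alpha> * \<beta> * \<gamma>"
proof -
  have "norm a * norm b * norm d \<le> \<alpha> * \<beta> * \<gamma>"
    using assms by (intro mult_mono) (auto intro!: mult_nonneg_nonneg intro: order_trans[OF norm_ge_zero])
  then show ?thesis using norm_tr[of a b d] by (simp add: mult.assoc)
qed

lemma cube_eq_0D: "cube x = 0 \<Longrightarrow> x = 0"
  using norm_cube[of x] by simp

subsection \<open>Identities of Jordan triples\<close>

text \<open>Two instances of the triple identity read a = 2 b - c and b = 2 a - c for the three
  expressions, so 3 (a - b) = 0.\<close>

lemma LQ_commute: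
  "tr x y (tr x z x) = tr (tr x y x) z x"
  "tr x y (tr x z x) = tr x (tr y x z) x"
proof -
  let ?a = "tr x y (tr x z x)" and ?b = "tr (tr x y x) z x" and ?c = "tr x (tr y x z) x"
  have 1: "?a = 2 *\<^sub>R ?b - ?c"
    using tr_identity[of x y x z x] by (simp add: scaleR_2 tr_comm[of x z "tr x y x"])
  have 2: "?b = 2 *\<^sub>R ?a - ?c"
    using tr_identity[of x z x y x]
    by (simp add: scaleR_2 tr_comm[of x z "tr x y x"] tr_comm[of "tr x z x" y x] tr_comm[of z x y])
  have "3 *\<^sub>R (?a - ?b) = (?a + ?a + ?a) - (?b + ?b + ?b)"
    using scaleR_left.add[of 1 2 "?a - ?b"] by (simp add: scaleR_2 algebra_simps)
  also have "\<dots> = (?a - (2 *\<^sub>R ?b - ?c)) - (?b - (2 *\<^sub>R ?a - ?c))"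
    by (simp add: scaleR_2 algebra_simps)
  also have "\<dots> = 0" by (simp only: 1[symmetric] 2[symmetric] diff_self)
  finally show ab: "?a = ?b" by simp
  have "?c = 2 *\<^sub>R ?b - ?a" using 1 by (simp add: algebra_simps)
  then show "?a = ?c" by (simp only: ab) (simp add: scaleR_2)
qed

lemma LQ_shift: "tr (tr x y x) y z = tr x (tr y x y) z"
  using tr_identity[of x y x y z] by simp

lemma LQ_shift_middle: "tr (tr x y x) w z + tr (tr x w x) y z = 2 *\<^sub>R tr x (tr y x w) z"
  using LQ_shift[of x "y + w" z] LQ_shift[of x y z] LQ_shift[of x w z]
  by (simp add: tr_lin scaleR_2 tr_comm[of w x y] algebra_simps)

text \<open>The fundamental formula for the quadratic operators Q(x) y = {x y x}, namely Q(Q(x) y) =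
  Q(x) Q(y) Q(x). \<open>LQ_commute\<close> moves \<open>x\<close> to both ends of every term, and
  what remains inside is again the triple identity.\<close>

lemma Q_fundamental: "tr (tr x y x) v (tr x y x) = tr x (tr y (tr x v x) y) x"
proof -
  let ?w = "tr x y x"
  have xyw: "tr x y ?w = tr x (tr y x y) x"
    by (rule LQ_commute(2))
  have "tr x y (tr x v ?w) = tr (tr x y x) v ?w - tr x (tr y x v) ?w + tr x v (tr x y ?w)"
    by (rule tr_identity)
  then have "tr ?w v ?w = tr x y (tr x v ?w) + tr x (tr y x v) ?w - tr x v (tr x y ?w)"
    by simp
  also have "\<dots> = tr x (tr y x (tr v x y)) x + tr x (tr (tr y x v) x y) x - tr x (tr v x (tr y x y)) x"
    by (simp only: xyw LQ_commute(2)[of x v y] LQ_commute(2)[of x y "tr v x y"]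
        LQ_commute(2)[of x "tr y x v" y] LQ_commute(2)[of x v "tr y x y"])
  also have "\<dots> = tr x (tr y x (tr v x y) + tr (tr y x v) x y - tr v x (tr y x y)) x"
    by (simp add: tr_lin)
  also have "tr y x (tr v x y) + tr (tr y x v) x y - tr v x (tr y x y) = tr y (tr x v x) y"
    using tr_identity[of v x y x y] by (simp add: tr_comm[of y x v] tr_comm[of "tr v x y" x y])
  finally show ?thesis .
qed

end

subsection \<open>Polynomials of an operator\<close>

lemma smult_2: "smult 2 r = r + (r :: real poly)"
  using smult_add_left[of 1 1 r] by simp

locale lin_endo =
  fixes S :: "'v::real_vector set" and K :: "'v \<Rightarrow> 'v"
  assumes sub: "subspace S"
    and K_in: "x \<in> S \<Longrightarrow> K x \<in> S"
    and K_add: "x \<in> S \<Longrightarrow> y \<in> S \<Longrightarrow> K (x + y) = K x + K y"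
    and K_scaleR: "x \<in> S \<Longrightarrow> K (r *\<^sub>R x) = r *\<^sub>R K x"
begin

text \<open>Horner evaluation at the operator \<open>K\<close>. The usual rules hold on
  \<open>S\<close> only, since \<open>K\<close> is arbitrary outside.\<close>

definition peval :: "real poly \<Rightarrow> 'v \<Rightarrow> 'v" where
  "peval p = fold_coeffs (\<lambda>c f x. c *\<^sub>R x + K (f x)) p (\<lambda>x. 0)"

lemma K_0: "K 0 = 0"
  using K_scaleR[of 0 0] subspace_0[OF sub] by simp

lemma peval_0 [simp]: "peval 0 x = 0"
  by (simp add: peval_def)

lemma peval_pCons: "peval (pCons c p) x = c *\<^sub>R x + K (peval p x)"
  by (cases "c = 0 \<and> p = 0") (auto simp: peval_def K_0)

lemma peval_1 [simp]: "peval 1 x = x"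
  by (simp add: one_pCons peval_pCons K_0)

lemma peval_X: "peval [:0, 1:] x = K x"
  by (simp add: peval_pCons K_0)

lemma peval_in: "x \<in> S \<Longrightarrow> peval p x \<in> S"
  by (induction p) (auto simp: peval_pCons intro: subspace_0 subspace_add subspace_scale K_in sub)

lemma peval_add_poly: "x \<in> S \<Longrightarrow> peval (p + q) x = peval p x + peval q x"
  by (induction p q rule: poly_induct2)
    (auto simp: peval_pCons K_add peval_in scaleR_add_left algebra_simps)

lemma peval_smult: "x \<in> S \<Longrightarrow> peval (smult c p) x = c *\<^sub>R peval p x"
  by (induction p) (auto simp: peval_pCons K_scaleR peval_in algebra_simps)

lemma peval_uminus: "x \<in> S \<Longrightarrow> peval (- p) x = - peval p x"
  using peval_smult[of x "-1" p] by simp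

lemma peval_diff_poly: "x \<in> S \<Longrightarrow> peval (p - q) x = peval p x - peval q x"
  by (simp add: peval_add_poly peval_uminus flip: add_uminus_conv_diff)

lemma peval_add: "x \<in> S \<Longrightarrow> y \<in> S \<Longrightarrow> peval p (x + y) = peval p x + peval p y"
  by (induction p) (auto simp: peval_pCons K_add peval_in algebra_simps)

lemma peval_scaleR: "x \<in> S \<Longrightarrow> peval p (r *\<^sub>R x) = r *\<^sub>R peval p x"
  by (induction p) (auto simp: peval_pCons K_scaleR peval_in algebra_simps)

lemma peval_K: "x \<in> S \<Longrightarrow> peval p (K x) = K (peval p x)"
  by (induction p) (auto simp: peval_pCons K_0 K_add K_scaleR peval_in K_in subspace_scale[OF sub])

lemma peval_mult: "x \<in> S \<Longrightarrow> peval (p * q) x = peval p (peval q x)"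
  by (induction p) (auto simp: peval_pCons peval_add_poly peval_smult)

lemma peval_comm: "x \<in> S \<Longrightarrow> peval p (peval q x) = peval q (peval p x)"
  by (simp add: mult.commute flip: peval_mult)

end

lemma scaleC_0_left [simp]: "scaleC 0 (x::'a::complex_banach) = 0"
  using scaleC_add_left[of 0 0 x] by simp

lemma scaleC_0_right [simp]: "scaleC c (0::'a::complex_banach) = 0"
  using scaleC_add_right[of c 0 "0::'a"] by simp

lemma scaleC_minus_left: "scaleC (- c) (x::'a::complex_banach) = - scaleC c x"
  using scaleC_add_left[of c "- c" x] by (simp add: eq_neg_iff_add_eq_0 add.commute)

subsection \<open>Multipliers\<close>

text \<open>\<open>C\<close> is a complex subtriple and \<open>K\<close> an operator on it that can be pulled out of each
  slot of the triple product, such as multiplication by a real function on a space of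
  functions. Real polynomials in \<open>K\<close> then behave like real functions with values in
  \<open>[-1, 1]\<close>.\<close>

locale centroid = jbstar jp invol
  for jp :: "'a::complex_banach \<Rightarrow> 'a \<Rightarrow> 'a" (infixl "\<odot>" 70) and invol :: "'a \<Rightarrow> 'a" +
  fixes C :: "'a set" and K :: "'a \<Rightarrow> 'a"
  assumes C_sub: "subspace C"
    and C_scaleC: "x \<in> C \<Longrightarrow> scaleC c x \<in> C"
    and C_tr: "x \<in> C \<Longrightarrow> y \<in> C \<Longrightarrow> z \<in> C \<Longrightarrow> tr x y z \<in> C"
    and C_K: "x \<in> C \<Longrightarrow> K x \<in> C"
    and C_K_add: "x \<in> C \<Longrightarrow> y \<in> C \<Longrightarrow> K (x + y) = K x + K y"
    and C_K_scaleC: "x \<in> C \<Longrightarrow> K (scaleC c x) = scaleC c (K x)"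
    and K_left: "x \<in> C \<Longrightarrow> y \<in> C \<Longrightarrow> z \<in> C \<Longrightarrow> tr (K x) y z = K (tr x y z)"
    and K_mid: "x \<in> C \<Longrightarrow> y \<in> C \<Longrightarrow> z \<in> C \<Longrightarrow> tr x (K y) z = K (tr x y z)"
begin

sublocale lin_endo C K
  by unfold_locales (auto simp: C_sub C_K C_K_add scaleR_scaleC C_K_scaleC)

lemma peval_scaleC: "x \<in> C \<Longrightarrow> peval p (scaleC c x) = scaleC c (peval p x)"
  by (induction p)
    (auto simp: peval_pCons C_K_scaleC peval_in scaleC_add_right scaleR_scaleC scaleC_scaleC mult.commute)

lemma tr_peval_left:
  "x \<in> C \<Longrightarrow> y \<in> C \<Longrightarrow> z \<in> C \<Longrightarrow> tr (peval p x) y z = peval p (tr x y z)"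
  by (induction p) (auto simp: peval_pCons tr_add tr_scaleR K_left peval_in)

lemma tr_peval_mid:
  "x \<in> C \<Longrightarrow> y \<in> C \<Longrightarrow> z \<in> C \<Longrightarrow> tr x (peval p y) z = peval p (tr x y z)"
  by (induction p) (auto simp: peval_pCons tr_add tr_scaleR K_mid peval_in)

lemma tr_peval:
  "x \<in> C \<Longrightarrow> y \<in> C \<Longrightarrow> z \<in> C \<Longrightarrow>
    tr (peval p x) (peval q y) (peval r z) = peval (p * q * r) (tr x y z)"
  using tr_peval_left[of z y x r] peval_comm[of "tr x y z" q p]
  by (simp add: tr_peval_left tr_peval_mid peval_in C_tr peval_mult mult.assoc tr_comm[of x y]
      peval_comm[of _ q p])

end

section \<open>Norm estimates for real polynomials in a contractive multiplier\<close>

locale multiplier = centroid +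
  assumes K_norm: "x \<in> C \<Longrightarrow> norm (K x) \<le> norm x"
begin

text \<open>An upper bound for the operator norm on \<open>C\<close>, kept as a predicate because
  \<open>C\<close> is a subset and not a type.\<close>

definition bnd :: "real poly \<Rightarrow> real \<Rightarrow> bool" where
  "bnd p c \<longleftrightarrow> (\<forall>y\<in>C. norm (peval p y) \<le> c * norm y)"

lemma bndD: "bnd p c \<Longrightarrow> y \<in> C \<Longrightarrow> norm (peval p y) \<le> c * norm y"
  by (simp add: bnd_def)

lemma bnd_mono: "bnd p c \<Longrightarrow> c \<le> d \<Longrightarrow> bnd p d"
  unfolding bnd_def by (meson mult_right_mono norm_ge_zero order_trans)

lemma bnd_1: "bnd 1 1"
  by (simp add: bnd_def)

lemma bnd_0: "bnd 0 0"
  by (simp add: bnd_def)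

lemma bnd_X: "bnd [:0, 1:] 1"
  by (simp add: bnd_def peval_X K_norm)

lemma bnd_add: "bnd p c \<Longrightarrow> bnd q d \<Longrightarrow> bnd (p + q) (c + d)"
  unfolding bnd_def
  by (auto simp: peval_add_poly distrib_right intro: order_trans[OF norm_triangle_ineq] add_mono)

lemma bnd_smult: "bnd p c \<Longrightarrow> bnd (smult r p) (\<bar>r\<bar> * c)"
  unfolding bnd_def by (auto simp: peval_smult mult.assoc intro: mult_left_mono)

lemma bnd_uminus: "bnd p c \<Longrightarrow> bnd (- p) c"
  unfolding bnd_def by (simp add: peval_uminus)

lemma bnd_diff: "bnd p c \<Longrightarrow> bnd q d \<Longrightarrow> bnd (p - q) (c + d)"
  using bnd_add[OF _ bnd_uminus] by simp

lemma bnd_mult: "bnd p c \<Longrightarrow> bnd q d \<Longrightarrow> 0 \<le> c \<Longrightarrow> bnd (p * q) (c * d)"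
  unfolding bnd_def
  by (auto simp: peval_mult mult.assoc intro!: order_trans[OF bspec[of C "\<lambda>y. norm (peval p y) \<le> c * norm y"]]
      peval_in mult_left_mono)

lemma bnd_ex: "\<exists>B\<ge>0. bnd p B"
proof (induction p)
  case 0
  then show ?case using bnd_0 by blast
next
  case (pCons a p)
  then obtain B where B: "B \<ge> 0" "bnd p B" by blast
  have "pCons a p = smult a 1 + [:0, 1:] * p" by (simp add: one_pCons)
  moreover have "bnd (smult a 1 + [:0, 1:] * p) (\<bar>a\<bar> * 1 + 1 * B)"
    using B by (intro bnd_add bnd_smult bnd_mult bnd_1 bnd_X) auto
  ultimately show ?case using B by (intro exI[of _ "\<bar>a\<bar> * 1 + 1 * B"]) auto
qed

lemma bnd_approx:
  assumes "\<And>\<delta>. \<delta> > 0 \<Longrightarrow> bnd p (c + \<delta> * M)"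
  shows "bnd p c"
proof -
  have "norm (peval p y) \<le> c * norm y" if y: "y \<in> C" for y
  proof (rule field_le_epsilon)
    fix e :: real assume e: "e > 0"
    define \<delta> where "\<delta> = e / (1 + \<bar>M\<bar> * norm y)"
    have pos: "1 + \<bar>M\<bar> * norm y > 0" by (simp add: add_pos_nonneg)
    then have "\<delta> > 0" using e by (simp add: \<delta>_def)
    then have "norm (peval p y) \<le> (c + \<delta> * M) * norm y"
      using assms y bndD by blast
    also have "\<dots> \<le> c * norm y + \<delta> * (\<bar>M\<bar> * norm y)"
      using \<open>\<delta> > 0\<close> by (simp add: distrib_right mult.assoc mult_left_mono mult_right_mono)
    also have "\<delta> * (\<bar>M\<bar> * norm y) \<le> e"
      unfolding \<delta>_def using pos e by (simp add: field_simps)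
    finally show "norm (peval p y) \<le> c * norm y + e" by simp
  qed
  then show ?thesis by (simp add: bnd_def)
qed

text \<open>The analogue of the C*-identity for a self-adjoint operator: cubing g(K) y gives g(K)
  applied to the cube of \<open>y\<close>, with two further factors g(K). A bound for the square
  thus feeds \<open>cube_improve\<close>.\<close>

lemma bnd_sqrt:
  assumes "bnd (g * g) c" "0 \<le> c"
  shows "bnd g (sqrt c)"
proof -
  obtain B where B: "bnd g B" using bnd_ex by blast
  have "norm (peval g y) \<le> sqrt c * norm y" if y: "y \<in> C" for y
  proof (rule cube_improve[where S = C and B = B and c = c and u = "\<lambda>y. norm (peval g y)"])
    fix s assume s: "s \<in> C"
    show "\<exists>s'\<in>C. norm (peval g s) ^ 3 \<le> c * norm (peval g s') \<and> norm s' \<le> norm s ^ 3"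
    proof
      show "cube s \<in> C" using s by (simp add: C_tr)
      have "cube (peval g s) = peval (g * g) (peval g (cube s))"
        using s by (simp add: tr_peval C_tr peval_mult)
      then have "norm (peval g s) ^ 3 = norm (peval (g * g) (peval g (cube s)))"
        by (metis norm_cube)
      also have "\<dots> \<le> c * norm (peval g (cube s))"
        using assms s by (intro bndD peval_in C_tr)
      finally show "norm (peval g s) ^ 3 \<le> c * norm (peval g (cube s)) \<and> norm (cube s) \<le> norm s ^ 3"
        by (simp add: norm_cube)
    qed
  qed (use assms y B bndD in auto)
  then show ?thesis by (simp add: bnd_def)
qed

text \<open>The operator \<open>V = p(K) + i g(K)\<close> is almost unimodular: cubing turns \<open>V y\<close> into
  \<open>V V* V\<close> applied to the cube of \<open>y\<close>, so that \<open>V\<close> is almost a contraction.\<close>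

lemma unimodular_bound:
  assumes pg: "p * p + g * g = 1 + e" and e: "bnd e \<delta>" and \<delta>: "0 \<le> \<delta>" and y: "y \<in> C"
  shows "norm (peval p y + scaleC \<i> (peval g y)) \<le> sqrt (1 + \<delta>) * norm y"
proof -
  define V where "V y = peval p y + scaleC \<i> (peval g y)" for y
  obtain Bp Bg where B: "bnd p Bp" "bnd g Bg" using bnd_ex by blast
  have V_scaleR: "V (r *\<^sub>R y) = r *\<^sub>R V y" if "y \<in> C" for r y
    using that by (simp add: V_def peval_scaleR scaleR_add_right)
      (simp add: scaleR_scaleC scaleC_scaleC mult.commute)
  have cube_V: "cube (V y) = V (peval (1 + e) (cube y))" if y: "y \<in> C" for y
  proof -
    let ?c = "cube y"
    have c: "?c \<in> C" using y by (simp add: C_tr)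
    have "cube (V y) = peval (p * p * p) ?c + peval (p * g * g) ?c
      + (scaleC \<i> (peval (p * p * g) ?c + peval (g * g * g) ?c))"
      unfolding V_def using y
      by (simp add: tr_add tr_scaleC tr_peval scaleC_scaleC scaleC_minus_left scaleC_one scaleC_add_right
          algebra_simps)
    also have "\<dots> = V (peval (p * p + g * g) ?c)"
      unfolding V_def peval_mult[OF c, symmetric]
      by (simp add: peval_add_poly[OF c] algebra_simps)
    finally show ?thesis by (simp add: pg)
  qed
  have "norm (V y) \<le> sqrt (1 + \<delta>) * norm y"
  proof (rule cube_improve[where S = C and B = "Bp + Bg" and u = "\<lambda>y. norm (V y)"])
    fix s assume s: "s \<in> C"
    then have c: "cube s \<in> C" by (simp add: C_tr)
    show "norm (V s) \<le> (Bp + Bg) * norm s"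
      unfolding V_def using B s
      by (auto simp: norm_scaleC distrib_right intro!: order_trans[OF norm_triangle_ineq] add_mono bndD)
    define s' where "s' = (1 / (1 + \<delta>)) *\<^sub>R peval (1 + e) (cube s)"
    have s'C: "s' \<in> C" unfolding s'_def using c by (intro subspace_scale C_sub peval_in)
    have "peval (1 + e) (cube s) = (1 + \<delta>) *\<^sub>R s'" using \<delta> by (simp add: s'_def)
    then have "cube (V s) = (1 + \<delta>) *\<^sub>R V s'" using cube_V[OF s] s'C by (simp add: V_scaleR)
    then have 1: "norm (V s) ^ 3 = (1 + \<delta>) * norm (V s')" using \<delta> by (simp flip: norm_cube)
    have "norm (peval (1 + e) (cube s)) \<le> (1 + \<delta>) * norm (cube s)"
      using bnd_add[OF bnd_1 e] c by (rule bndD)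
    then have "norm s' \<le> norm s ^ 3"
      using \<delta> by (simp add: s'_def norm_cube field_simps)
    then show "\<exists>s'\<in>C. norm (V s) ^ 3 \<le> (1 + \<delta>) * norm (V s') \<and> norm s' \<le> norm s ^ 3"
      using 1 s'C by (intro bexI[of _ s']) auto
  qed (use \<delta> y in auto)
  then show ?thesis by (simp add: V_def)
qed

text \<open>An approximate square root of 1 - g^2. The iterates \<open>q\<close> approach 1 minus
  this root; \<open>s\<close> is the same iteration with the number 1 in place of \<open>g\<close>,
  and it majorises the iterates and their increments.\<close>

lemma sqrt_one_minus_sq:
  assumes g: "bnd g 1" and \<delta>: "\<delta> > 0"
  obtains p e where "p * p + g * g = 1 + e" "bnd e \<delta>"
proof -
  define q where "q = rec_nat 0 (\<lambda>_ r. smult (1/2) (g * g + r * r))"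
  define s where "s = rec_nat (0::real) (\<lambda>_ r. (1 + r * r) / 2)"
  have q: "q 0 = 0" "q (Suc n) = smult (1/2) (g * g + q n * q n)" for n
    by (simp_all add: q_def)
  have s: "s 0 = 0" "s (Suc n) = (1 + s n * s n) / 2" for n
    by (simp_all add: s_def)
  have s01: "0 \<le> s n \<and> s n \<le> 1" for n
  proof (induction n)
    case (Suc n)
    then have "s n * s n \<le> 1" using mult_le_one by blast
    then show ?case by (simp add: s)
  qed (simp add: s)
  have s_mono: "s n \<le> s (Suc n)" for n
  proof -
    have "0 \<le> (1 - s n) * (1 - s n)" by simp
    then show ?thesis by (simp add: s algebra_simps)
  qed
  have bq: "bnd (q n) (s n)" for n
  proof (induction n)
    case (Suc n)
    have "bnd (smult (1/2) (g * g + q n * q n)) (\<bar>1/2\<bar> * (1 * 1 + s n * s n))"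
      using g Suc s01 by (intro bnd_smult bnd_add bnd_mult) auto
    then show ?case by (simp add: q s)
  qed (simp add: q s bnd_0)
  have bdq: "bnd (q (Suc n) - q n) (s (Suc n) - s n)" for n
  proof (induction n)
    case 0
    have "bnd (smult (1/2) (g * g)) (\<bar>1/2\<bar> * (1 * 1))"
      using g by (intro bnd_smult bnd_mult) auto
    then show ?case by (simp add: q s)
  next
    case (Suc n)
    have "bnd (smult (1/2) ((q (Suc n) - q n) * (q (Suc n) + q n)))
      (\<bar>1/2\<bar> * ((s (Suc n) - s n) * (s (Suc n) + s n)))"
      using s_mono[of n] by (intro bnd_smult bnd_mult bnd_add bq Suc) auto
    moreover have "q (Suc (Suc n)) - q (Suc n) = smult (1/2) ((q (Suc n) - q n) * (q (Suc n) + q n))"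
    proof -
      have "q (Suc (Suc n)) - q (Suc n) = smult (1/2) (g * g + q (Suc n) * q (Suc n) - (g * g + q n * q n))"
        unfolding q(2)[of "Suc n"] using q(2)[of n] by (metis smult_diff_right)
      then show ?thesis by (simp add: algebra_simps)
    qed
    moreover have "\<bar>1/2\<bar> * ((s (Suc n) - s n) * (s (Suc n) + s n)) = s (Suc (Suc n)) - s (Suc n)"
    proof -
      have "s (Suc (Suc n)) - s (Suc n) = (1 + s (Suc n) * s (Suc n)) / 2 - (1 + s n * s n) / 2"
        using s(2)[of "Suc n"] s(2)[of n] by linarith
      then show ?thesis by (simp add: field_simps)
    qed
    ultimately show ?case by (simp only:)
  qed
  have "incseq s" using s_mono by (rule incseq_SucI)
  then obtain L where "s \<longlonglongrightarrow> L"
    using s01 incseq_convergent[of s 1] by blast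
  then have "(\<lambda>n. s (Suc n) - s n) \<longlonglongrightarrow> L - L"
    by (intro tendsto_diff LIMSEQ_Suc)
  then have "eventually (\<lambda>n. s (Suc n) - s n < \<delta> / 2) sequentially"
    by (rule order_tendstoD(2)) (use \<delta> in simp)
  then obtain n where n: "s (Suc n) - s n < \<delta> / 2"
    by (meson eventually_at_top_linorder order_refl)
  \<comment> \<open>By the recursion the defect (1 - q n)^2 + g^2 - 1 is twice the next increment.
    Convergence of the numbers \<open>s\<close> makes it small, so no limit of polynomials is
    taken.\<close>
  show thesis
  proof (rule that[of "1 - q n" "smult 2 (q (Suc n) - q n)"])
    show "(1 - q n) * (1 - q n) + g * g = 1 + smult 2 (q (Suc n) - q n)"
    proof -
      have "smult 2 (q (Suc n)) = g * g + q n * q n" by (simp add: q)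
      then show ?thesis by (simp only: smult_diff_right smult_2) (simp add: algebra_simps)
    qed
    show "bnd (smult 2 (q (Suc n) - q n)) \<delta>"
      using bnd_mono[OF bnd_smult[OF bdq[of n], of 2], of \<delta>] n by simp
  qed
qed

text \<open>The double angle formula, with \<open>g\<close> as sine and \<open>p\<close> as cosine:
  the squares of the almost unimodular p + i g and p - i g average to p^2 - g^2, which is 1 - 2 g^2
  up to the error \<open>e\<close>.\<close>

lemma bnd_one_minus_2sq:
  assumes g: "bnd g 1"
  shows "bnd (1 - smult 2 (g * g)) 1"
proof (rule bnd_approx)
  fix \<delta> :: real assume \<delta>: "\<delta> > 0"
  then obtain p e where pe: "p * p + g * g = 1 + e" "bnd e \<delta>"
    using sqrt_one_minus_sq[OF g] by blast
  have "norm (peval (1 - smult 2 (g * g)) y) \<le> (1 + \<delta> * 2) * norm y" if y: "y \<in> C" for y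
  proof -
    define V where "V h y = peval p y + scaleC \<i> (peval h y)" for h y
    have V_in: "V h y \<in> C" if "y \<in> C" for h y
      using that by (simp add: V_def subspace_add C_sub peval_in C_scaleC)
    have V_norm: "norm (V h y) \<le> sqrt (1 + \<delta>) * norm y" if "y \<in> C" "h = g \<or> h = - g" for h y
      unfolding V_def using that pe \<delta> by (intro unimodular_bound[of _ _ e]) auto
    have VV: "norm (V h (V h y)) \<le> (1 + \<delta>) * norm y" if "h = g \<or> h = - g" for h
    proof -
      have "norm (V h (V h y)) \<le> sqrt (1 + \<delta>) * (sqrt (1 + \<delta>) * norm y)"
        using V_norm[OF V_in[OF y] that] V_norm[OF y that] \<delta>
        by (meson mult_left_mono order_trans real_sqrt_ge_zero add_nonneg_nonneg less_imp_le zero_le_one)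
      then show ?thesis using \<delta> by (simp flip: mult.assoc)
    qed
    have V2: "V h (V h y) = peval (p * p - h * h) y + scaleC \<i> (peval (smult 2 (p * h)) y)" for h
    proof -
      have "V h (V h y) = peval (p * p) y + scaleC \<i> (peval (p * h) y)
          + scaleC \<i> (peval (p * h) y) - peval (h * h) y"
        unfolding V_def using y
        by (simp add: peval_add peval_in peval_scaleC C_scaleC scaleC_add_right scaleC_scaleC
            scaleC_minus_left scaleC_one peval_mult peval_comm[OF y, of h p])
      then show ?thesis
        using y by (simp add: peval_diff_poly peval_smult scaleR_2 scaleC_add_right)
    qed
    have "V g (V g y) + V (- g) (V (- g) y) = 2 *\<^sub>R peval (p * p - g * g) y
        + scaleC \<i> (peval (smult 2 (p * g)) y + peval (smult 2 (p * (- g))) y)"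
      unfolding V2 by (simp add: scaleR_2 scaleC_add_right)
    also have "peval (smult 2 (p * g)) y + peval (smult 2 (p * (- g))) y = 0"
      using y by (simp flip: peval_add_poly)
    finally have "V g (V g y) + V (- g) (V (- g) y) = 2 *\<^sub>R peval (p * p - g * g) y"
      by simp
    also have "p * p - g * g = (1 - smult 2 (g * g)) + e"
    proof -
      have "p * p = 1 + e - g * g" using pe(1) by (metis add_diff_cancel_right')
      then show ?thesis by (simp add: smult_2)
    qed
    finally have "2 *\<^sub>R peval (1 - smult 2 (g * g)) y
        = V g (V g y) + V (- g) (V (- g) y) - 2 *\<^sub>R peval e y"
      using y by (simp add: peval_add_poly scaleR_add_right)
    then have "2 * norm (peval (1 - smult 2 (g * g)) y)
        = norm (V g (V g y) + V (- g) (V (- g) y) - 2 *\<^sub>R peval e y)"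
      by (metis abs_numeral norm_scaleR)
    also have "\<dots> \<le> norm (V g (V g y)) + norm (V (- g) (V (- g) y)) + 2 * norm (peval e y)"
      using norm_triangle_ineq4[of "V g (V g y) + V (- g) (V (- g) y)" "2 *\<^sub>R peval e y"]
        norm_triangle_ineq[of "V g (V g y)" "V (- g) (V (- g) y)"] by simp
    also have "\<dots> \<le> (1 + \<delta>) * norm y + (1 + \<delta>) * norm y + 2 * (\<delta> * norm y)"
      using VV bndD[OF pe(2) y] by (intro add_mono) auto
    finally show ?thesis by (simp add: algebra_simps)
  qed
  then show "bnd (1 - smult 2 (g * g)) (1 + \<delta> * 2)" by (simp add: bnd_def)
qed

lemma bnd_one_minus:
  assumes "bnd (1 - smult 2 h) 1"
  shows "bnd (1 - h) 1"
proof -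
  have "1 - h = smult (1/2) 1 + smult (1/2) (1 - smult 2 h)"
    by (simp add: smult_diff_right one_pCons numeral_poly)
  moreover have "bnd (smult (1/2) 1 + smult (1/2) (1 - smult 2 h)) (\<bar>1/2\<bar> * 1 + \<bar>1/2\<bar> * 1)"
    by (intro bnd_add bnd_smult bnd_1 assms)
  ultimately show ?thesis by simp
qed

lemma bnd_one_minus_sq: "bnd g 1 \<Longrightarrow> bnd (1 - g * g) 1"
  by (rule bnd_one_minus) (rule bnd_one_minus_2sq)

text \<open>Up to a small error 1 - g^2 is a square p^2, so the product is the square of
  \<open>p * w\<close>, and \<open>bnd_one_minus_2sq\<close> applies after rescaling. With
  \<open>w\<close> a power of 1 - g^2 this handles odd powers.\<close>

lemma bnd_one_minus_mult:
  assumes g: "bnd g 1" and w: "bnd w 1"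
  shows "bnd (1 - (1 - g * g) * (w * w)) 1"
proof (rule bnd_one_minus, rule bnd_approx)
  fix \<delta> :: real assume \<delta>: "\<delta> > 0"
  then obtain p e where pe: "p * p + g * g = 1 + e" "bnd e \<delta>"
    using sqrt_one_minus_sq[OF g] by blast
  have pp: "p * p = (1 - g * g) + e" using pe(1) by (simp add: algebra_simps)
  have "bnd (p * p) (1 + \<delta>)"
    unfolding pp by (intro bnd_add bnd_one_minus_sq g pe)
  then have "bnd p (sqrt (1 + \<delta>))" using \<delta> by (intro bnd_sqrt) auto
  then have "bnd (smult (1 / sqrt (1 + \<delta>)) (p * w)) (\<bar>1 / sqrt (1 + \<delta>)\<bar> * (sqrt (1 + \<delta>) * 1))"
    using w \<delta> by (intro bnd_smult bnd_mult) auto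
  then have "bnd (smult (1 / sqrt (1 + \<delta>)) (p * w)) 1"
    using \<delta> by (simp add: field_simps)
  from bnd_one_minus_2sq[OF this]
  have "bnd (1 - smult (2 / (1 + \<delta>)) (p * p * (w * w))) 1"
    using \<delta> by (simp add: mult_ac)
  then have *: "bnd (smult (1 + \<delta>) (1 - smult (2 / (1 + \<delta>)) (p * p * (w * w)))) (\<bar>1 + \<delta>\<bar> * 1)"
    by (rule bnd_smult)
  then have 1: "bnd (smult (1 + \<delta>) 1 - smult 2 (p * p * (w * w))) (1 + \<delta>)"
  proof -
    have "(1 + \<delta>) * (2 / (1 + \<delta>)) = 2" using \<delta> by (simp add: field_simps)
    then show ?thesis
      using * \<delta> by (simp only: smult_diff_right smult_smult) simp
  qed
  have "bnd (smult (1 + \<delta>) 1 - smult 2 (p * p * (w * w)) + smult 2 (e * (w * w)) - smult \<delta> 1)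
     ((1 + \<delta>) + \<bar>2\<bar> * (\<delta> * (1 * 1)) + \<bar>\<delta>\<bar> * 1)"
    using \<delta> by (intro bnd_diff bnd_add 1 bnd_smult bnd_mult pe w bnd_1) auto
  moreover have "smult (1 + \<delta>) 1 - smult 2 (p * p * (w * w)) + smult 2 (e * (w * w)) - smult \<delta> 1
     = 1 - smult 2 ((1 - g * g) * (w * w))"
    unfolding pp by (simp add: smult_add_left smult_diff_right smult_add_right algebra_simps)
  ultimately have "bnd (1 - smult 2 ((1 - g * g) * (w * w))) ((1 + \<delta>) + \<bar>2\<bar> * (\<delta> * (1 * 1)) + \<bar>\<delta>\<bar> * 1)"
    by (simp only:)
  then show "bnd (1 - smult 2 ((1 - g * g) * (w * w))) (1 + \<delta> * 4)"
    by (rule bnd_mono) (use \<delta> in simp)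
qed

end

context jbstar
begin

text \<open>Complex multiples of the powers are included because the almost unimodular operators use
  \<open>\<i>\<close>. The shift \<open>m\<close> is 1 for odd powers in a triple and 2 for powers
  of a self-adjoint element.\<close>

lemma centroid_span:
  assumes K_add: "\<And>x y. K (x + y) = K x + K y" and K_scaleC: "\<And>c x. K (scaleC c x) = scaleC c (K x)"
    and Kp: "\<And>k. K (p k) = p (Suc k)" and trp: "\<And>i j k. tr (p i) (p j) (p k) = p (i + j + k + m)"
  defines "G \<equiv> {scaleC c (p k) | c k. True}"
  shows "centroid jp invol (span G) K"
proof -
  have G: "scaleC c (p k) \<in> span G" for c k
    unfolding G_def by (rule span_base) blast
  have K_scaleR: "K (r *\<^sub>R x) = r *\<^sub>R K x" for r x
    by (simp add: scaleR_scaleC K_scaleC)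
  have scale_in: "scaleC c x \<in> span G" if "x \<in> span G" for c x
    using that
  proof (induction rule: span_induct_alt)
    case (step r x y)
    then obtain d k where "x = scaleC d (p k)" by (auto simp: G_def)
    then have "scaleC c (r *\<^sub>R x + y) = r *\<^sub>R scaleC (c * d) (p k) + scaleC c y"
      by (simp add: scaleC_add_right scaleR_scaleC scaleC_scaleC mult_ac)
    then show ?case using step G by (simp add: span_add span_scale)
  qed (simp add: span_zero)
  have K_in: "K x \<in> span G" if "x \<in> span G" for x
    using that
  proof (induction rule: span_induct_alt)
    case base
    show ?case using K_scaleR[of 0 0] by (simp add: span_zero)
  next
    case (step r x y)
    then obtain d k where "x = scaleC d (p k)" by (auto simp: G_def)
    then show ?case using step G by (simp add: K_add K_scaleR K_scaleC Kp span_add span_scale)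
  qed
  \<comment> \<open>Trilinear induction: a property compatible with linear combinations in each slot
    is checked on generators only.\<close>
  have tri_induct: "Q x y z"
    if xyz: "x \<in> span G" "y \<in> span G" "z \<in> span G"
    and z1: "\<And>y z. Q 0 y z" and z2: "\<And>x z. Q x 0 z" and z3: "\<And>x y. Q x y 0"
    and s1: "\<And>r x x' y z. Q x y z \<Longrightarrow> Q x' y z \<Longrightarrow> Q (r *\<^sub>R x + x') y z"
    and s2: "\<And>r x y y' z. Q x y z \<Longrightarrow> Q x y' z \<Longrightarrow> Q x (r *\<^sub>R y + y') z"
    and s3: "\<And>r x y z z'. Q x y z \<Longrightarrow> Q x y z' \<Longrightarrow> Q x y (r *\<^sub>R z + z')"
    and g: "\<And>a b c i j k. Q (scaleC a (p i)) (scaleC b (p j)) (scaleC c (p k))"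
    for Q and x y z :: 'a
  proof -
    have 1: "Q x y z" if "x \<in> G" "y \<in> G" "z \<in> span G" for x y z
      using that(3)
    proof (induction rule: span_induct_alt)
      case (step r v w)
      show ?case using that step g by (intro s3) (auto simp: G_def)
    qed (rule z3)
    have 2: "Q x y z" if "x \<in> G" "y \<in> span G" "z \<in> span G" for x y z
      using that(2) by (induction rule: span_induct_alt) (auto intro: z2 s2 1 that)
    show ?thesis
      using xyz(1) by (induction rule: span_induct_alt) (auto intro: z1 s1 2 xyz)
  qed
  show ?thesis
  proof unfold_locales
    show "subspace (span G)" by simp
    show "x \<in> span G \<Longrightarrow> scaleC c x \<in> span G" for x c by (rule scale_in)
    show "x \<in> span G \<Longrightarrow> K x \<in> span G" for x by (rule K_in)
    fix x y z assume xyz: "x \<in> span G" "y \<in> span G" "z \<in> span G"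
    show "tr x y z \<in> span G"
      using xyz by (rule tri_induct)
        (simp_all add: tr_lin tr_scaleC trp scaleC_scaleC span_zero span_add span_scale G)
    show "tr (K x) y z = K (tr x y z)"
      using xyz by (rule tri_induct)
        (simp_all add: tr_lin tr_scaleC trp Kp K_add K_scaleR K_scaleC K_scaleR[of 0 0, simplified])
    show "tr x (K y) z = K (tr x y z)"
      using xyz by (rule tri_induct)
        (simp_all add: tr_lin tr_scaleC trp Kp K_add K_scaleR K_scaleC K_scaleR[of 0 0, simplified])
  qed (rule K_add K_scaleC)+
qed

subsection \<open>Odd powers\<close>

text \<open>Power associativity of Jordan triples, by induction on the total index.\<close>

lemma tr_odd_powers:
  defines "p \<equiv> \<lambda>k u. ((tr u u) ^^ k) u"
  shows "tr (p i u) (p j u) (p k u) = p (i + j + k + 1) u"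
proof -
  have "\<forall>i j k. i + j + k \<le> n \<longrightarrow> tr (p i u) (p j u) (p k u) = p (i + j + k + 1) u" for n
  proof (induction n)
    case 0
    then show ?case by (simp add: p_def)
  next
    case (Suc n)
    define s where "s a b c = tr (p a u) (p b u) (p c u)" for a b c
    define P where "P = p (n + 2) u"
    have IH: "s a b c = p (a + b + c + 1) u" if "a + b + c \<le> n" for a b c
      using Suc that by (simp add: s_def)
    have sym: "s a b c = s c b a" for a b c
      by (simp add: s_def tr_comm)
    \<comment> \<open>All inner products have total index at most \<open>n\<close> and are known, so
      the triple identity becomes a linear relation between products of total index
      \<open>n + 1\<close>. These relations determine all of them.\<close>
    have eq: "s a b (c + d + e + 1) = s (a + b + c + 1) d e - s c (a + b + d + 1) e + s c d (a + b + e + 1)"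
      if "a + b + c + d + e = n" for a b c d e
      using tr_identity[of "p a u" "p b u" "p c u" "p d u" "p e u"]
        IH[of a b c] IH[of c d e] IH[of b a d] IH[of a b e] that
      by (simp add: s_def add.commute[of b a])
    have s00: "s 0 0 (Suc n) = P" by (simp add: s_def P_def p_def)
    have s00': "s (Suc n) 0 0 = P" using s00 sym by metis
    have X: "s 0 (Suc n) 0 = P"
    proof -
      have 1: "s 0 n 1 = P - s 0 (Suc n) 0 + P"
        using eq[of 0 n 0 0 0] s00 s00' by simp
      have 2: "P = s 1 n 0 - s 0 (Suc n) 0 + s 0 n 1"
        using eq[of 0 0 0 n 0] s00 by simp
      have "P = 2 *\<^sub>R (P - s 0 (Suc n) 0 + P) - s 0 (Suc n) 0"
        using 2 unfolding sym[of 1 n 0] 1 by (simp add: scaleR_2 algebra_simps)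
      then have "3 *\<^sub>R (P - s 0 (Suc n) 0) = 0"
        using scaleR_left.add[of 1 2 "P - s 0 (Suc n) 0"] by (simp add: scaleR_2 algebra_simps)
      then show ?thesis by simp
    qed
    have s1: "s a b 1 = P" if "a + b = n" for a b
      using eq[of a b 0 0 0] that s00 s00' X by simp
    have s0: "s 0 j k = P" if "j + k = Suc n" for j k
      using that
    proof (induction j arbitrary: k)
      case (Suc j)
      have "s 0 0 (Suc n) = s 1 j k - s 0 (Suc j) k + s 0 j (Suc k)"
        using eq[of 0 0 0 j k] Suc.prems by simp
      then show ?case using Suc.IH[of "Suc k"] Suc.prems s1[of k j] s00 sym[of k j 1] by simp
    qed (use s00 in simp)
    have step: "s a b (Suc e) = s (a + b + 1) 0 e" if "a + b + e = n" for a b e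
      using eq[of a b 0 0 e] that s0[of "a + b + 1" e] s00 by simp
    have sa: "s a 0 k = P" if "a + k = Suc n" for a k
      using that by (induction k arbitrary: a) (use s00' step[of _ 0] in auto)
    have "s a b c = P" if "a + b + c = Suc n" for a b c
    proof (cases c)
      case 0
      then show ?thesis using s0[of b a] that sym[of a b 0] by simp
    next
      case (Suc e)
      then show ?thesis using step[of a b e] sa[of "a + b + 1" e] that by simp
    qed
    then show ?case
      using Suc by (auto simp: s_def P_def le_Suc_eq)
  qed
  then show ?thesis by blast
qed

text \<open>As long as \<open>p m\<close> has norm at most 1, its box operator has the bound 3
  independently of \<open>m\<close>, and it is the power \<open>2 * m + 1\<close> of the operator in
  question. Cubing sends \<open>m\<close> to \<open>3 * m + 1\<close>, so
  \<open>cube_improve\<close> on pairs of an index and a vector turns 3 into 1.\<close>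

lemma odd_power_multiplier:
  assumes u: "norm u \<le> 1"
  obtains C where "multiplier jp invol C (tr u u)" "u \<in> C"
proof -
  define p where "p k = ((tr u u) ^^ k) u" for k
  define C where "C = span {scaleC c (p k) | c k. True}"
  interpret centroid jp invol C "tr u u"
    unfolding C_def
  proof (rule centroid_span)
    show "tr (p i) (p j) (p k) = p (i + j + k + 1)" for i j k
      unfolding p_def by (rule tr_odd_powers)
  qed (simp_all add: tr_add tr_scaleC p_def)
  have uC: "u \<in> C"
    unfolding C_def by (rule span_base) (auto simp: p_def scaleC_one intro!: exI[of _ 1] exI[of _ "0::nat"])
  define X :: "real poly" where "X = [:0, 1:]"
  have peX: "peval X y = tr u u y" for y
    unfolding X_def by (rule peval_X)
  have p: "p k = peval (X ^ k) u" for k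
    by (induction k) (simp_all add: p_def peval_mult uC peX)
  have p_tr: "tr (p m) (p m) y = peval (X ^ (2 * m + 1)) y" if "y \<in> C" for m y
    using that uC tr_peval[of u u y "X ^ m" "X ^ m" 1]
    by (simp add: p peval_mult peX mult_2 power_add peval_K C_tr peval_in)
  have "norm (tr u u y) \<le> norm y" if y: "y \<in> C" for y
  proof -
    define S where "S = {(m, y). norm (p m) \<le> 1 \<and> y \<in> C}"
    have "norm (peval (X ^ (2 * fst (0::nat, y) + 1)) (snd (0::nat, y))) \<le> sqrt 1 * norm (snd (0::nat, y))"
    proof (rule cube_improve[where S = S and B = 3 and c = 1
        and u = "\<lambda>s. norm (peval (X ^ (2 * fst s + 1)) (snd s))" and v = "\<lambda>s. norm (snd s)" and s = "(0, y)"])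
      fix s assume s: "s \<in> S"
      then obtain m x where s_eq: "s = (m, x)" and m: "norm (p m) \<le> 1" and x: "x \<in> C"
        by (auto simp: S_def)
      show "norm (peval (X ^ (2 * fst s + 1)) (snd s)) \<le> 3 * norm (snd s)"
        using norm_tr_le[OF m m, of x "norm x"] x p_tr[OF x, of m] by (simp add: s_eq)
      have "p (3 * m + 1) = cube (p m)"
        using tr_odd_powers[of m u m m] by (simp add: p_def numeral_3_eq_3 add.assoc)
      then have "norm (p (3 * m + 1)) \<le> 1"
        using m by (simp add: norm_cube power_le_one)
      then have S': "(3 * m + 1, cube x) \<in> S" using x by (simp add: S_def C_tr)
      have "cube (peval (X ^ (2 * m + 1)) x) = peval (X ^ (2 * (3 * m + 1) + 1)) (cube x)"
      proof -
        have "X ^ (2 * m + 1) * X ^ (2 * m + 1) * X ^ (2 * m + 1) = X ^ (2 * (3 * m + 1) + 1)"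
          unfolding power_add[symmetric] by (rule arg_cong[of _ _ "(^) X"]) simp
        then show ?thesis using x by (simp only: tr_peval)
      qed
      then have "norm (peval (X ^ (2 * m + 1)) x) ^ 3 = norm (peval (X ^ (2 * (3 * m + 1) + 1)) (cube x))"
        by (metis norm_cube)
      then show "\<exists>s'\<in>S. norm (peval (X ^ (2 * fst s + 1)) (snd s)) ^ 3
          \<le> 1 * norm (peval (X ^ (2 * fst s' + 1)) (snd s')) \<and> norm (snd s') \<le> norm (snd s) ^ 3"
        using S' by (intro bexI[of _ "(3 * m + 1, cube x)"]) (simp_all add: s_eq norm_cube)
    qed (use y u in \<open>auto simp: S_def p_def\<close>)
    then show ?thesis by (simp add: peX)
  qed
  then have "multiplier jp invol C (tr u u)"
    by unfold_locales
  then show thesis using uC that by blast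
qed

text \<open>At an extreme point \<open>u\<close> the functions of absolute value at most one must be unimodular:
  otherwise \<open>u\<close> could be moved a little in the direction \<open>u - L\<^sup>2 u\<close>.\<close>

lemma extreme_point_power:
  assumes u: "norm u \<le> 1"
    and extreme: "\<And>r. norm (u + r *\<^sub>R (u - tr u u (tr u u u))) \<le> 1 \<Longrightarrow>
      norm (u - r *\<^sub>R (u - tr u u (tr u u u))) \<le> 1 \<Longrightarrow> r *\<^sub>R (u - tr u u (tr u u u)) = 0"
  shows "tr u u (tr u u u) = u"
proof -
  obtain C where "multiplier jp invol C (tr u u)" and uC: "u \<in> C"
    using odd_power_multiplier[OF u] by blast
  then interpret multiplier jp invol C "tr u u" by blast
  define X :: "real poly" where "X = [:0, 1:]"
  have peX: "peval X y = tr u u y" for y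
    unfolding X_def by (rule peval_X)
  define Y where "Y = 1 - X * X"
  \<comment> \<open>The coefficient 1/4 cancels the term linear in \<open>Y\<close> of (1 + Y/4)^4
    (1 - Y); all higher coefficients are then negative.\<close>
  define q where "q = 1 + smult (1/4) Y"
  have X: "bnd X 1" unfolding X_def by (rule bnd_X)
  have Y: "bnd Y 1" unfolding Y_def by (rule bnd_one_minus_sq[OF X])
  have YY: "bnd (Y * Y) 1" using bnd_mult[OF Y Y] by simp
  \<comment> \<open>\<open>(q\<^sup>2 X)\<^sup>2 = (1 + Y/4)\<^sup>4 (1 - Y)\<close> is a convex combination of the contractions \<open>1 - Y\<^sup>k\<close>, \<open>2 \<le> k \<le> 5\<close>\<close>
  have "bnd (smult (5/8) (1 - Y * Y) + smult (5/16) (1 - Y * (Y * Y))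
      + smult (15/256) (1 - (Y * Y) * (Y * Y)) + smult (1/256) (1 - Y * ((Y * Y) * (Y * Y))))
      (\<bar>5/8\<bar> * 1 + \<bar>5/16\<bar> * 1 + \<bar>15/256\<bar> * 1 + \<bar>1/256\<bar> * 1)"
    using bnd_one_minus_mult[OF X Y] bnd_one_minus_mult[OF X YY]
    by (intro bnd_add bnd_smult bnd_one_minus_sq Y YY) (simp_all flip: Y_def)
  moreover have "smult (5/8) (1 - Y * Y) + smult (5/16) (1 - Y * (Y * Y))
      + smult (15/256) (1 - (Y * Y) * (Y * Y)) + smult (1/256) (1 - Y * ((Y * Y) * (Y * Y)))
      = (q * q * X) * (q * q * X)"
    unfolding poly_eq_poly_eq_iff[symmetric] q_def Y_def
    by (rule ext) (simp add: field_simps power2_eq_square)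
  ultimately have "bnd ((q * q * X) * (q * q * X)) 1" by simp
  then have h: "bnd (q * q * X) 1"
    using bnd_sqrt[of "q * q * X" 1] by simp
  have qu: "peval q u = u + (1/4) *\<^sub>R (u - tr u u (tr u u u))"
    unfolding q_def Y_def using uC
    by (simp add: peval_add_poly peval_smult peval_diff_poly peval_mult peX C_tr)
  have "cube (peval q u) = peval (q * q * X) (peval q u)"
  proof -
    have "cube (peval q u) = peval (q * q * q) (peval X u)"
      using uC by (simp add: tr_peval peX)
    also have "\<dots> = peval ((q * q * X) * q) u"
      using uC by (simp add: mult_ac flip: peval_mult)
    finally show ?thesis using uC by (simp add: peval_mult)
  qed
  then have "norm (peval q u) ^ 3 \<le> 1 * norm (peval q u)"
    using bndD[OF h peval_in[OF uC, of q]] by (metis norm_cube)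
  then have "norm (peval q u) \<le> 1"
    by (metis (no_types, opaque_lifting) linorder_not_le mult_1 norm_ge_zero power_increasing_iff
        power_one_right one_less_numeral_iff semiring_norm(77))
  then have 1: "norm (u + (1/4) *\<^sub>R (u - tr u u (tr u u u))) \<le> 1" by (simp add: qu)
  have "u - (1/4) *\<^sub>R (u - tr u u (tr u u u)) = (3/4) *\<^sub>R u + (1/4) *\<^sub>R tr u u (tr u u u)"
    by (simp add: scaleR_diff_right algebra_simps flip: scaleR_add_left)
  moreover have "norm (tr u u (tr u u u)) \<le> 1"
    using K_norm[OF uC] K_norm[OF C_K[OF uC]] u by linarith
  ultimately have "norm (u - (1/4) *\<^sub>R (u - tr u u (tr u u u))) \<le> 1"
    using norm_triangle_ineq[of "(3/4) *\<^sub>R u" "(1/4) *\<^sub>R tr u u (tr u u u)"] u by simp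
  from extreme[OF 1 this] show ?thesis by simp
qed

end

subsection \<open>Ideals and signed tripotents\<close>

text \<open>An extreme point \<open>u\<close> only satisfies \<open>L\<^sup>2 u = u\<close>, so it splits into two
  orthogonal elements \<open>e\<^sub>1\<close> and \<open>e\<^sub>2\<close> whose cubes are \<open>e\<^sub>1\<close> and \<open>- e\<^sub>2\<close>. The operator \<open>H\<close>
  plays the role of \<open>L(e, e)\<close> for a genuine tripotent \<open>e\<close>.\<close>

locale signed_tripotent = jbstar jp invol
  for jp :: "'a::complex_banach \<Rightarrow> 'a \<Rightarrow> 'a" (infixl "\<odot>" 70) and invol :: "'a \<Rightarrow> 'a" +
  fixes e1 e2 :: 'a
  assumes e111: "tr e1 e1 e1 = e1" and e222: "tr e2 e2 e2 = - e2"
    and e112: "tr e1 e1 e2 = 0" and e221: "tr e2 e2 e1 = 0"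
    and e121: "tr e1 e2 e1 = 0" and e212: "tr e2 e1 e2 = 0"
begin

lemma e12: "tr e1 e2 x = 0"
  using LQ_shift_middle[of e1 e1 e2 x] by (simp add: e111 e121 e112)

lemma e21: "tr e2 e1 x = 0"
  using LQ_shift_middle[of e2 e2 e1 x] by (simp add: e222 e212 e221 tr_minus)

abbreviation "L1 x \<equiv> tr e1 e1 x"
abbreviation "L2 x \<equiv> tr e2 e2 x"

lemma QQ1: "tr e1 (tr e1 x e1) e1 = 2 *\<^sub>R L1 (L1 x) - L1 x"
proof -
  have "tr x e1 e1 = tr (tr x e1 e1) e1 e1 - tr e1 (tr e1 x e1) e1 + tr e1 e1 (tr x e1 e1)"
    using tr_identity[of x e1 e1 e1 e1] by (simp add: e111)
  then show ?thesis
    by (simp add: tr_comm[of _ e1 e1] scaleR_2 algebra_simps)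
qed

lemma QQ2: "tr e2 (tr e2 x e2) e2 = 2 *\<^sub>R L2 (L2 x) + L2 x"
proof -
  have "- tr x e2 e2 = tr (tr x e2 e2) e2 e2 - tr e2 (tr e2 x e2) e2 + tr e2 e2 (tr x e2 e2)"
    using tr_identity[of x e2 e2 e2 e2] by (simp add: e222 tr_minus)
  then have "tr e2 (tr e2 x e2) e2 = tr (tr x e2 e2) e2 e2 + tr e2 e2 (tr x e2 e2) + tr x e2 e2"
    by (simp add: eq_diff_eq diff_eq_eq algebra_simps)
  then show ?thesis
    by (simp add: tr_comm[of _ e2 e2] scaleR_2 algebra_simps)
qed

text \<open>The Peirce polynomial t (2 t - 1) (t - 1): \<open>L1\<close> fixes the range of the
  quadratic operator of \<open>e1\<close>, whose square is 2 L1^2 - L1.\<close>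

lemma L1_cubic: "2 *\<^sub>R L1 (L1 (L1 x)) = 3 *\<^sub>R L1 (L1 x) - L1 x"
proof -
  have "L1 (tr e1 (tr e1 x e1) e1) = tr e1 (tr e1 x e1) e1"
    by (simp add: LQ_commute(1) e111)
  then have "2 *\<^sub>R L1 (L1 (L1 x)) - L1 (L1 x) = 2 *\<^sub>R L1 (L1 x) - L1 x"
    unfolding QQ1 by (simp add: tr_lin)
  then show ?thesis
    using scaleR_left.add[of 1 2 "L1 (L1 x)"] by (simp add: algebra_simps)
qed

lemma L2_cubic: "2 *\<^sub>R L2 (L2 (L2 x)) = - (3 *\<^sub>R L2 (L2 x)) - L2 x"
proof -
  have "L2 (tr e2 (tr e2 x e2) e2) = - tr e2 (tr e2 x e2) e2"
    by (simp add: LQ_commute(1) e222 tr_minus)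
  then have "2 *\<^sub>R L2 (L2 (L2 x)) + L2 (L2 x) = - (2 *\<^sub>R L2 (L2 x) + L2 x)"
    unfolding QQ2 by (simp add: tr_lin)
  then show ?thesis
    using scaleR_left.add[of 1 2 "L2 (L2 x)"] by (simp add: algebra_simps eq_neg_iff_add_eq_0)
qed

lemma L12_commute: "L1 (L2 x) = L2 (L1 x)"
  using tr_identity[of e1 e1 e2 e2 x] by (simp add: e112)

lemma L2Q1: "L2 (tr e1 x e1) = 0"
proof -
  have "tr e1 (L2 x) e1 = 0"
    using tr_identity[of e2 x e1 e2 e1]
    by (simp add: e121 tr_comm[of "tr e2 x e1" e2 e1] e12 tr_comm[of x e2 e2])
  then show ?thesis
    using tr_identity[of e2 e2 e1 x e1] by (simp add: e221)
qed

lemma L1Q2: "L1 (tr e2 x e2) = 0"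
proof -
  have "tr e2 (L1 x) e2 = 0"
    using tr_identity[of e1 x e2 e1 e2]
    by (simp add: e212 tr_comm[of "tr e1 x e2" e1 e2] e21 tr_comm[of x e1 e1])
  then show ?thesis
    using tr_identity[of e1 e1 e2 x e2] by (simp add: e112)
qed

text \<open>Each of \<open>L1\<close> and \<open>L2\<close> annihilates the range of the other
  quadratic operator. Hence on the range of their product \<open>L1\<close> acts as 1/2 and
  \<open>L2\<close> as -1/2.\<close>

lemma L12_mixed:
  "2 *\<^sub>R L1 (L1 (L2 x)) = L1 (L2 x)" "2 *\<^sub>R L1 (L2 (L2 x)) = - L1 (L2 x)"
proof -
  have "L2 (2 *\<^sub>R L1 (L1 x) - L1 x) = 0"
    by (simp only: L2Q1 flip: QQ1)
  then show "2 *\<^sub>R L1 (L1 (L2 x)) = L1 (L2 x)"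
    by (simp add: tr_lin L12_commute)
  have "L1 (2 *\<^sub>R L2 (L2 x) + L2 x) = 0"
    by (simp only: L1Q2 flip: QQ2)
  then show "2 *\<^sub>R L1 (L2 (L2 x)) = - L1 (L2 x)"
    by (simp add: tr_lin eq_neg_iff_add_eq_0)
qed

text \<open>The minus sign compensates the negative cube of \<open>e2\<close>, so that both elements
  have degree 1.\<close>

definition H :: "'a \<Rightarrow> 'a" where "H x = L1 x - L2 x"

lemma H_lin: "H (x + y) = H x + H y" "H (x - y) = H x - H y" "H (- x) = - H x"
  "H (r *\<^sub>R x) = r *\<^sub>R H x" "H 0 = 0"
  by (simp_all add: H_def tr_lin algebra_simps)

text \<open>The joint values of \<open>L1\<close> and \<open>L2\<close> have one entry 0, or are the
  pair 1/2, -1/2 by \<open>L12_mixed\<close>. In all cases the difference is 0, 1/2 or 1, as for a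
  single tripotent.\<close>

lemma H_cubic: "2 *\<^sub>R H (H (H x)) = 3 *\<^sub>R H (H x) - H x"
proof -
  let ?a = "L1 (L1 (L2 x))" and ?b = "L1 (L2 (L2 x))" and ?c = "L1 (L2 x)"
  have HH: "H (H x) = L1 (L1 x) - 2 *\<^sub>R ?c + L2 (L2 x)"
    by (simp add: H_def tr_lin L12_commute scaleR_2)
  have "H (H (H x)) = L1 (L1 (L1 x)) - 3 *\<^sub>R ?a + 3 *\<^sub>R ?b - L2 (L2 (L2 x))"
    using scaleR_left.add[of 1 2 ?a] scaleR_left.add[of 1 2 ?b]
    unfolding HH by (simp add: H_def tr_lin L12_commute scaleR_2 algebra_simps)
  then have "2 *\<^sub>R H (H (H x)) = 2 *\<^sub>R (L1 (L1 (L1 x)) - 3 *\<^sub>R ?a + 3 *\<^sub>R ?b - L2 (L2 (L2 x)))"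
    by (simp only:)
  also have "\<dots> = 2 *\<^sub>R L1 (L1 (L1 x)) - 3 *\<^sub>R (2 *\<^sub>R ?a) + 3 *\<^sub>R (2 *\<^sub>R ?b)
      - 2 *\<^sub>R L2 (L2 (L2 x))"
    by (simp add: algebra_simps)
  also have "\<dots> = 3 *\<^sub>R (L1 (L1 x) - 2 *\<^sub>R ?c + L2 (L2 x)) - (L1 x - L2 x)"
    unfolding L1_cubic L2_cubic L12_mixed
    using scaleR_left.add[of 3 3 ?c] by (simp add: algebra_simps)
  finally show ?thesis by (simp add: HH) (simp add: H_def)
qed

lemma H_tr: "H (tr x y z) = tr (H x) y z - tr x (H y) z + tr x y (H z)"
  unfolding H_def tr_identity[of e1 e1 x y z] tr_identity[of e2 e2 x y z]
  by (simp add: tr_lin algebra_simps)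

text \<open>On the kernel \<open>L1\<close> and \<open>L2\<close> agree, and the two mixed relations
  then express the third power of \<open>L1\<close> by its square with opposite signs.\<close>

lemma H_ker:
  assumes "H z = 0"
  shows "L1 z = 0" "L2 z = 0"
proof -
  have eq: "L1 z = L2 z" using assms by (simp add: H_def)
  have 1: "2 *\<^sub>R L1 (L1 (L1 z)) = L1 (L1 z)"
    using L12_mixed(1)[of z] by (simp add: eq)
  have "L2 (L2 z) = L1 (L1 z)" using L12_commute[of z] eq by simp
  then have "2 *\<^sub>R L1 (L1 (L1 z)) = - L1 (L1 z)"
    using L12_mixed(2)[of z] by (simp only: eq[symmetric])
  with 1 have "L1 (L1 z) = - L1 (L1 z)" by simp
  then have "2 *\<^sub>R L1 (L1 z) = 0" by (simp add: scaleR_2 eq_neg_iff_add_eq_0)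
  then have "L1 (L1 z) = 0" by simp
  then show "L1 z = 0" using L1_cubic[of z] by simp
  then show "L2 z = 0" using eq by simp
qed

definition grade :: "real \<Rightarrow> 'a set" where "grade \<alpha> = {x. H x = \<alpha> *\<^sub>R x}"

lemma grade_0: "x \<in> grade 0 \<longleftrightarrow> H x = 0"
  by (simp add: grade_def)

text \<open>The Peirce multiplication rule: \<open>H\<close> is a derivation up to the sign in the
  middle slot.\<close>

lemma grade_tr: "x \<in> grade \<alpha> \<Longrightarrow> y \<in> grade \<beta> \<Longrightarrow> z \<in> grade \<gamma> \<Longrightarrow> tr x y z \<in> grade (\<alpha> - \<beta> + \<gamma>)"
  by (simp add: grade_def H_tr tr_scaleR algebra_simps)

lemma grade_eq_0:
  assumes "x \<in> grade \<alpha>" "\<alpha> \<noteq> 0" "\<alpha> \<noteq> 1/2" "\<alpha> \<noteq> 1"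
  shows "x = 0"
proof -
  have "2 *\<^sub>R H (H (H x)) - 3 *\<^sub>R H (H x) + H x = 0" using H_cubic[of x] by simp
  then have "(2 * \<alpha> ^ 3 - 3 * \<alpha> ^ 2 + \<alpha>) *\<^sub>R x = 0"
    using assms(1) by (simp add: grade_def H_lin power3_eq_cube power2_eq_square algebra_simps)
  moreover have "2 * \<alpha> ^ 3 - 3 * \<alpha> ^ 2 + \<alpha> = \<alpha> * (2 * \<alpha> - 1) * (\<alpha> - 1)"
    by algebra
  moreover have "\<alpha> * (2 * \<alpha> - 1) * (\<alpha> - 1) \<noteq> 0" using assms(2-4) by simp
  ultimately show ?thesis by (metis scaleR_eq_0_iff)
qed

lemma tr_grade_eq_0:
  "x \<in> grade \<alpha> \<Longrightarrow> y \<in> grade \<beta> \<Longrightarrow> z \<in> grade \<gamma> \<Longrightarrow> \<alpha> - \<beta> + \<gamma> \<notin> {0, 1/2, 1} \<Longrightarrow> tr x y z = 0"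
  using grade_tr grade_eq_0 by blast

lemma e_grade: "e1 \<in> grade 1" "e2 \<in> grade 1"
  by (simp_all add: grade_def H_def e111 e222 e112 e221)

text \<open>An element of the kernel of \<open>H\<close> is orthogonal to \<open>u\<close>, so adding it to \<open>u\<close> does not
  increase the norm beyond the maximum.\<close>

lemma norm_add_ker:
  assumes "H c = 0"
  shows "norm (e1 + e2 + c) \<le> max 1 (norm c)"
proof -
  \<comment> \<open>Cubing exchanges \<open>e1 + e2\<close> and \<open>e1 - e2\<close>, so the
    family has to contain both.\<close>
  define S where "S = {(v, c). (v = e1 + e2 \<or> v = e1 - e2) \<and> H c = 0}"
  have cube_S: "cube (v + c) = cube v + cube c \<and> (cube v, cube c) \<in> S" if vc: "(v, c) \<in> S" for v c
  proof -
    have c: "c \<in> grade 0" and Hc: "H c = 0" using vc by (auto simp: S_def grade_0)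
    have e1c: "tr e1 c e1 = 0" and e2c: "tr e2 c e2 = 0"
      using tr_grade_eq_0[OF e_grade(1) c e_grade(1)] tr_grade_eq_0[OF e_grade(2) c e_grade(2)] by auto
    have e1cz: "tr e1 c z = 0" for z
      using LQ_shift_middle[of e1 e1 c z] by (simp add: e111 e1c H_ker[OF Hc])
    have e2cz: "tr e2 c z = 0" for z
      using LQ_shift_middle[of e2 e2 c z] by (simp add: e222 e2c H_ker[OF Hc] tr_minus)
    have ce1: "tr c e1 c = 0" "tr c e2 c = 0"
      using tr_grade_eq_0[OF c e_grade(1) c] tr_grade_eq_0[OF c e_grade(2) c] by auto
    have zero: "tr v v c = 0" "tr v c x = 0" "tr c v c = 0" for x
      using vc by (auto simp: S_def tr_lin e1cz e2cz ce1 e12 e21 H_ker[OF Hc])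
    have "cube (v + c) = cube v + cube c"
      by (simp add: tr_add zero tr_comm[of c v v] tr_comm[of c c v])
    moreover have "cube (e1 + e2) = e1 - e2" "cube (e1 - e2) = e1 + e2"
      by (simp_all add: tr_lin e12 e21 e111 e222 e112 e221)
    moreover have "H (cube c) = 0"
      using grade_tr[OF c c c] by (simp add: grade_0)
    ultimately show ?thesis using vc by (auto simp: S_def)
  qed
  have "norm (fst (e1 + e2, c) + snd (e1 + e2, c)) \<le> sqrt 1 * max 1 (norm (snd (e1 + e2, c)))"
  proof (rule cube_improve[where S = S and B = "norm e1 + norm e2 + 1" and c = 1
        and u = "\<lambda>s. norm (fst s + snd s)" and v = "\<lambda>s. max 1 (norm (snd s))" and s = "(e1 + e2, c)"])
    fix s assume s: "s \<in> S"
    obtain v c where s_eq: "s = (v, c)" by (cases s)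
    note vc = cube_S[OF s[unfolded s_eq]]
    have "norm v \<le> norm e1 + norm e2"
      using s s_eq norm_triangle_ineq[of e1 e2] norm_triangle_ineq4[of e1 e2] by (auto simp: S_def)
    then have "norm (v + c) \<le> norm e1 + norm e2 + norm c"
      using norm_triangle_ineq[of v c] by linarith
    also have "\<dots> \<le> (norm e1 + norm e2) * max 1 (norm c) + max 1 (norm c)"
      using mult_left_mono[of 1 "max 1 (norm c)" "norm e1 + norm e2"] by simp
    finally show "norm (fst s + snd s) \<le> (norm e1 + norm e2 + 1) * max 1 (norm (snd s))"
      by (simp add: s_eq distrib_right)
    have "max 1 (norm (cube c)) \<le> max 1 (norm c) ^ 3"
      by (auto simp: norm_cube max_def power_le_one)
    then show "\<exists>s'\<in>S. norm (fst s + snd s) ^ 3 \<le> 1 * norm (fst s' + snd s')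
        \<and> max 1 (norm (snd s')) \<le> max 1 (norm (snd s)) ^ 3"
      using vc by (intro bexI[of _ "(cube v, cube c)"]) (simp_all add: s_eq flip: norm_cube)
  qed (use assms in \<open>auto simp: S_def\<close>)
  then show ?thesis by simp
qed

end

section \<open>The Peirce decomposition of an ideal that meets the kernel of \<open>H\<close>
  trivially\<close>

locale tripotent_ideal = signed_tripotent +
  fixes A I :: "'a set"
  assumes A_sub: "subspace A" and I_sub: "subspace I" and IA: "I \<subseteq> A"
    and A_tr: "x \<in> A \<Longrightarrow> y \<in> A \<Longrightarrow> z \<in> A \<Longrightarrow> tr x y z \<in> A"
    and I_tr: "x \<in> I \<Longrightarrow> y \<in> A \<Longrightarrow> z \<in> A \<Longrightarrow> tr x y z \<in> I"
    and e_in: "e1 \<in> I" "e2 \<in> I"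
    and I_ker: "x \<in> I \<Longrightarrow> H x = 0 \<Longrightarrow> x = 0"
begin

lemma H_in: "x \<in> A \<Longrightarrow> H x \<in> I"
  unfolding H_def using IA e_in by (intro subspace_diff I_sub I_tr) auto

lemma I_in_A: "x \<in> I \<Longrightarrow> x \<in> A"
  using IA by blast

lemma I_tr': "z \<in> I \<Longrightarrow> x \<in> A \<Longrightarrow> y \<in> A \<Longrightarrow> tr x y z \<in> I"
  using I_tr[of z y x] by (simp add: tr_comm)

lemma I_grade_0: "x \<in> I \<Longrightarrow> x \<in> grade 0 \<Longrightarrow> x = 0"
  using I_ker by (simp add: grade_0)

text \<open>The polynomial 3 t - 2 t^2 is 0 at 0 and 1 at 1/2 and at 1, so this projects onto the
  two nonzero Peirce spaces.\<close>

definition proj :: "'a \<Rightarrow> 'a" where "proj x = 3 *\<^sub>R H x - 2 *\<^sub>R H (H x)"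

lemma H_proj: "H (proj x) = H x"
proof -
  have "H (proj x) = 3 *\<^sub>R H (H x) - 2 *\<^sub>R H (H (H x))"
    by (simp add: proj_def H_lin)
  then show ?thesis by (simp add: H_cubic)
qed

lemma proj_in: "x \<in> A \<Longrightarrow> proj x \<in> I"
  by (simp add: proj_def subspace_diff subspace_scale I_sub H_in I_in_A)

lemma proj_ideal: "x \<in> I \<Longrightarrow> proj x = x"
proof -
  assume x: "x \<in> I"
  have "x - proj x \<in> I" using x by (simp add: subspace_diff I_sub proj_in I_in_A)
  moreover have "H (x - proj x) = 0" by (simp add: H_lin H_proj)
  ultimately show ?thesis using I_ker[of "x - proj x"] by simp
qed

text \<open>On the values 0, 1/2, 1 the polynomials 4 (t - t^2) and 2 t^2 - t are the indicators of
  1/2 and of 1. Degree 0 does not occur in the ideal by \<open>I_ker\<close>.\<close>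

lemma I_decompose:
  assumes "j \<in> I"
  obtains a b where "j = a + b" "a \<in> I" "a \<in> grade (1/2)" "b \<in> I" "b \<in> grade 1"
proof
  let ?a = "4 *\<^sub>R (H j - H (H j))" and ?b = "2 *\<^sub>R H (H j) - H j"
  show "j = ?a + ?b"
    using proj_ideal[OF assms] scaleR_left.add[of 3 1 "H j"] scaleR_left.add[of 2 2 "H (H j)"]
    by (simp add: proj_def algebra_simps)
  have in_I: "H j \<in> I" "H (H j) \<in> I" using assms by (simp_all add: H_in I_in_A)
  then show "?a \<in> I" "?b \<in> I" by (auto intro!: subspace_diff subspace_scale I_sub)
  have "2 *\<^sub>R H ?a = 4 *\<^sub>R (2 *\<^sub>R H (H j) - 2 *\<^sub>R H (H (H j)))"
    by (simp add: H_lin scaleR_diff_right)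
  also have "\<dots> = ?a"
    unfolding H_cubic using scaleR_left.add[of 2 1 "H (H j)"] by (simp add: algebra_simps)
  finally have "2 *\<^sub>R H ?a = ?a" .
  then have "(1/2) *\<^sub>R (2 *\<^sub>R H ?a) = (1/2) *\<^sub>R ?a" by (simp only:)
  then show "?a \<in> grade (1/2)" by (simp add: grade_def)
  have "H ?b = 2 *\<^sub>R H (H (H j)) - H (H j)" by (simp add: H_lin)
  then show "?b \<in> grade 1"
    unfolding H_cubic grade_def using scaleR_left.add[of 2 1 "H (H j)"] by (simp add: algebra_simps)
qed

text \<open>The orthogonality of the ideal and the kernel of \<open>H\<close> follows from the grading: products
  that land in degree \<open>0\<close> or outside \<open>{0, 1/2, 1}\<close> vanish, and the remaining ones vanish
  because they have zero cubes.\<close>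

context
  fixes z z' :: 'a
  assumes zA: "z \<in> A" and z0: "z \<in> grade 0" and zA': "z' \<in> A" and z0': "z' \<in> grade 0"
begin

lemma orth_same_grade:
  assumes "a \<in> I" "a \<in> grade \<alpha>" "b \<in> I" "b \<in> grade \<alpha>"
  shows "tr a b z = 0"
  using I_tr[OF assms(1) I_in_A[OF assms(3)] zA] grade_tr[OF assms(2,4) z0] I_grade_0 by simp

lemma orth_1z1:
  assumes "a \<in> grade 1" "b \<in> grade \<beta>" "\<beta> = 1 \<or> \<beta> = 1/2"
  shows "tr a z b = 0"
  using tr_grade_eq_0[OF assms(1) z0 assms(2)] assms(3) by auto

lemma orth_hzh_diag:
  assumes a: "a \<in> I" "a \<in> grade (1/2)"
  shows "tr a z a = 0"
proof -
  let ?w = "tr a z a"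
  have w: "?w \<in> I" "?w \<in> grade 1"
    using I_tr[OF a(1) zA I_in_A[OF a(1)]] grade_tr[OF a(2) z0 a(2)] by auto
  have "tr a ?w a = 0"
    using I_tr[OF a(1) I_in_A[OF w(1)] I_in_A[OF a(1)]] grade_tr[OF a(2) w(2) a(2)] I_grade_0 by simp
  then have "cube ?w = 0"
    using Q_fundamental[of a z "tr a z a"] by simp
  then show ?thesis by (rule cube_eq_0D)
qed

lemma orth_hzh:
  assumes a: "a \<in> I" "a \<in> grade (1/2)" and b: "b \<in> I" "b \<in> grade (1/2)"
  shows "tr a z b = 0"
proof -
  have "a + b \<in> I" "a + b \<in> grade (1/2)"
    using a b by (auto simp: subspace_add I_sub grade_def H_lin algebra_simps)
  then have "tr (a + b) z (a + b) = 0" by (rule orth_hzh_diag)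
  then have "2 *\<^sub>R tr a z b = 0"
    using orth_hzh_diag[OF a] orth_hzh_diag[OF b] by (simp add: tr_add tr_comm[of b z a] scaleR_2)
  then show ?thesis by simp
qed

lemma orth_azb:
  assumes "a \<in> I" "a \<in> grade \<alpha>" "\<alpha> = 1 \<or> \<alpha> = 1/2" and "b \<in> I" "b \<in> grade \<beta>" "\<beta> = 1 \<or> \<beta> = 1/2"
  shows "tr a z b = 0"
  using assms orth_1z1[of a b \<beta>] orth_1z1[of b a \<alpha>] orth_hzh[of a b] tr_comm[of a z b] by metis

lemma orth_zaz:
  assumes "a \<in> grade \<alpha>" "\<alpha> = 1 \<or> \<alpha> = 1/2"
  shows "tr z a z' = 0"
  using tr_grade_eq_0[OF z0 assms(1) z0'] assms(2) by auto

end

text \<open>In the triple identity for \<open>tr z a (tr ?t z' ?t)\<close> the middle term is the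
  cube of the product in question, and all other terms contain a product already known to
  vanish.\<close>

lemma orth_azz:
  assumes z: "z \<in> A" "z \<in> grade 0" "z' \<in> A" "z' \<in> grade 0"
    and a: "a \<in> I" "a \<in> grade \<alpha>" and \<alpha>: "\<alpha> = 1 \<or> \<alpha> = 1/2"
  shows "tr a z z' = 0"
proof -
  let ?t = "tr a z z'"
  have t: "?t \<in> I" "?t \<in> grade \<alpha>"
    using I_tr[OF a(1) z(1,3)] grade_tr[OF a(2) z(2,4)] by auto
  note same = orth_same_grade[OF z(1,2,3,4)] orth_same_grade[OF z(3,4,1,2)]
  have "tr z a (tr ?t z' ?t) = tr (tr z a ?t) z' ?t - tr ?t (tr a z z') ?t + tr ?t z' (tr z a ?t)"
    by (rule tr_identity)
  moreover have "tr ?t z' ?t = 0"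
    by (rule orth_azb[OF z(3,4,1,2) t \<alpha> t \<alpha>])
  moreover have "tr z a ?t = 0"
    using same(1)[OF t a] by (simp add: tr_comm)
  ultimately have "cube ?t = 0" by simp
  then show ?thesis by (rule cube_eq_0D)
qed

lemma orth_10z:
  assumes z: "z \<in> A" "z \<in> grade 0" and a: "a \<in> I" "a \<in> grade 1" and b: "b \<in> I" "b \<in> grade (1/2)"
  shows "tr a b z = 0"
proof -
  let ?r = "tr z b a"
  have r: "?r \<in> I" "?r \<in> grade (1/2)"
    using I_tr'[OF a(1) z(1) I_in_A[OF b(1)]] grade_tr[OF z(2) b(2) a(2)] by auto
  have "tr b z (tr ?r a ?r) = tr (tr b z ?r) a ?r - tr ?r (tr z b a) ?r + tr ?r a (tr b z ?r)"
    by (rule tr_identity)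
  moreover have "tr ?r a ?r = 0"
    using I_tr[OF r(1) I_in_A[OF a(1)] I_in_A[OF r(1)]] grade_tr[OF r(2) a(2) r(2)] I_grade_0 by simp
  moreover have "tr b z ?r = 0"
    by (rule orth_hzh[OF z z b r])
  ultimately have "cube ?r = 0" by simp
  then show ?thesis using cube_eq_0D tr_comm by metis
qed

lemma orthogonal:
  assumes z: "z \<in> A" "H z = 0" and j: "j \<in> I"
  shows "tr j z j = 0" "tr z j z = 0" "tr j z z = 0" "tr j j z = 0"
proof -
  have z0: "z \<in> grade 0" using z by (simp add: grade_0)
  obtain a b where ab: "j = a + b" "a \<in> I" "a \<in> grade (1/2)" "b \<in> I" "b \<in> grade 1"
    using I_decompose[OF j] by blast
  note zz = z(1) z0 z(1) z0
  have h: "(1/2::real) = 1 \<or> (1/2::real) = 1/2" and o: "(1::real) = 1 \<or> (1::real) = 1/2" by auto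
  show "tr j z j = 0"
    by (simp add: ab(1) tr_add orth_azb[OF zz ab(2,3) h ab(2,3) h] orth_azb[OF zz ab(4,5) o ab(4,5) o]
        orth_azb[OF zz ab(2,3) h ab(4,5) o] orth_azb[OF zz ab(4,5) o ab(2,3) h])
  show "tr z j z = 0"
    by (simp add: ab(1) tr_add orth_zaz[OF zz ab(3) h] orth_zaz[OF zz ab(5) o])
  show "tr j z z = 0"
    by (simp add: ab(1) tr_add orth_azz[OF zz ab(2,3) h] orth_azz[OF zz ab(4,5) o])
  have "tr a b z = 0"
    using tr_grade_eq_0[OF ab(3) ab(5) z0] by simp
  then show "tr j j z = 0"
    by (simp add: ab(1) tr_add orth_same_grade[OF zz ab(2,3) ab(2,3)] orth_same_grade[OF zz ab(4,5) ab(4,5)]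
        orth_10z[OF z(1) z0 ab(4,5) ab(2,3)])
qed

text \<open>Cubing acts on orthogonal summands separately, so pairs of them form a family stable
  under cubing. Both inequalities are instances of \<open>cube_improve\<close>; the lower one takes
  its crude constant from the boundedness of \<open>proj\<close>.\<close>

lemma norm_orthogonal_sum:
  assumes z: "z \<in> A" "H z = 0" and j: "j \<in> I"
  shows "norm (j + z) = max (norm j) (norm z)"
proof -
  define S where "S = {(j, z). j \<in> I \<and> z \<in> A \<and> H z = 0}"
  have S: "cube (j + z) = cube j + cube z \<and> (cube j, cube z) \<in> S" if "(j, z) \<in> S" for j z
  proof -
    have jz: "j \<in> I" "z \<in> A" "H z = 0" using that by (auto simp: S_def)
    note o = orthogonal[OF jz(2,3,1)]
    have "cube (j + z) = cube j + cube z"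
      by (simp add: tr_add o tr_comm[of z j j] tr_comm[of z z j])
    moreover have "H (cube z) = 0"
      using jz by (simp add: H_tr)
    ultimately show ?thesis
      using jz by (simp add: S_def A_tr I_tr I_in_A)
  qed
  have max3: "max a b ^ 3 = max (a ^ 3) (b ^ 3)" if "0 \<le> a" "0 \<le> b" for a b :: real
    using that by (auto simp: max_def power_mono_iff)
  have le: "norm (j + z) \<le> max (norm j) (norm z)"
  proof -
    have "norm (fst (j, z) + snd (j, z)) \<le> sqrt 1 * max (norm (fst (j, z))) (norm (snd (j, z)))"
    proof (rule cube_improve[where S = S and B = 2 and c = 1 and u = "\<lambda>s. norm (fst s + snd s)"
          and v = "\<lambda>s. max (norm (fst s)) (norm (snd s))" and s = "(j, z)"])
      fix s assume s: "s \<in> S"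
      show "norm (fst s + snd s) \<le> 2 * max (norm (fst s)) (norm (snd s))"
        using norm_triangle_ineq[of "fst s" "snd s"] by linarith
      show "\<exists>s'\<in>S. norm (fst s + snd s) ^ 3 \<le> 1 * norm (fst s' + snd s')
          \<and> max (norm (fst s')) (norm (snd s')) \<le> max (norm (fst s)) (norm (snd s)) ^ 3"
        using S[of "fst s" "snd s"] s
        by (intro bexI[of _ "(cube (fst s), cube (snd s))"]) (simp_all add: max3 flip: norm_cube)
    qed (use assms in \<open>auto simp: S_def le_max_iff_disj\<close>)
    then show ?thesis by simp
  qed
  have H_norm: "norm (H x) \<le> 3 * (norm e1 ^ 2 + norm e2 ^ 2) * norm x" for x
    using norm_tr[of e1 e1 x] norm_tr[of e2 e2 x] norm_triangle_ineq4[of "L1 x" "L2 x"]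
    by (simp add: H_def power2_eq_square algebra_simps)
  define h where "h = 3 * (norm e1 ^ 2 + norm e2 ^ 2)"
  have h0: "0 \<le> h" by (simp add: h_def)
  have proj_norm: "norm (proj x) \<le> (3 * h + 2 * (h * h)) * norm x" for x
  proof -
    have "norm (H (H x)) \<le> h * (h * norm x)"
      using H_norm[of "H x"] H_norm[of x] h0 by (fold h_def) (meson mult_left_mono order_trans)
    then show ?thesis
      using H_norm[of x] norm_triangle_ineq4[of "3 *\<^sub>R H x" "2 *\<^sub>R H (H x)"]
      by (fold h_def) (simp add: proj_def algebra_simps)
  qed
  have "max (norm j) (norm z) \<le> norm (j + z)"
  proof -
    have "max (norm (fst (j, z))) (norm (snd (j, z))) \<le> sqrt 1 * norm (fst (j, z) + snd (j, z))"
    proof (rule cube_improve[where S = S and B = "3 * h + 2 * (h * h) + 1" and c = 1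
          and v = "\<lambda>s. norm (fst s + snd s)"
          and u = "\<lambda>s. max (norm (fst s)) (norm (snd s))" and s = "(j, z)"])
      fix s assume s: "s \<in> S"
      obtain j z where s_eq: "s = (j, z)" by (cases s)
      have jz: "j \<in> I" "z \<in> A" "H z = 0" using s s_eq by (auto simp: S_def)
      have "proj (j + z) = proj j + proj z"
        by (simp add: proj_def H_lin algebra_simps)
      then have pj: "proj (j + z) = j" using jz by (simp add: proj_ideal) (simp add: proj_def H_lin)
      have 1: "norm j \<le> (3 * h + 2 * (h * h)) * norm (j + z)"
        using proj_norm[of "j + z"] by (simp add: pj)
      have "norm z \<le> norm (j + z) + norm j" using norm_triangle_ineq4[of "j + z" j] by simp
      then show "max (norm (fst s)) (norm (snd s)) \<le> (3 * h + 2 * (h * h) + 1) * norm (fst s + snd s)"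
        using 1 by (simp add: s_eq distrib_right add_increasing2)
      show "\<exists>s'\<in>S. max (norm (fst s)) (norm (snd s)) ^ 3 \<le> 1 * max (norm (fst s')) (norm (snd s'))
          \<and> norm (fst s' + snd s') \<le> norm (fst s + snd s) ^ 3"
        using S[of j z] s s_eq
        by (intro bexI[of _ "(cube j, cube z)"]) (simp_all add: max3 flip: norm_cube)
    qed (use assms in \<open>auto simp: S_def le_max_iff_disj\<close>)
    then show ?thesis by simp
  qed
  with le show ?thesis by simp
qed

lemma M_summand_ideal: "M_summand A I"
  unfolding M_summand_def M_projection_def
proof (intro exI[of _ proj] conjI ballI allI)
  show "proj ` A \<subseteq> A" using proj_in IA by blast
  show "I = proj ` A"
    using proj_in proj_ideal IA by (force simp: image_iff)
  fix x y and r :: real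
  show "proj (x + y) = proj x + proj y" "proj (r *\<^sub>R x) = r *\<^sub>R proj x"
    by (simp_all add: proj_def H_lin algebra_simps)
  assume x: "x \<in> A"
  show "proj (proj x) = proj x" using x by (simp add: proj_in proj_ideal)
  have "norm (proj x + (x - proj x)) = max (norm (proj x)) (norm (x - proj x))"
    using x by (intro norm_orthogonal_sum) (simp_all add: H_lin H_proj proj_in subspace_diff A_sub I_in_A)
  then show "norm x = max (norm (proj x)) (norm (x - proj x))" by simp
qed

end

section \<open>From an extreme point of the unit ball of an ideal to an M-projection\<close>

context jbstar
begin

lemma M_summand_of_extreme_point:
  assumes A_sub: "subspace A" and I_sub: "subspace I" and IA: "I \<subseteq> A"
    and A_tr: "\<And>x y z. x \<in> A \<Longrightarrow> y \<in> A \<Longrightarrow> z \<in> A \<Longrightarrow> tr x y z \<in> A"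
    and I_tr: "\<And>x y z. x \<in> I \<Longrightarrow> y \<in> A \<Longrightarrow> z \<in> A \<Longrightarrow> tr x y z \<in> I"
    and u: "u \<in> I" "norm u \<le> 1"
    and extreme: "\<And>v. v \<in> I \<Longrightarrow> norm (u + v) \<le> 1 \<Longrightarrow> norm (u - v) \<le> 1 \<Longrightarrow> v = 0"
  shows "M_summand A I"
proof -
  let ?L = "tr u u"
  have uA: "u \<in> A" using u IA by blast
  have Lu: "?L u \<in> I" "?L (?L u) \<in> I"
    using u I_tr[OF u(1) uA, of u] I_tr[OF u(1) uA, of "?L u"] uA IA by auto
  have LLu: "?L (?L u) = u"
  proof (rule extreme_point_power[OF u(2)])
    fix r
    have "r *\<^sub>R (u - ?L (?L u)) \<in> I" using u Lu by (simp add: subspace_scale subspace_diff I_sub)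
    then show "r *\<^sub>R (u - ?L (?L u)) = 0" if "norm (u + r *\<^sub>R (u - ?L (?L u))) \<le> 1"
      "norm (u - r *\<^sub>R (u - ?L (?L u))) \<le> 1"
      using extreme that by blast
  qed
  define p where "p k = (?L ^^ k) u" for k
  have p01: "p 0 = u" "p 1 = ?L u" by (simp_all add: p_def)
  \<comment> \<open>The odd powers alternate between \<open>u\<close> and \<open>?L u\<close>, so
    every triple product of these two elements is determined by a parity.\<close>
  have p_mod: "p (Suc (Suc k)) = p k" for k
  proof -
    have "p (Suc (Suc k)) = (?L ^^ k) (?L (?L u))"
      by (simp add: p_def funpow_swap1)
    then show ?thesis by (simp add: LLu p_def)
  qed
  have trp: "tr (p i) (p j) (p k) = p (i + j + k + 1)" for i j k
    unfolding p_def by (rule tr_odd_powers)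
  have p_num: "p 2 = u" "p 3 = p 1" "p 4 = u"
    using p_mod[of 0] p_mod[of 1] p_mod[of 2] p01 by (simp_all add: eval_nat_numeral)
  define v where "v = ?L u"
  have tp: "tr u u u = v" "tr u u v = u" "tr u v u = u" "tr u v v = v" "tr v u u = u" "tr v u v = v"
    "tr v v u = v" "tr v v v = u"
    using trp[of 0 0 0] trp[of 0 0 1] trp[of 0 1 0] trp[of 0 1 1] trp[of 1 0 0] trp[of 1 0 1]
      trp[of 1 1 0] trp[of 1 1 1] p01 p_num by (simp_all add: v_def numeral_eq_Suc)
  define e1 e2 where "e1 = (1/2) *\<^sub>R (u + v)" and "e2 = (1/2) *\<^sub>R (u - v)"
  have q: "(1/8) *\<^sub>R (x + x + x + x) = (1/2) *\<^sub>R x" for x :: 'a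
  proof -
    have "x + x + x + x = 4 *\<^sub>R x"
      using scaleR_left.add[of 2 2 x] by (simp add: scaleR_2 add.assoc)
    then show ?thesis by (simp only: scaleR_scaleR) simp
  qed
  interpret signed_tripotent jp invol e1 e2
  proof unfold_locales
    show "tr e1 e1 e1 = e1" "tr e2 e2 e2 = - e2" "tr e1 e1 e2 = 0" "tr e2 e2 e1 = 0"
      "tr e1 e2 e1 = 0" "tr e2 e1 e2 = 0"
      using q[of u] q[of v]
      by (simp_all add: e1_def e2_def tr_lin tp algebra_simps flip: scaleR_add_left)
  qed
  have u_eq: "u = e1 + e2"
    by (simp add: e1_def e2_def algebra_simps flip: scaleR_add_left)
  have eI: "e1 \<in> I" "e2 \<in> I"
    using u Lu by (auto simp: e1_def e2_def v_def intro!: subspace_scale subspace_add subspace_diff I_sub)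
  interpret tripotent_ideal jp invol e1 e2 A I
  proof unfold_locales
    fix c assume c: "c \<in> I" "H c = 0"
    show "c = 0"
    proof (rule ccontr)
      assume c0: "c \<noteq> 0"
      \<comment> \<open>A normalised kernel element could be added to and subtracted from
        \<open>u\<close> without leaving the unit ball, against extremality.\<close>
      define d where "d = (1 / norm c) *\<^sub>R c"
      have d: "d \<in> I" "H d = 0" "norm d = 1" "H (- d) = 0"
        using c c0 by (simp_all add: d_def subspace_scale I_sub H_lin)
      then have "norm (u + d) \<le> 1" "norm (u - d) \<le> 1"
        using norm_add_ker[of d] norm_add_ker[of "- d"] by (simp_all add: u_eq)
      then have "d = 0" using extreme d by blast
      then show False using d by simp
    qed
  qed (use assms eI in auto)
  show ?thesis by (rule M_summand_ideal)
qed

end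

subsection \<open>Infinitesimal isometries\<close>

text \<open>Isometric to first order, uniformly in \<open>x\<close> and \<open>s\<close>. The
  one-sided quadratic bound avoids exponentials and makes sense on a set that \<open>D\<close> need
  not preserve.\<close>

definition skew :: "'v::real_normed_vector set \<Rightarrow> ('v \<Rightarrow> 'v) \<Rightarrow> bool" where
  "skew S D \<longleftrightarrow> (\<exists>C\<ge>0. \<forall>s. \<forall>x\<in>S. norm (x + s *\<^sub>R D x) \<le> (1 + C * s\<^sup>2) * norm x)"

lemma skew_mono: "skew S D \<Longrightarrow> T \<subseteq> S \<Longrightarrow> skew T D"
  unfolding skew_def by blast

lemma skew_cong: "(\<And>x. x \<in> S \<Longrightarrow> D x = E x) \<Longrightarrow> skew S D \<longleftrightarrow> skew S E"
  unfolding skew_def by simp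

lemma skew_zero: "skew S (\<lambda>x. 0)"
  unfolding skew_def by (intro exI[of _ 0]) simp

lemma skew_scaleR:
  assumes "skew S D"
  shows "skew S (\<lambda>x. r *\<^sub>R D x)"
proof -
  obtain C where "C \<ge> 0" and C: "\<And>s x. x \<in> S \<Longrightarrow> norm (x + s *\<^sub>R D x) \<le> (1 + C * s\<^sup>2) * norm x"
    using assms unfolding skew_def by blast
  have "norm (x + s *\<^sub>R r *\<^sub>R D x) \<le> (1 + C * r\<^sup>2 * s\<^sup>2) * norm x" if "x \<in> S" for s x
    using C[OF that, of "s * r"] by (simp add: power_mult_distrib mult_ac)
  then show ?thesis unfolding skew_def using \<open>C \<ge> 0\<close> by (intro exI[of _ "C * r\<^sup>2"]) auto
qed

text \<open>The moved point is the midpoint of the points obtained from \<open>D\<close> and from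
  \<open>E\<close> alone with step \<open>2 * s\<close>.\<close>

lemma skew_add:
  assumes "skew S D" "skew S E"
  shows "skew S (\<lambda>x. D x + E x)"
proof -
  obtain C where "C \<ge> 0" and C: "\<And>s x. x \<in> S \<Longrightarrow> norm (x + s *\<^sub>R D x) \<le> (1 + C * s\<^sup>2) * norm x"
    using assms unfolding skew_def by blast
  obtain C' where "C' \<ge> 0" and C': "\<And>s x. x \<in> S \<Longrightarrow> norm (x + s *\<^sub>R E x) \<le> (1 + C' * s\<^sup>2) * norm x"
    using assms unfolding skew_def by blast
  have "norm (x + s *\<^sub>R (D x + E x)) \<le> (1 + (2 * C + 2 * C') * s\<^sup>2) * norm x" if "x \<in> S" for s x
  proof -
    have "2 *\<^sub>R (x + s *\<^sub>R (D x + E x)) = (x + (2 * s) *\<^sub>R D x) + (x + (2 * s) *\<^sub>R E x)"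
      by (simp add: scaleR_add_right) (simp add: scaleR_2)
    then have "2 * norm (x + s *\<^sub>R (D x + E x)) \<le> norm (x + (2 * s) *\<^sub>R D x) + norm (x + (2 * s) *\<^sub>R E x)"
      by (metis norm_scaleR abs_numeral norm_triangle_ineq)
    also have "\<dots> \<le> (1 + C * (2 * s)\<^sup>2) * norm x + (1 + C' * (2 * s)\<^sup>2) * norm x"
      by (intro add_mono C C' that)
    finally show ?thesis by (simp add: algebra_simps)
  qed
  then show ?thesis
    unfolding skew_def using \<open>C \<ge> 0\<close> \<open>C' \<ge> 0\<close> by (intro exI[of _ "2 * C + 2 * C'"]) auto
qed

lemma skew_diff: "skew S D \<Longrightarrow> skew S E \<Longrightarrow> skew S (\<lambda>x. D x - E x)"
  using skew_add[OF _ skew_scaleR[of S E "-1"], of D] by simp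

text \<open>The inequality at \<open>s = \<delta>\<close> already bounds \<open>D\<close>, and
  beyond \<open>\<delta>\<close> the linear growth this allows is dominated by a multiple of
  s^2.\<close>

lemma skewI:
  assumes "0 < \<delta>" "0 \<le> C"
    and C: "\<And>s x. \<bar>s\<bar> \<le> \<delta> \<Longrightarrow> x \<in> S \<Longrightarrow> norm (x + s *\<^sub>R D x) \<le> (1 + C * s\<^sup>2) * norm x"
  shows "skew S D"
proof -
  define d where "d = (2 + C * \<delta>\<^sup>2) / \<delta>"
  have d: "norm (D x) \<le> d * norm x" if "x \<in> S" for x
  proof -
    have "\<delta> *\<^sub>R D x = (x + \<delta> *\<^sub>R D x) - x" by simp
    then have "\<delta> * norm (D x) \<le> norm (x + \<delta> *\<^sub>R D x) + norm x"
      using \<open>0 < \<delta>\<close> by (metis norm_scaleR abs_of_pos norm_triangle_ineq4)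
    also have "\<dots> \<le> (1 + C * \<delta>\<^sup>2) * norm x + norm x"
      using C[of \<delta> x] that \<open>0 < \<delta>\<close> by simp
    finally show ?thesis using \<open>0 < \<delta>\<close> by (simp add: d_def field_simps)
  qed
  have "d \<ge> 0" using assms(1,2) by (simp add: d_def)
  define C' where "C' = C + d / \<delta>"
  have "norm (x + s *\<^sub>R D x) \<le> (1 + C' * s\<^sup>2) * norm x" if x: "x \<in> S" for s x
  proof (cases "\<bar>s\<bar> \<le> \<delta>")
    case True
    have "(1 + C * s\<^sup>2) * norm x \<le> (1 + C' * s\<^sup>2) * norm x"
      using \<open>d \<ge> 0\<close> assms(1) by (intro mult_right_mono) (auto simp: C'_def distrib_right)
    then show ?thesis using C[OF True x] by linarith
  next
    case False
    have "\<delta> * \<bar>s\<bar> \<le> \<bar>s\<bar> * \<bar>s\<bar>" using False by (intro mult_right_mono) auto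
    then have "\<bar>s\<bar> \<le> s\<^sup>2 / \<delta>" using assms(1) by (simp add: field_simps power2_eq_square)
    then have "\<bar>s\<bar> * d \<le> s\<^sup>2 / \<delta> * d" using \<open>d \<ge> 0\<close> by (rule mult_right_mono)
    also have "\<dots> \<le> C' * s\<^sup>2" using assms(2) by (simp add: C'_def distrib_right mult_ac)
    finally have sd: "\<bar>s\<bar> * d \<le> C' * s\<^sup>2" .
    have "norm (x + s *\<^sub>R D x) \<le> norm x + \<bar>s\<bar> * norm (D x)"
      using norm_triangle_ineq[of x "s *\<^sub>R D x"] by simp
    also have "\<dots> \<le> norm x + \<bar>s\<bar> * (d * norm x)"
      using d[OF x] by (intro add_left_mono mult_left_mono) auto
    also have "\<dots> = (1 + \<bar>s\<bar> * d) * norm x" by (simp add: algebra_simps)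
    also have "\<dots> \<le> (1 + C' * s\<^sup>2) * norm x" using sd by (intro mult_right_mono) auto
    finally show ?thesis .
  qed
  moreover have "C' \<ge> 0" using assms(1,2) \<open>d \<ge> 0\<close> by (simp add: C'_def)
  ultimately show ?thesis unfolding skew_def by blast
qed

text \<open>The convex function \<open>s \<mapsto> norm (x + s D x)\<close> is stationary at \<open>0\<close>, hence minimal there.\<close>

lemma skew_norm_le:
  assumes "skew S D" "x \<in> S"
  shows "norm x \<le> norm (x + D x)"
proof (rule field_le_epsilon)
  fix e :: real assume "e > 0"
  obtain C where "C \<ge> 0" and C: "\<And>s. norm (x + s *\<^sub>R D x) \<le> (1 + C * s\<^sup>2) * norm x"
    using assms unfolding skew_def by blast
  define s where "s = e / (C * norm x + 1)"
  have pos: "C * norm x + 1 > 0" using \<open>C \<ge> 0\<close> by (simp add: add_nonneg_pos)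
  then have s: "s > 0" "s * (C * norm x) \<le> e"
    using \<open>e > 0\<close> by (auto simp: s_def field_simps)
  have "(1 + s) *\<^sub>R x = (x + (- s) *\<^sub>R D x) + s *\<^sub>R (x + D x)"
    by (simp add: algebra_simps)
  then have "(1 + s) * norm x \<le> norm (x + (- s) *\<^sub>R D x) + s * norm (x + D x)"
    using s by (metis norm_scaleR abs_of_pos add_pos_pos zero_less_one norm_triangle_ineq)
  also have "\<dots> \<le> (1 + C * s\<^sup>2) * norm x + s * norm (x + D x)"
    using C[of "- s"] by simp
  finally have "s * norm x \<le> s * (s * (C * norm x) + norm (x + D x))"
    by (simp add: algebra_simps power2_eq_square)
  then show "norm x \<le> norm (x + D x) + e" using s by simp
qed

text \<open>After \<open>k\<close> steps of length 1/sqrt k norms have grown at most by (1 + C/k)^k,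
  which is below exp C, whereas a constant drift would accumulate to sqrt k.
  \<open>sqrt_growth\<close> turns this disproportion into vanishing.\<close>

lemma skew_iterates_bounded:
  assumes "skew S D"
  obtains B where "B \<ge> 0"
    "\<And>k v. 0 < k \<Longrightarrow> (\<And>j. v j \<in> S) \<Longrightarrow> (\<And>j. v (Suc j) = v j + (1 / sqrt (real k)) *\<^sub>R D (v j)) \<Longrightarrow>
      norm (v k) \<le> B * norm (v 0)"
proof -
  obtain C where "C \<ge> 0" and C: "\<And>s x. x \<in> S \<Longrightarrow> norm (x + s *\<^sub>R D x) \<le> (1 + C * s\<^sup>2) * norm x"
    using assms unfolding skew_def by blast
  show thesis
  proof (rule that[of "exp C"])
    fix k :: nat and v :: "nat \<Rightarrow> 'a"
    assume k: "0 < k" and vS: "\<And>j. v j \<in> S" and v: "\<And>j. v (Suc j) = v j + (1 / sqrt (real k)) *\<^sub>R D (v j)"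
    have "norm (v j) \<le> (1 + C / real k) ^ j * norm (v 0)" for j
    proof (induction j)
      case (Suc j)
      have "norm (v (Suc j)) \<le> (1 + C * (1 / sqrt (real k))\<^sup>2) * norm (v j)"
        unfolding v by (rule C[OF vS])
      also have "\<dots> = (1 + C / real k) * norm (v j)" by (simp add: power_divide)
      also have "\<dots> \<le> (1 + C / real k) * ((1 + C / real k) ^ j * norm (v 0))"
        using Suc \<open>C \<ge> 0\<close> by (intro mult_left_mono) auto
      finally show ?case by (simp add: mult_ac)
    qed simp
    then have "norm (v k) \<le> (1 + C / real k) ^ k * norm (v 0)" .
    also have "\<dots> \<le> exp C * norm (v 0)"
      using \<open>C \<ge> 0\<close> k exp_ge_one_plus_x_over_n_power_n[of k C] by (intro mult_right_mono) auto
    finally show "norm (v k) \<le> exp C * norm (v 0)" .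
  qed simp
qed

lemma sqrt_growth:
  assumes "\<And>k. 0 < k \<Longrightarrow> sqrt (real k) * a \<le> b"
  shows "a \<le> 0"
proof (rule ccontr)
  assume "\<not> a \<le> 0"
  then have a: "a > 0" by simp
  obtain k :: nat where k: "(b / a)\<^sup>2 < real k" using reals_Archimedean2 by blast
  have "0 < k" using k zero_le_power2[of "b / a"] by (metis le_less_trans of_nat_0_less_iff)
  have "b / a < sqrt (real k)" using k by (rule real_less_rsqrt)
  then show False using assms[OF \<open>0 < k\<close>] a by (simp add: field_simps)
qed

text \<open>The iterates are exactly \<open>y\<close> plus multiples of \<open>D y\<close>, and
  after \<open>k\<close> steps the multiple is sqrt k.\<close>

lemma skew_square_zero:
  assumes "skew UNIV D" "linear D" "D (D y) = 0"
  shows "D y = 0"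
proof -
  interpret D: linear D by fact
  obtain B where "B \<ge> 0" and B: "\<And>k v. 0 < k \<Longrightarrow> (\<And>j. v j \<in> UNIV) \<Longrightarrow>
      (\<And>j. v (Suc j) = v j + (1 / sqrt (real k)) *\<^sub>R D (v j)) \<Longrightarrow> norm (v k) \<le> B * norm (v 0)"
    using skew_iterates_bounded[OF assms(1)] by blast
  have "norm (D y) \<le> 0"
  proof (rule sqrt_growth)
    fix k :: nat assume k: "0 < k"
    have "norm (y + (real k / sqrt (real k)) *\<^sub>R D y) \<le> B * norm (y + (real 0 / sqrt (real k)) *\<^sub>R D y)"
    proof (rule B[OF k])
      show "y + (real (Suc j) / sqrt (real k)) *\<^sub>R D y = y + (real j / sqrt (real k)) *\<^sub>R D y
          + (1 / sqrt (real k)) *\<^sub>R D (y + (real j / sqrt (real k)) *\<^sub>R D y)" for j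
        by (simp add: D.add D.scale assms(3) add_divide_distrib scaleR_add_left add_ac)
    qed simp
    moreover have "real k / sqrt (real k) = sqrt (real k)" by (simp add: real_div_sqrt)
    ultimately have "norm (y + sqrt (real k) *\<^sub>R D y) \<le> B * norm y" by simp
    moreover have "norm (sqrt (real k) *\<^sub>R D y) \<le> norm (y + sqrt (real k) *\<^sub>R D y) + norm y"
      using norm_triangle_ineq4[of "y + sqrt (real k) *\<^sub>R D y" y] by simp
    ultimately show "sqrt (real k) * norm (D y) \<le> B * norm y + norm y" by simp
  qed
  then show ?thesis by simp
qed

locale normed_lin_endo = lin_endo S K
  for S :: "'v::real_normed_vector set" and K :: "'v \<Rightarrow> 'v"
begin

lemma peval_skew:
  assumes skew: "\<And>k. skew S (K ^^ Suc k)" and p: "coeff p 0 = 0"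
  shows "skew S (peval p)"
proof -
  have iter_in: "(K ^^ k) x \<in> S" if "x \<in> S" for k x
    using that by (induction k) (auto intro: K_in)
  have iter_add: "(K ^^ k) (x + y) = (K ^^ k) x + (K ^^ k) y" if "x \<in> S" "y \<in> S" for k x y
    using that by (induction k) (auto simp: K_add iter_in)
  have iter_scaleR: "(K ^^ k) (r *\<^sub>R x) = r *\<^sub>R (K ^^ k) x" if "x \<in> S" for k r x
    using that by (induction k) (auto simp: K_scaleR iter_in)
  have iter_0: "(K ^^ k) 0 = 0" for k
    by (induction k) (auto simp: K_0)
  have *: "skew S (\<lambda>x. (K ^^ Suc k) (peval q x))" for k q
  proof (induction q arbitrary: k)
    case (pCons a q)
    have "(K ^^ Suc k) (peval (pCons a q) x) = a *\<^sub>R (K ^^ Suc k) x + (K ^^ Suc (Suc k)) (peval q x)"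
      if "x \<in> S" for x
    proof -
      have "K (peval q x) \<in> S" "a *\<^sub>R x \<in> S"
        using that by (auto intro: K_in peval_in subspace_scale sub)
      then have "(K ^^ Suc k) (peval (pCons a q) x) = (K ^^ Suc k) (a *\<^sub>R x) + (K ^^ Suc k) (K (peval q x))"
        unfolding peval_pCons by (intro iter_add)
      then show ?thesis using iter_scaleR[OF that, of "Suc k" a] by (simp only: funpow_Suc_right comp_apply)
    qed
    then show ?case
      using skew_add[OF skew_scaleR[OF skew[of k], of a] pCons.IH[of "Suc k"]]
      by (subst skew_cong) auto
  qed (simp add: iter_0[of "Suc _", simplified] skew_zero)
  obtain q where "p = pCons 0 q" using p by (cases p) simp
  then have "peval p = (\<lambda>x. K (peval q x))" by (simp add: peval_pCons fun_eq_iff)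
  then show ?thesis using *[of 0 q] by simp
qed

text \<open>The Cesaro means of the powers of \<open>1 + s K\<close> have constant coefficient \<open>1\<close>, so they do
  not decrease norms, but they almost annihilate the range of \<open>K\<close>.\<close>

lemma skew_powers_zero:
  assumes skew: "\<And>k. skew S (K ^^ Suc k)" and x: "x \<in> S"
  shows "K x = 0"
proof -
  have "skew S K" using skew[of 0] by simp
  then obtain B where "B \<ge> 0" and B: "\<And>k v. 0 < k \<Longrightarrow> (\<And>j. v j \<in> S) \<Longrightarrow>
      (\<And>j. v (Suc j) = v j + (1 / sqrt (real k)) *\<^sub>R K (v j)) \<Longrightarrow> norm (v k) \<le> B * norm (v 0)"
    using skew_iterates_bounded by blast
  have "norm (K x) \<le> 0"
  proof (rule sqrt_growth)
    fix k :: nat assume k: "0 < k"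
    define s where "s = 1 / sqrt (real k)"
    define g where "g = [:1, s:]"
    have g: "peval g v = v + s *\<^sub>R K v" if "v \<in> S" for v
      using that by (simp add: g_def peval_pCons K_0 K_scaleR)
    have iter: "norm (peval (g ^ k) x) \<le> B * norm (peval (g ^ 0) x)"
      by (rule B[OF k]) (use x in \<open>auto simp: peval_mult peval_in g s_def\<close>)
    define q where "q = (\<Sum>j<k. g ^ j)"
    have q0: "coeff q 0 = real k"
      by (simp add: q_def coeff_sum coeff_0_power g_def)
    \<comment> \<open>The constant coefficient of \<open>q\<close> is \<open>k\<close>, yet
      multiplied by the operator s K the geometric sum telescopes to \<open>g ^ k - 1\<close>, which
      stays bounded at \<open>x\<close>.\<close>
    have gq: "[:0, s:] * q = g ^ k - 1"
    proof -
      have "(1 - g) * q = 1 - g ^ k"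
        unfolding q_def by (simp add: one_diff_power_eq)
      moreover have "[:0, s:] = - (1 - g)" by (simp add: g_def one_pCons)
      ultimately show ?thesis by (metis minus_diff_eq mult_minus_left)
    qed
    define r where "r = smult (1 / real k) q - 1"
    have "coeff r 0 = 0" using q0 k by (simp add: r_def)
    then have "norm (K x) \<le> norm (K x + peval r (K x))"
      by (intro skew_norm_le[OF peval_skew[OF skew]] K_in x)
    also have "K x + peval r (K x) = (1 / real k) *\<^sub>R peval q (K x)"
      using x by (simp add: r_def peval_diff_poly peval_smult K_in)
    finally have "real k * norm (K x) \<le> norm (peval q (K x))"
      using k by (simp add: field_simps)
    then have "s * (real k * norm (K x)) \<le> norm (s *\<^sub>R peval q (K x))"
      by (simp add: s_def divide_right_mono)
    also have "s *\<^sub>R peval q (K x) = peval (g ^ k - 1) x"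
      unfolding gq[symmetric] using x
      by (simp add: peval_mult peval_pCons K_0 K_scaleR peval_K peval_in peval_smult)
    also have "norm \<dots> \<le> B * norm x + norm x"
      using iter x norm_triangle_ineq4[of "peval (g ^ k) x" x] by (simp add: peval_diff_poly)
    finally have "s * real k * norm (K x) \<le> B * norm x + norm x" by (simp add: mult.assoc)
    moreover have "s * real k = sqrt (real k)" using k by (simp add: s_def real_div_sqrt)
    ultimately show "sqrt (real k) * norm (K x) \<le> B * norm x + norm x" by simp
  qed
  then show ?thesis by simp
qed

end

subsection \<open>M-projections\<close>

locale M_proj =
  fixes A :: "'v::real_normed_vector set" and P :: "'v \<Rightarrow> 'v"
  assumes A_sub: "subspace A" and proj: "M_projection A P"
begin

lemma P_in: "x \<in> A \<Longrightarrow> P x \<in> A"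
  and P_add: "x \<in> A \<Longrightarrow> y \<in> A \<Longrightarrow> P (x + y) = P x + P y"
  and P_scaleR: "x \<in> A \<Longrightarrow> P (r *\<^sub>R x) = r *\<^sub>R P x"
  and P_idem: "x \<in> A \<Longrightarrow> P (P x) = P x"
  and P_norm: "x \<in> A \<Longrightarrow> norm x = max (norm (P x)) (norm (x - P x))"
  using proj unfolding M_projection_def by blast+

lemmas A_add = subspace_add[OF A_sub] and A_diff = subspace_diff[OF A_sub]
  and A_scaleR = subspace_scale[OF A_sub] and A_neg = subspace_neg[OF A_sub]

lemma P_neg: "x \<in> A \<Longrightarrow> P (- x) = - P x"
  using P_scaleR[of x "-1"] by simp

lemma P_diff: "x \<in> A \<Longrightarrow> y \<in> A \<Longrightarrow> P (x - y) = P x - P y"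
  using P_add[of x "- y"] by (simp add: P_neg A_neg)

lemma P_0: "P 0 = 0"
  using P_scaleR[of 0 0] subspace_0[OF A_sub] by simp

lemma norm_P_le: "x \<in> A \<Longrightarrow> norm (P x) \<le> norm x"
  and norm_compl_le: "x \<in> A \<Longrightarrow> norm (x - P x) \<le> norm x"
  using P_norm by (metis max.cobounded1, metis max.cobounded2)

lemma compl: "M_proj A (\<lambda>x. x - P x)"
proof
  show "M_projection A (\<lambda>x. x - P x)"
    unfolding M_projection_def
  proof (intro conjI ballI allI)
    show "(\<lambda>x. x - P x) ` A \<subseteq> A" using A_diff P_in by blast
    show "norm x = max (norm (x - P x)) (norm (x - (x - P x)))" if "x \<in> A" for x
      using P_norm[OF that] by (simp add: max.commute)
  qed (simp_all add: P_add P_scaleR P_diff P_in P_idem scaleR_diff_right)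
qed (rule A_sub)

lemma norm_sum: "m \<in> A \<Longrightarrow> n \<in> A \<Longrightarrow> P m = m \<Longrightarrow> P n = 0 \<Longrightarrow> norm (m + n) = max (norm m) (norm n)"
  using P_norm[of "m + n"] by (simp add: A_add P_add)

text \<open>Expresses the unit ball of the range by norm bounds for translates, which survive weak*
  limits. A nonzero complementary part \<open>q\<close> is detected by the translate in its own
  direction, which lengthens it by 1.\<close>

lemma unit_range_iff:
  assumes x: "x \<in> A" "norm x \<le> 1"
  shows "P x = x \<longleftrightarrow> (\<forall>y\<in>A. P y = 0 \<and> norm y \<le> 1 \<longrightarrow> norm (x + y) \<le> 1)"
proof
  assume "P x = x"
  then show "\<forall>y\<in>A. P y = 0 \<and> norm y \<le> 1 \<longrightarrow> norm (x + y) \<le> 1"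
    using x by (simp add: norm_sum)
next
  assume le: "\<forall>y\<in>A. P y = 0 \<and> norm y \<le> 1 \<longrightarrow> norm (x + y) \<le> 1"
  define q where "q = x - P x"
  have q: "q \<in> A" "P q = 0" using x by (simp_all add: q_def A_diff P_in P_diff P_idem)
  have "q = 0"
  proof (rule ccontr)
    assume "q \<noteq> 0"
    define y where "y = (1 / norm q) *\<^sub>R q"
    have y: "y \<in> A" "norm y = 1" "P y = 0"
      using \<open>q \<noteq> 0\<close> q by (simp_all add: y_def A_scaleR P_scaleR)
    have "q + y = (1 + 1 / norm q) *\<^sub>R q" by (simp add: y_def scaleR_add_left)
    then have "norm (q + y) = (1 + 1 / norm q) * norm q"
      by (metis abs_of_nonneg add_nonneg_nonneg norm_ge_zero norm_scaleR zero_le_divide_1_iff zero_le_one)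
    then have "norm (q + y) = norm q + 1" using \<open>q \<noteq> 0\<close> by (simp add: distrib_right)
    moreover have eq: "q + y = (x + y) - P (x + y)" using x y by (simp add: q_def P_add)
    have "norm (q + y) \<le> norm (x + y)" unfolding eq by (intro norm_compl_le A_add x y)
    moreover have "norm (x + y) \<le> 1" using le y by simp
    moreover have "norm q > 0" using \<open>q \<noteq> 0\<close> by simp
    ultimately show False by linarith
  qed
  then show "P x = x" by (simp add: q_def)
qed

text \<open>If \<open>p = P (D n)\<close> were nonzero, then \<open>\<plusminus>n + S p\<close> would be moved by \<open>1 \<plusminus> t D\<close> to elements
  with too large components in the range of \<open>P\<close>.\<close>

lemma skew_ker:
  assumes D: "linear D" "\<And>x. x \<in> A \<Longrightarrow> D x \<in> A" "skew A D" and n: "n \<in> A" "P n = 0"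
  shows "P (D n) = 0"
proof (rule ccontr)
  interpret D: linear D by fact
  obtain C where "C \<ge> 0" and C: "\<And>s x. x \<in> A \<Longrightarrow> norm (x + s *\<^sub>R D x) \<le> (1 + C * s\<^sup>2) * norm x"
    using D(3) unfolding skew_def by blast
  define p where "p = P (D n)"
  assume "P (D n) \<noteq> 0"
  then have p0: "norm p > 0" by (simp add: p_def)
  \<comment> \<open>This weight makes S p longer than \<open>n\<close>, so that r n + S p has the
    norm of S p for both signs \<open>r\<close>.\<close>
  define S where "S = (norm n + 1) / norm p"
  have S: "S > 0" "S * norm p = norm n + 1"
    using p0 by (simp_all add: S_def add_nonneg_pos)
  have pA: "p \<in> A" "P p = p" using n D(2) by (simp_all add: p_def P_in P_idem)
  have "1 \<le> C * S * t" if t: "t > 0" for t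
  proof -
    have bound: "norm (S *\<^sub>R p + t *\<^sub>R p + (r * t * S) *\<^sub>R P (D p)) \<le> (1 + C * t\<^sup>2) * (S * norm p)"
      if r: "r = 1 \<or> r = -1" for r
    proof -
      define y where "y = r *\<^sub>R n + S *\<^sub>R p"
      have yA: "y \<in> A" using n pA by (simp add: y_def A_add A_scaleR)
      have "norm y = norm (S *\<^sub>R p + r *\<^sub>R n)" by (simp add: y_def add.commute)
      also have "\<dots> = max (norm (S *\<^sub>R p)) (norm (r *\<^sub>R n))"
        using n pA by (intro norm_sum) (simp_all add: A_scaleR P_scaleR)
      finally have ny: "norm y = S * norm p" using r S by auto
      have "P (y + (r * t) *\<^sub>R D y) = S *\<^sub>R p + (r * r * t) *\<^sub>R p + (r * t * S) *\<^sub>R P (D p)"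
        unfolding y_def using n pA D(2)
        by (simp add: D.add D.scale P_add P_scaleR A_add A_scaleR p_def[symmetric] scaleR_add_right mult_ac add_ac)
      moreover have "r * r = 1" using r by auto
      ultimately have "S *\<^sub>R p + t *\<^sub>R p + (r * t * S) *\<^sub>R P (D p) = P (y + (r * t) *\<^sub>R D y)" by simp
      then have "norm (S *\<^sub>R p + t *\<^sub>R p + (r * t * S) *\<^sub>R P (D p)) \<le> norm (y + (r * t) *\<^sub>R D y)"
        using norm_P_le[of "y + (r * t) *\<^sub>R D y"] yA D(2) by (simp add: A_add A_scaleR)
      also have "\<dots> \<le> (1 + C * (r * t)\<^sup>2) * norm y" by (rule C[OF yA])
      finally show ?thesis unfolding ny using r by auto
    qed
    \<comment> \<open>Adding the two signs cancels the uncontrolled P (D p). A gain linear in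
      \<open>t\<close> is left against an error quadratic in \<open>t\<close>.\<close>
    have eq: "(2 * (S + t)) *\<^sub>R p = (S *\<^sub>R p + t *\<^sub>R p + (1 * t * S) *\<^sub>R P (D p))
        + (S *\<^sub>R p + t *\<^sub>R p + ((-1) * t * S) *\<^sub>R P (D p))"
      by (simp add: scaleR_2 scaleR_add_left algebra_simps flip: scaleR_scaleR)
    have "norm ((2 * (S + t)) *\<^sub>R p) \<le> (1 + C * t\<^sup>2) * (S * norm p) + (1 + C * t\<^sup>2) * (S * norm p)"
      unfolding eq by (intro order_trans[OF norm_triangle_ineq] add_mono bound) auto
    moreover have "norm ((2 * (S + t)) *\<^sub>R p) = (2 * (S + t)) * norm p"
      using S(1) t by (simp only: norm_scaleR) simp
    moreover have "(1 + C * t\<^sup>2) * (S * norm p) + (1 + C * t\<^sup>2) * (S * norm p)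
        = (2 * ((1 + C * t\<^sup>2) * S)) * norm p"
      by (simp only: mult_2 distrib_right mult.assoc)
    ultimately have "(2 * (S + t)) * norm p \<le> (2 * ((1 + C * t\<^sup>2) * S)) * norm p" by metis
    then have "2 * (S + t) \<le> 2 * ((1 + C * t\<^sup>2) * S)"
      using p0 by (simp only: mult_le_cancel_right_pos)
    then have "t * 1 \<le> t * (C * S * t)" by (simp add: algebra_simps power2_eq_square)
    then show ?thesis using t by simp
  qed
  note le = this
  define k where "k = C * S"
  have k: "k \<ge> 0" using \<open>C \<ge> 0\<close> S(1) by (simp add: k_def)
  then have "0 < 1 / (2 * (k + 1))" by simp
  then have "1 \<le> k * (1 / (2 * (k + 1)))" unfolding k_def by (rule le)
  also have "\<dots> < 1" using k by (simp add: divide_less_eq)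
  finally show False by simp
qed

lemma skew_commute:
  assumes "linear D" "\<And>x. x \<in> A \<Longrightarrow> D x \<in> A" "skew A D" "x \<in> A"
  shows "P (D x) = D (P x)"
proof -
  interpret D: linear D by fact
  have DA: "D z \<in> A" if "z \<in> A" for z using that by (rule assms(2))
  have "P (D (x - P x)) = 0"
    by (rule skew_ker[OF assms(1) DA assms(3)]) (simp_all add: A_diff P_in P_diff P_idem assms(4))
  moreover have "D (P x) - P (D (P x)) = 0"
    by (rule M_proj.skew_ker[OF compl assms(1) DA assms(3)]) (simp_all add: P_in P_idem assms(4))
  ultimately show ?thesis by (simp add: D.diff P_diff P_in DA assms(4))
qed

text \<open>The vector \<open>v\<close> has the \<open>P'\<close>-part of m1 + q1 and the
  complementary part of q1 - m1. Both lie in the unit ball, since \<open>m1\<close> is in the range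
  and \<open>q1\<close> in the kernel of \<open>P\<close>, but the complement of \<open>v\<close>
  with respect to \<open>P\<close> is a multiple of \<open>q\<close> longer than 1.\<close>

lemma M_proj_commute:
  assumes P': "M_proj A P'" and m: "m \<in> A" "P m = m"
  shows "P (P' m) = P' m"
proof (rule ccontr)
  interpret p: M_proj A P' by (rule P')
  assume "P (P' m) \<noteq> P' m"
  define q where "q = P' m - P (P' m)"
  have q: "norm q > 0" using \<open>P (P' m) \<noteq> P' m\<close> by (simp add: q_def)
  then have m0: "norm m > 0" by (auto simp: q_def p.P_0 P_0)
  have qA: "q \<in> A" "P q = 0" using m by (simp_all add: q_def A_diff P_in p.P_in P_diff P_idem)
  define m1 where "m1 = (1 / norm m) *\<^sub>R m"
  define q1 where "q1 = (1 / norm q) *\<^sub>R q"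
  have m1: "m1 \<in> A" "P m1 = m1" "norm m1 = 1"
    using m m0 by (simp_all add: m1_def A_scaleR P_scaleR)
  have q1: "q1 \<in> A" "P q1 = 0" "norm q1 = 1"
    using qA q by (simp_all add: q1_def A_scaleR P_scaleR)
  define v where "v = P' m1 + P' m1 - m1 + q1"
  have vA: "v \<in> A" using m1 q1 by (simp add: v_def A_add A_diff p.P_in)
  have P'v: "P' v = P' (m1 + q1)"
    unfolding v_def using m1 q1 by (simp add: p.P_add p.P_diff p.P_idem A_add A_diff p.P_in)
  have "v - P' v = (q1 - m1) - P' (q1 - m1)"
    unfolding P'v using m1 q1 by (simp add: v_def p.P_add p.P_diff)
  then have "norm v = max (norm (P' (m1 + q1))) (norm ((q1 - m1) - P' (q1 - m1)))"
    using p.P_norm[OF vA] P'v by simp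
  also have "\<dots> \<le> max (norm (m1 + q1)) (norm (q1 - m1))"
    using m1 q1 by (intro max.mono p.norm_P_le p.norm_compl_le) (simp_all add: A_add A_diff)
  also have "\<dots> \<le> 1"
    using norm_sum[of m1 q1] norm_sum[of "- m1" q1] m1 q1 by (simp add: A_neg P_neg)
  finally have "norm v \<le> 1" .
  have "v - P v = (2 / norm m + 1 / norm q) *\<^sub>R q"
  proof -
    have "v - P v = 2 *\<^sub>R (P' m1 - P (P' m1)) + q1"
      unfolding v_def using m1 q1 by (simp add: P_add P_diff A_add A_diff p.P_in scaleR_2)
    also have "P' m1 - P (P' m1) = (1 / norm m) *\<^sub>R q"
      using m by (simp add: m1_def q_def p.P_scaleR P_scaleR p.P_in scaleR_diff_right)
    finally show ?thesis by (simp add: q1_def scaleR_add_left)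
  qed
  then have "norm (v - P v) = (2 / norm m + 1 / norm q) * norm q" using q m0 by simp
  also have "\<dots> > 1" using q m0 by (simp add: distrib_right)
  finally show False using norm_compl_le[OF vA] \<open>norm v \<le> 1\<close> by simp
qed

end

subsection \<open>Extreme points of compact sets of functions\<close>

text \<open>The Krein-Milman argument, with faces defined by midpoints. A minimal closed face is a
  single point, because a coordinate separating two of its points attains its maximum on a smaller
  face.\<close>

lemma compact_extreme_point:
  fixes B :: "('e \<Rightarrow> real) set"
  assumes B: "compact B" "closed B" "B \<noteq> {}"
  obtains f where "f \<in> B" "\<And>g h. g \<in> B \<Longrightarrow> h \<in> B \<Longrightarrow> f = (\<lambda>e. (g e + h e) / 2) \<Longrightarrow> g = f"
proof -
  define face where "face T \<longleftrightarrow> closed T \<and> T \<subseteq> B \<and> T \<noteq> {} \<and>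
    (\<forall>g\<in>B. \<forall>h\<in>B. (\<lambda>e. (g e + h e) / 2) \<in> T \<longrightarrow> g \<in> T \<and> h \<in> T)" for T
  have "\<exists>T\<in>Collect face. \<forall>T'\<in>Collect face. T' \<subseteq> T \<longrightarrow> T' = T"
  proof (rule predicate_Zorn)
    show "partial_order_on (Collect face) (relation_of (\<lambda>T T'. T' \<subseteq> T) (Collect face))"
      by (rule partial_order_on_relation_ofI) auto
    fix C assume C: "C \<in> Chains (relation_of (\<lambda>T T'. T' \<subseteq> T) (Collect face))"
    then have chain: "\<And>S T. S \<in> C \<Longrightarrow> T \<in> C \<Longrightarrow> face S \<and> (S \<subseteq> T \<or> T \<subseteq> S)"
      by (auto simp: Chains_def relation_of_def)
    show "\<exists>u\<in>Collect face. \<forall>a\<in>C. u \<subseteq> a"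
    proof (cases "C = {}")
      case True
      then show ?thesis using B by (intro bexI[of _ B]) (auto simp: face_def)
    next
      case False
      have fin: "\<exists>T\<in>C. T \<subseteq> \<Inter>D" if "finite D" "D \<subseteq> C" "D \<noteq> {}" for D
        using that(1,3,2)
      proof (induction D rule: finite_ne_induct)
        case (insert S D)
        then obtain T where "T \<in> C" "T \<subseteq> \<Inter>D" by auto
        then show ?case using insert.prems chain[of S T] by auto
      qed auto
      have "B \<inter> \<Inter>C \<noteq> {}"
      proof (rule compact_imp_fip[OF B(1)])
        show "closed T" if "T \<in> C" for T using chain[OF that that] unfolding face_def by blast
        show "B \<inter> \<Inter>D \<noteq> {}" if D: "finite D" "D \<subseteq> C" for D
        proof (cases "D = {}")
          case False
          then obtain T where T: "T \<in> C" "T \<subseteq> \<Inter>D" using fin[OF D False] by blast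
          have "T \<noteq> {}" "T \<subseteq> B" using chain[OF T(1) T(1)] by (simp_all add: face_def)
          then show ?thesis using T(2) by blast
        qed (use B in simp)
      qed
      moreover have faces: "closed T" "T \<subseteq> B"
        "\<And>g h. g \<in> B \<Longrightarrow> h \<in> B \<Longrightarrow> (\<lambda>e. (g e + h e) / 2) \<in> T \<Longrightarrow> g \<in> T \<and> h \<in> T" if "T \<in> C" for T
        using chain[OF that that] unfolding face_def by blast+
      moreover have sub: "\<Inter>C \<subseteq> B" using False faces(2) by blast
      moreover have "closed (\<Inter>C)" using faces(1) by (intro closed_Inter) blast
      moreover have "g \<in> \<Inter>C \<and> h \<in> \<Inter>C" if "g \<in> B" "h \<in> B" "(\<lambda>e. (g e + h e) / 2) \<in> \<Inter>C" for g h
        using faces(3)[OF _ that(1,2)] that(3) by blast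
      ultimately have "face (\<Inter>C)" unfolding face_def by (simp add: Int_absorb1)
      then show ?thesis by blast
    qed
  qed
  then obtain T where T: "face T" and min: "\<And>T'. face T' \<Longrightarrow> T' \<subseteq> T \<Longrightarrow> T' = T" by blast
  have T_compact: "compact T"
    using T B compact_Int_closed[of B T] by (auto simp: face_def Int_absorb1)
  have single: "f = g" if fg: "f \<in> T" "g \<in> T" for f g
  proof (rule ccontr)
    assume "f \<noteq> g"
    then obtain e where e: "f e \<noteq> g e" by blast
    have cont: "continuous_on S (\<lambda>f. f e)" for S :: "('e \<Rightarrow> real) set"
      by (rule continuous_on_subset[OF continuous_on_product_coordinates]) simp
    obtain h where h: "h \<in> T" "\<And>f. f \<in> T \<Longrightarrow> f e \<le> h e"
      using continuous_attains_sup[OF T_compact _ cont] fg by blast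
    define T' where "T' = T \<inter> {f. f e = h e}"
    have "closed T'"
      unfolding T'_def using T by (intro closed_Int closed_Collect_eq cont) (auto simp: face_def)
    moreover have "g1 \<in> T' \<and> g2 \<in> T'" if "g1 \<in> B" "g2 \<in> B" "(\<lambda>e. (g1 e + g2 e) / 2) \<in> T'" for g1 g2
    proof -
      have "g1 \<in> T \<and> g2 \<in> T" using that T unfolding face_def T'_def by blast
      moreover have "(g1 e + g2 e) / 2 = h e" using that by (simp add: T'_def)
      ultimately show ?thesis using h(2)[of g1] h(2)[of g2] by (simp add: T'_def)
    qed
    ultimately have "face T'" using T h unfolding face_def by (auto simp: T'_def)
    then have "T' = T" using min by (simp add: T'_def)
    then have "f e = h e" "g e = h e" using fg by (auto simp: T'_def)
    then show False using e by simp
  qed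
  obtain f where f: "f \<in> T" using T by (auto simp: face_def)
  show thesis
  proof
    show "f \<in> B" using f T by (auto simp: face_def)
    show "g = f" if "g \<in> B" "h \<in> B" "f = (\<lambda>e. (g e + h e) / 2)" for g h
      using that f T single[of g f] unfolding face_def by blast
  qed
qed

subsection \<open>Norming functionals\<close>

text \<open>Hahn-Banach through minimality: among the sublinear functionals below the norm that are
  small enough at \<open>- d\<close>, a minimal one is linear.\<close>

lemma norming_functional:
  fixes d :: "'e::real_normed_vector"
  obtains \<phi> :: "'e \<Rightarrow>\<^sub>L real" where "norm \<phi> \<le> 1" "blinfun_apply \<phi> d = norm d"
proof -
  define subl where "subl q \<longleftrightarrow> (\<forall>x y. q (x + y) \<le> q x + q y) \<and> (\<forall>t x. 0 \<le> t \<longrightarrow> q (t *\<^sub>R x) = t * q x)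
    \<and> (\<forall>x. q x \<le> norm x)" for q :: "'e \<Rightarrow> real"
  have low: "- norm x \<le> q x" if "subl q" for q x
  proof -
    have "q (0 *\<^sub>R x) = 0 * q x" using that unfolding subl_def by blast
    then have "0 \<le> q x + q (- x)" using that unfolding subl_def by (metis add.right_inverse mult_zero_left scale_zero_left)
    moreover have "q (- x) \<le> norm x" using that unfolding subl_def by (metis norm_minus_cancel)
    ultimately show ?thesis by linarith
  qed
  \<comment> \<open>Lowers a sublinear functional in the direction \<open>y\<close> while keeping it
    sublinear. A minimal \<open>q\<close> is unchanged for every \<open>y\<close>, and this is
    additivity.\<close>
  define mv where "mv q y x = (INF t\<in>{0..}. q (x + t *\<^sub>R y) - t * q y)" for q :: "'e \<Rightarrow> real" and y x
  have mv_lower: "- q (- x) \<le> q (x + t *\<^sub>R y) - t * q y" if q: "subl q" and t: "0 \<le> t" for q x y t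
  proof -
    have "t * q y = q (t *\<^sub>R y)" using q t by (simp add: subl_def)
    also have "\<dots> = q ((x + t *\<^sub>R y) + - x)" by simp
    also have "\<dots> \<le> q (x + t *\<^sub>R y) + q (- x)" using q unfolding subl_def by blast
    finally show ?thesis by simp
  qed
  have mv_le: "mv q y x \<le> q (x + t *\<^sub>R y) - t * q y" if q: "subl q" and t: "0 \<le> t" for q x y t
    unfolding mv_def using mv_lower[OF q] t by (intro cINF_lower bdd_belowI2[of _ "- q (- x)"]) auto
  have mv_greatest: "c \<le> mv q y x" if "\<And>t. 0 \<le> t \<Longrightarrow> c \<le> q (x + t *\<^sub>R y) - t * q y" for q x y c
    unfolding mv_def using that by (intro cINF_greatest) auto
  have mv_subl: "subl (mv q y)" if q: "subl q" for q y
  proof -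
    have add: "mv q y (x1 + x2) \<le> mv q y x1 + mv q y x2" for x1 x2
    proof -
      have "mv q y (x1 + x2) - (q (x2 + t2 *\<^sub>R y) - t2 * q y) \<le> mv q y x1" if t2: "0 \<le> t2" for t2
      proof (rule mv_greatest)
        fix t1 :: real assume t1: "0 \<le> t1"
        have "mv q y (x1 + x2) \<le> q (x1 + x2 + (t1 + t2) *\<^sub>R y) - (t1 + t2) * q y"
          using t1 t2 by (intro mv_le q) auto
        moreover have "q ((x1 + t1 *\<^sub>R y) + (x2 + t2 *\<^sub>R y)) \<le> q (x1 + t1 *\<^sub>R y) + q (x2 + t2 *\<^sub>R y)"
          using q unfolding subl_def by blast
        ultimately show "mv q y (x1 + x2) - (q (x2 + t2 *\<^sub>R y) - t2 * q y) \<le> q (x1 + t1 *\<^sub>R y) - t1 * q y"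
          by (simp add: algebra_simps)
      qed
      then have "mv q y (x1 + x2) - mv q y x1 \<le> mv q y x2"
        by (intro mv_greatest) (simp add: algebra_simps)
      then show ?thesis by simp
    qed
    have pos: "s * mv q y x \<le> mv q y (s *\<^sub>R x)" if s: "0 < s" for s x
    proof (rule mv_greatest)
      fix t :: real assume t: "0 \<le> t"
      have "s * mv q y x \<le> s * (q (x + (t / s) *\<^sub>R y) - (t / s) * q y)"
        using s t by (intro mult_left_mono mv_le q) auto
      also have "s * q (x + (t / s) *\<^sub>R y) = q (s *\<^sub>R (x + (t / s) *\<^sub>R y))"
        using q s by (simp add: subl_def)
      then have "s * (q (x + (t / s) *\<^sub>R y) - (t / s) * q y) = q (s *\<^sub>R x + t *\<^sub>R y) - t * q y"
        using s by (simp add: algebra_simps)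
      finally show "s * mv q y x \<le> q (s *\<^sub>R x + t *\<^sub>R y) - t * q y" .
    qed
    have zero: "mv q y 0 = 0"
    proof (rule antisym)
      have "q 0 = 0" using q unfolding subl_def by (metis mult_zero_left order_refl scale_zero_left)
      then show "mv q y 0 \<le> 0" using mv_le[OF q, of 0 y 0] by simp
      show "0 \<le> mv q y 0" using q by (intro mv_greatest) (simp add: subl_def)
    qed
    have hom: "mv q y (s *\<^sub>R x) = s * mv q y x" if s: "0 \<le> s" for s x
    proof (cases "s = 0")
      case False
      then have s0: "0 < s" using s by simp
      have "(1 / s) * mv q y (s *\<^sub>R x) \<le> mv q y ((1 / s) *\<^sub>R (s *\<^sub>R x))"
        using s0 by (intro pos) simp
      then have "mv q y (s *\<^sub>R x) \<le> s * mv q y x" using s0 by (simp add: field_simps)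
      with pos[OF s0, of x] show ?thesis by simp
    qed (simp add: zero)
    have "mv q y x \<le> norm x" for x
      using mv_le[OF q, of 0 y x] q unfolding subl_def by (auto intro: order_trans)
    then show ?thesis unfolding subl_def using add hom by blast
  qed
  define Q where "Q = {q. subl q \<and> q (- d) \<le> - norm d}"
  have norm_subl: "subl norm" by (simp add: subl_def norm_triangle_ineq)
  \<comment> \<open>The parameter value 1 in the infimum already gives the required bound at
    \<open>- d\<close>, so the family is nonempty.\<close>
  have "mv norm d (- d) \<le> norm (- d + 1 *\<^sub>R d) - 1 * norm d"
    by (intro mv_le norm_subl) simp
  then have Q_ne: "mv norm d \<in> Q" using mv_subl[OF norm_subl] by (simp add: Q_def)
  have "\<exists>q\<in>Q. \<forall>q'\<in>Q. q' \<le> q \<longrightarrow> q' = q"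
  proof (rule predicate_Zorn)
    show "partial_order_on Q (relation_of (\<lambda>q q'. q' \<le> q) Q)"
      by (rule partial_order_on_relation_ofI) auto
    fix C assume C: "C \<in> Chains (relation_of (\<lambda>q q'. q' \<le> q) Q)"
    then have CQ: "\<And>q. q \<in> C \<Longrightarrow> q \<in> Q" and chain: "\<And>q q'. q \<in> C \<Longrightarrow> q' \<in> C \<Longrightarrow> q \<le> q' \<or> q' \<le> q"
      by (auto simp: Chains_def relation_of_def)
    show "\<exists>u\<in>Q. \<forall>q\<in>C. u \<le> q"
    proof (cases "C = {}")
      case True
      then show ?thesis using Q_ne by blast
    next
      case False
      define m where "m x = (INF q\<in>C. q x)" for x
      have m_le: "m x \<le> q x" if "q \<in> C" for q x
        unfolding m_def using that CQ low
        by (intro cINF_lower bdd_belowI2[of _ "- norm x"]) (auto simp: Q_def)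
      have m_greatest: "c \<le> m x" if "\<And>q. q \<in> C \<Longrightarrow> c \<le> q x" for c x
        unfolding m_def using that False by (intro cINF_greatest) auto
      obtain q0 where q0: "q0 \<in> C" using False by blast
      have add: "m (x + y) \<le> m x + m y" for x y
      proof -
        have "m (x + y) - q y \<le> m x" if q: "q \<in> C" for q
        proof (rule m_greatest)
          fix q' assume q': "q' \<in> C"
          have "\<exists>p\<in>C. p \<le> q \<and> p \<le> q'" using chain[OF q q'] q q' by auto
          then obtain p where p: "p \<in> C" "p \<le> q" "p \<le> q'" by blast
          have "m (x + y) \<le> p (x + y)" by (rule m_le[OF p(1)])
          also have "\<dots> \<le> p x + p y" using CQ[OF p(1)] by (simp add: Q_def subl_def)
          also have "\<dots> \<le> q' x + q y" using p by (simp add: add_mono le_funD)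
          finally show "m (x + y) - q y \<le> q' x" by simp
        qed
        then have "m (x + y) - m x \<le> m y" by (intro m_greatest) (simp add: algebra_simps)
        then show ?thesis by simp
      qed
      have hom: "m (t *\<^sub>R x) = t * m x" if t: "0 \<le> t" for t x
      proof (rule antisym)
        have qh: "q (t *\<^sub>R x) = t * q x" if "q \<in> C" for q
          using CQ[OF that] t by (simp add: Q_def subl_def)
        show "t * m x \<le> m (t *\<^sub>R x)"
          using t m_le by (intro m_greatest) (simp add: qh mult_left_mono)
        show "m (t *\<^sub>R x) \<le> t * m x"
        proof (cases "t = 0")
          case True
          then show ?thesis using m_le[OF q0, of "t *\<^sub>R x"] qh[OF q0] by simp
        next
          case False
          have "m (t *\<^sub>R x) / t \<le> m x"
          proof (rule m_greatest)
            fix q assume q: "q \<in> C"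
            show "m (t *\<^sub>R x) / t \<le> q x"
              using m_le[OF q, of "t *\<^sub>R x"] qh[OF q] t False by (simp add: field_simps)
          qed
          then show ?thesis using t False by (simp add: field_simps)
        qed
      qed
      have "m x \<le> norm x" for x
        using m_le[OF q0, of x] CQ[OF q0] by (auto simp: Q_def subl_def intro: order_trans)
      moreover have "m (- d) \<le> - norm d"
        using m_le[OF q0, of "- d"] CQ[OF q0] by (auto simp: Q_def intro: order_trans)
      ultimately have "m \<in> Q" using add hom by (simp add: Q_def subl_def)
      then show ?thesis using m_le by (intro bexI[of _ m]) (auto simp: le_fun_def)
    qed
  qed
  then obtain q where q: "subl q" "q (- d) \<le> - norm d"
    and min: "\<And>q'. q' \<in> Q \<Longrightarrow> q' \<le> q \<Longrightarrow> q' = q"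
    unfolding Q_def by blast
  have mv_eq: "mv q y = q" for y
  proof (rule min)
    have le: "mv q y x \<le> q x" for x using mv_le[OF q(1), of 0 y x] by simp
    then show "mv q y \<le> q" by (simp add: le_fun_def)
    show "mv q y \<in> Q" unfolding Q_def using mv_subl[OF q(1)] le[of "- d"] q(2) by auto
  qed
  have add: "q (x + y) = q x + q y" for x y
    using mv_le[OF q(1), of 1 y x] q(1) unfolding mv_eq subl_def by (auto intro: antisym)
  have minus: "q (- x) = - q x" for x
  proof -
    have "q (0 *\<^sub>R x) = 0 * q x" using q(1) unfolding subl_def by blast
    then show ?thesis using add[of x "- x"] by simp
  qed
  have scale: "q (r *\<^sub>R x) = r * q x" for r x
  proof (cases "0 \<le> r")
    case True
    then show ?thesis using q(1) by (simp add: subl_def)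
  next
    case False
    have "q (t *\<^sub>R x) = t * q x" if "0 \<le> t" for t using q(1) that unfolding subl_def by blast
    from this[of "- r"] have "q ((- r) *\<^sub>R x) = (- r) * q x" using False by linarith
    then show ?thesis using minus[of "r *\<^sub>R x"] by simp
  qed
  have abs_le: "\<bar>q x\<bar> \<le> norm x" for x
    using q(1) minus[of x] norm_minus_cancel[of x] unfolding subl_def
    by (metis abs_le_iff)
  have lin: "bounded_linear q"
    by (rule bounded_linear_intro[of _ 1]) (simp_all add: add scale abs_le)
  show thesis
  proof
    show "norm (Blinfun q) \<le> 1"
      using lin abs_le by (intro norm_blinfun_bound) (simp_all add: bounded_linear_Blinfun_apply)
    have "q d = norm d" using q(2) minus[of d] abs_le[of d] by simp
    then show "blinfun_apply (Blinfun q) d = norm d" using lin by (simp add: bounded_linear_Blinfun_apply)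
  qed
qed

text \<open>The functionals are added one at a time, each by the one-dimensional step of the
  Hahn-Banach theorem. When they are evaluations at points of a predual, the resulting combination
  is again such an evaluation.\<close>

lemma finite_separation:
  fixes V :: "'v::real_vector set" and g :: "'v \<Rightarrow> real" and l :: "'f \<Rightarrow> 'v \<Rightarrow> real"
  assumes "finite F" and V: "subspace V"
    and g: "\<And>x y r. x \<in> V \<Longrightarrow> y \<in> V \<Longrightarrow> g (x + y) = g x + g y \<and> g (r *\<^sub>R x) = r * g x"
    and l: "\<And>f x y r. f \<in> F \<Longrightarrow> x \<in> V \<Longrightarrow> y \<in> V \<Longrightarrow> l f (x + y) = l f x + l f y \<and> l f (r *\<^sub>R x) = r * l f x"
    and p: "\<And>x y. x \<in> V \<Longrightarrow> y \<in> V \<Longrightarrow> p (x + y) \<le> p x + (p y :: real)"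
      "\<And>r x. x \<in> V \<Longrightarrow> 0 < r \<Longrightarrow> p (r *\<^sub>R x) = r * p x"
    and le: "\<And>x. x \<in> V \<Longrightarrow> (\<And>f. f \<in> F \<Longrightarrow> l f x = 0) \<Longrightarrow> g x \<le> p x"
  shows "\<exists>c. \<forall>x\<in>V. g x - (\<Sum>f\<in>F. c f * l f x) \<le> p x"
  using assms
proof (induction F arbitrary: V rule: finite_induct)
  case empty
  then show ?case by simp
next
  case (insert f F)
  define V' where "V' = {x \<in> V. l f x = 0}"
  have V'V: "V' \<subseteq> V" by (auto simp: V'_def)
  have l_zero: "l f 0 = 0" using insert.prems(3)[of f 0 0 0] subspace_0[OF insert.prems(1)] by simp
  have V': "subspace V'"
    using insert.prems(1) insert.prems(3)[of f] l_zero
    by (auto simp: V'_def subspace_def)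
  have "\<exists>c. \<forall>x\<in>V'. g x - (\<Sum>f\<in>F. c f * l f x) \<le> p x"
  proof (rule insert.IH[OF V'])
    show "g x \<le> p x" if "x \<in> V'" "\<And>h. h \<in> F \<Longrightarrow> l h x = 0" for x
      using that by (intro insert.prems(6)) (auto simp: V'_def)
  qed (use V'V insert.prems(2-5) in \<open>auto simp: subset_iff\<close>)
  then obtain c where c: "\<And>x. x \<in> V' \<Longrightarrow> g x - (\<Sum>f\<in>F. c f * l f x) \<le> p x" by blast
  define g' where "g' x = g x - (\<Sum>f\<in>F. c f * l f x)" for x
  have g'_add: "g' (x + y) = g' x + g' y" if "x \<in> V" "y \<in> V" for x y
    using that insert.prems(2,3) by (simp add: g'_def distrib_left sum.distrib)
  have g'_scale: "g' (r *\<^sub>R x) = r * g' x" if "x \<in> V" for r x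
  proof -
    have "(\<Sum>f\<in>F. c f * l f (r *\<^sub>R x)) = r * (\<Sum>f\<in>F. c f * l f x)"
      unfolding sum_distrib_left using that insert.prems(3) by (intro sum.cong) auto
    then show ?thesis using that insert.prems(2) by (simp add: g'_def algebra_simps)
  qed
  have ex: "\<exists>c0. \<forall>x\<in>V. g' x - c0 * l f x \<le> p x"
  proof (cases "V' = V")
    case True
    then show ?thesis using c by (intro exI[of _ 0]) (auto simp: g'_def)
  next
    case False
    then obtain a where a: "a \<in> V" "l f a \<noteq> 0" by (auto simp: V'_def)
    define a1 where "a1 = (1 / l f a) *\<^sub>R a"
    have a1: "a1 \<in> V" "l f a1 = 1" "- a1 \<in> V" "l f (- a1) = - 1"
      using a insert.prems(1) insert.prems(3)[of f a a] insert.prems(3)[of f a1 a1 "-1"]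
      by (auto simp: a1_def subspace_scale subspace_neg)
    \<comment> \<open>By homogeneity only the slices where \<open>l f\<close> is 1 or -1 matter.
      Sums of a point of each lie in \<open>V'\<close>, which leaves room for \<open>c0\<close>
      between the lower bounds from one slice and the upper bounds from the other.\<close>
    define S where "S = {g' x - p x | x. x \<in> V \<and> l f x = 1}"
    have key: "g' x - p x \<le> p y - g' y" if "x \<in> V" "l f x = 1" "y \<in> V" "l f y = - 1" for x y
    proof -
      have "x + y \<in> V'" using that insert.prems(1) insert.prems(3)[of f x y] by (auto simp: V'_def subspace_add)
      then have "g' (x + y) \<le> p (x + y)" using c by (simp add: g'_def)
      then show ?thesis using that g'_add[of x y] insert.prems(4)[of x y] by simp
    qed
    have bdd: "bdd_above S" using key a1 by (auto simp: S_def intro!: bdd_aboveI[of _ "p (- a1) - g' (- a1)"])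
    have ne: "S \<noteq> {}" using a1 by (auto simp: S_def)
    define c0 where "c0 = Sup S"
    have 1: "g' x - c0 \<le> p x" if "x \<in> V" "l f x = 1" for x
    proof -
      have "g' x - p x \<le> c0" unfolding c0_def using that by (intro cSup_upper bdd) (auto simp: S_def)
      then show ?thesis by simp
    qed
    have 2: "g' y + c0 \<le> p y" if "y \<in> V" "l f y = - 1" for y
    proof -
      have "c0 \<le> p y - g' y" unfolding c0_def using that key by (intro cSup_least ne) (auto simp: S_def)
      then show ?thesis by simp
    qed
    have "g' x - c0 * l f x \<le> p x" if x: "x \<in> V" for x
    proof (cases "l f x = 0")
      case True
      then show ?thesis using c[of x] x by (simp add: V'_def g'_def)
    next
      case False
      define t where "t = \<bar>l f x\<bar>"
      have t: "0 < t" using False by (simp add: t_def)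
      define y where "y = (1 / t) *\<^sub>R x"
      have y: "y \<in> V" "l f y = sgn (l f x)"
        using x t False insert.prems(1) insert.prems(3)[of f x x "1 / t"]
        by (auto simp: y_def subspace_scale t_def sgn_if)
      have xy: "x = t *\<^sub>R y" using t by (simp add: y_def)
      have "g' y - c0 * sgn (l f x) \<le> p y"
        using 1[of y] 2[of y] y False by (auto simp: sgn_if split: if_splits)
      then have "t * (g' y - c0 * sgn (l f x)) \<le> t * p y" using t by simp
      moreover have "t * p y = p x" using xy insert.prems(5)[OF y(1) t] by simp
      moreover have "t * g' y = g' x" using xy g'_scale[OF y(1)] by simp
      moreover have "t * sgn (l f x) = l f x" by (simp add: t_def sgn_if abs_if)
      ultimately show ?thesis by (simp add: algebra_simps)
    qed
    then show ?thesis by blast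
  qed
  then obtain c0 where c0: "\<And>x. x \<in> V \<Longrightarrow> g' x - c0 * l f x \<le> p x" by blast
  have "g x - (\<Sum>h\<in>insert f F. (c(f := c0)) h * l h x) \<le> p x" if "x \<in> V" for x
  proof -
    have "(\<Sum>h\<in>F. (c(f := c0)) h * l h x) = (\<Sum>h\<in>F. c h * l h x)"
      using insert.hyps by (intro sum.cong) auto
    then show ?thesis using c0[OF that] insert.hyps by (simp add: g'_def)
  qed
  then show ?case by blast
qed

subsection \<open>Dual Banach spaces\<close>

locale dual_space =
  fixes A :: "'a::real_normed_vector set" and Phi :: "'a \<Rightarrow> ('e::banach \<Rightarrow>\<^sub>L real)"
  assumes A_sub: "subspace A" and predual: "predual_iso A Phi"
begin

text \<open>Elements of \<open>A\<close> as functions on the predual, so that weak* questions become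
  questions about the product topology.\<close>

definition ev :: "'a \<Rightarrow> 'e \<Rightarrow> real" where "ev a = blinfun_apply (Phi a)"

lemma ev_add: "a \<in> A \<Longrightarrow> b \<in> A \<Longrightarrow> ev (a + b) e = ev a e + ev b e"
  and ev_scaleR: "a \<in> A \<Longrightarrow> ev (r *\<^sub>R a) e = r * ev a e"
  and Phi_norm: "a \<in> A \<Longrightarrow> norm (Phi a) = norm a"
  and Phi_bij: "bij_betw Phi A UNIV"
  using predual by (auto simp: predual_iso_def ev_def plus_blinfun.rep_eq scaleR_blinfun.rep_eq)

lemma ev_diff: "a \<in> A \<Longrightarrow> b \<in> A \<Longrightarrow> ev (a - b) e = ev a e - ev b e"
  using ev_add[of a "- b" e] ev_scaleR[of b "-1" e] by (simp add: subspace_neg A_sub)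

lemma ev_le: "a \<in> A \<Longrightarrow> \<bar>ev a e\<bar> \<le> norm a * norm e"
  using norm_blinfun[of "Phi a" e] by (simp add: ev_def Phi_norm)

lemma ev_inj: "a \<in> A \<Longrightarrow> b \<in> A \<Longrightarrow> (\<And>e. ev a e = ev b e) \<Longrightarrow> a = b"
  using Phi_bij by (auto simp: ev_def bij_betw_def inj_on_def blinfun_eqI)

lemma ev_nonzero:
  assumes "a \<in> A" "a \<noteq> 0"
  obtains e where "ev a e \<noteq> 0"
proof -
  have "ev 0 e = 0" for e using ev_scaleR[of 0 0 e] subspace_0[OF A_sub] by simp
  then show thesis using ev_inj[of a 0] assms subspace_0[OF A_sub] that by metis
qed

lemma ev_norming:
  obtains a where "a \<in> A" "norm a \<le> 1" "ev a d = norm d"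
proof -
  obtain \<phi> :: "'e \<Rightarrow>\<^sub>L real" where \<phi>: "norm \<phi> \<le> 1" "blinfun_apply \<phi> d = norm d"
    by (rule norming_functional)
  have "\<phi> \<in> Phi ` A" using Phi_bij by (simp add: bij_betw_def)
  then obtain a where "a \<in> A" "Phi a = \<phi>" by blast
  then show thesis using \<phi> Phi_norm that by (auto simp: ev_def)
qed

definition unit_ball :: "'a set" where "unit_ball = {a \<in> A. norm a \<le> 1}"

text \<open>The conditions on the right are closed under pointwise limits; that every such function
  comes from \<open>A\<close> is the surjectivity of \<open>Phi\<close>.\<close>

lemma ev_unit_ball:
  "ev ` unit_ball = {f. (\<forall>x y. f (x + y) = f x + f y) \<and> (\<forall>r x. f (r *\<^sub>R x) = r * f x) \<and> (\<forall>x. \<bar>f x\<bar> \<le> norm x)}"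
  (is "?l = ?r")
proof
  show "?l \<subseteq> ?r"
    using ev_le by (auto simp: ev_def unit_ball_def blinfun.add_right blinfun.scaleR_right)
      (metis mult_left_le_one_le mult.commute norm_ge_zero order_trans abs_ge_zero)
  show "?r \<subseteq> ?l"
  proof
    fix f assume f: "f \<in> ?r"
    have lin: "bounded_linear f"
      using f by (intro bounded_linear_intro[of _ 1]) auto
    obtain a where a: "a \<in> A" "Phi a = Blinfun f" using Phi_bij by (metis UNIV_I bij_betw_iff_bijections)
    have "norm (Blinfun f) \<le> 1"
      using f lin by (intro norm_blinfun_bound) (simp_all add: bounded_linear_Blinfun_apply)
    then have "a \<in> unit_ball" using a Phi_norm[of a] by (simp add: unit_ball_def)
    moreover have "ev a = f" using a lin by (simp add: ev_def bounded_linear_Blinfun_apply)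
    ultimately show "f \<in> ?l" by blast
  qed
qed

lemma continuous_coordinate [continuous_intros]: "continuous_on S (\<lambda>f :: 'e \<Rightarrow> real. f e)"
  by (rule continuous_on_subset[OF continuous_on_product_coordinates]) simp

lemma closed_unit_ball: "closed (ev ` unit_ball)"
  unfolding ev_unit_ball
  by (intro closed_Collect_conj closed_Collect_all closed_Collect_eq closed_Collect_le continuous_intros)

text \<open>The Banach-Alaoglu theorem: a closed subset of a product of compact intervals.\<close>

lemma compact_unit_ball: "compact (ev ` unit_ball)"
proof -
  have "compact (PiE UNIV (\<lambda>e::'e. {- norm e..norm e}))"
    using compactin_PiE[of "\<lambda>_::'e. euclidean :: real topology" UNIV "\<lambda>e. {- norm e..norm e}"]
    by (simp add: euclidean_product_topology)
  then have "compact (PiE UNIV (\<lambda>e::'e. {- norm e..norm e}) \<inter> ev ` unit_ball)"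
    using closed_unit_ball by (rule compact_Int_closed)
  moreover have "ev ` unit_ball \<subseteq> PiE UNIV (\<lambda>e. {- norm e..norm e})"
    unfolding ev_unit_ball by (auto simp: PiE_def abs_le_iff minus_le_iff)
  ultimately show ?thesis by (simp add: Int_absorb2 Int_commute)
qed

abbreviation "wstar \<equiv> wstar_topology A Phi"

lemma topspace_wstar: "topspace wstar = A"
  by (auto simp: wstar_topology_def intro!: exI[of _ "UNIV :: real set"])

lemma openin_wstar:
  assumes "openin wstar U"
  obtains W where "open W" "U = {a \<in> A. ev a \<in> W}"
proof -
  have "generate_topology_on {{x \<in> A. blinfun_apply (Phi x) e \<in> U} | e U. open U} U"
    using assms by (simp add: wstar_topology_def openin_topology_generated_by_iff)
  then have "\<exists>W. open W \<and> U = {a \<in> A. ev a \<in> W}"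
  proof induction
    case Empty
    show ?case by (intro exI[of _ "{}"]) auto
  next
    case (Int a b)
    then obtain V W where "open V" "open W" "a = {x \<in> A. ev x \<in> V}" "b = {x \<in> A. ev x \<in> W}" by blast
    then show ?case by (intro exI[of _ "V \<inter> W"]) auto
  next
    case (UN \<K>)
    then obtain W where "\<And>k. k \<in> \<K> \<Longrightarrow> open (W k) \<and> k = {x \<in> A. ev x \<in> W k}" by metis
    then show ?case by (intro exI[of _ "\<Union>(W ` \<K>)"]) blast
  next
    case (Basis s)
    then obtain e V where "open V" "s = {x \<in> A. blinfun_apply (Phi x) e \<in> V}" by blast
    moreover from this have "open ((\<lambda>f. f e) -` V)"
      by (intro open_vimage continuous_coordinate)
    ultimately show ?case by (intro exI[of _ "(\<lambda>f. f e) -` V"]) (auto simp: ev_def)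
  qed
  then show thesis using that by blast
qed

text \<open>The unit ball of \<open>I\<close> becomes a compact set of functions, and an extreme one
  \<open>ev u\<close> is the midpoint of those of \<open>u + v\<close> and
  \<open>u - v\<close>.\<close>

lemma extreme_point_exists:
  assumes I: "subspace I" "closedin wstar I"
  obtains u where "u \<in> I" "norm u \<le> 1"
    "\<And>v. v \<in> I \<Longrightarrow> norm (u + v) \<le> 1 \<Longrightarrow> norm (u - v) \<le> 1 \<Longrightarrow> v = 0"
proof -
  have IA: "I \<subseteq> A" using closedin_subset[OF I(2)] by (simp add: topspace_wstar)
  have "openin wstar (A - I)" using I(2) by (simp add: closedin_def topspace_wstar)
  then obtain W where W: "open W" "A - I = {a \<in> A. ev a \<in> W}" by (rule openin_wstar)
  define B where "B = ev ` unit_ball \<inter> - W"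
  have B: "compact B" "closed B"
    unfolding B_def using W compact_unit_ball closed_unit_ball by (auto intro: compact_Int_closed)
  have B_eq: "B = ev ` {a \<in> I. norm a \<le> 1}"
    using W(2) IA by (auto simp: B_def unit_ball_def)
  have "0 \<in> I" using I by (simp add: subspace_0)
  then have "B \<noteq> {}" unfolding B_eq by auto
  then obtain f where f: "f \<in> B" and extr: "\<And>g h. g \<in> B \<Longrightarrow> h \<in> B \<Longrightarrow> f = (\<lambda>e. (g e + h e) / 2) \<Longrightarrow> g = f"
    using compact_extreme_point[OF B] by blast
  obtain u where u: "u \<in> I" "norm u \<le> 1" "f = ev u" using f unfolding B_eq by blast
  show thesis
  proof
    fix v assume v: "v \<in> I" "norm (u + v) \<le> 1" "norm (u - v) \<le> 1"
    have uv: "u + v \<in> I" "u - v \<in> I" using u v I by (auto simp: subspace_add subspace_diff)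
    have "ev (u + v) = f"
    proof (rule extr)
      show "ev (u + v) \<in> B" "ev (u - v) \<in> B" unfolding B_eq using uv v by auto
      show "f = (\<lambda>e. (ev (u + v) e + ev (u - v) e) / 2)"
        using u v IA by (auto simp: ev_add ev_diff subset_iff)
    qed
    then have "u + v = u"
      using uv u IA by (intro ev_inj) auto
    then show "v = 0" by simp
  qed (use u in auto)
qed

text \<open>A norm bound for a translate is a conjunction of inequalities at single points of the
  predual, hence a closed condition.\<close>

lemma compact_translates: "compact (ev ` {x \<in> unit_ball. \<forall>y\<in>Y. norm (x + y) \<le> 1})" if "Y \<subseteq> A"
proof -
  have "ev ` {x \<in> unit_ball. \<forall>y\<in>Y. norm (x + y) \<le> 1}
      = ev ` unit_ball \<inter> {f. \<forall>y\<in>Y. \<forall>e. \<bar>f e + ev y e\<bar> \<le> norm e}"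
  proof -
    have eq: "norm (x + y) \<le> 1 \<longleftrightarrow> (\<forall>e. \<bar>ev x e + ev y e\<bar> \<le> norm e)" if "x \<in> A" "y \<in> A" for x y
    proof
      assume le: "norm (x + y) \<le> 1"
      show "\<forall>e. \<bar>ev x e + ev y e\<bar> \<le> norm e"
      proof
        fix e
        have "\<bar>ev (x + y) e\<bar> \<le> norm (x + y) * norm e"
          using that by (intro ev_le subspace_add A_sub)
        also have "\<dots> \<le> norm e"
          using mult_right_mono[OF le, of "norm e"] by simp
        finally show "\<bar>ev x e + ev y e\<bar> \<le> norm e" using that by (simp add: ev_add)
      qed
    next
      assume "\<forall>e. \<bar>ev x e + ev y e\<bar> \<le> norm e"
      then have "norm (Phi (x + y)) \<le> 1"
        using that by (intro norm_blinfun_bound) (auto simp flip: ev_add ev_def)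
      then show "norm (x + y) \<le> 1" using that by (simp add: Phi_norm subspace_add A_sub)
    qed
    have "(\<forall>y\<in>Y. norm (x + y) \<le> 1) \<longleftrightarrow> ev x \<in> {f. \<forall>y\<in>Y. \<forall>e. \<bar>f e + ev y e\<bar> \<le> norm e}"
      if "x \<in> unit_ball" for x
      using eq[of x] that \<open>Y \<subseteq> A\<close> by (auto simp: unit_ball_def)
    then show ?thesis by blast
  qed
  moreover have "closed {f. \<forall>y\<in>Y. \<forall>e. \<bar>f e + ev y e\<bar> \<le> norm e}"
  proof -
    have "{f. \<forall>y\<in>Y. \<forall>e. \<bar>f e + ev y e\<bar> \<le> norm e} = (\<Inter>y\<in>Y. {f. \<forall>e. \<bar>f e + ev y e\<bar> \<le> norm e})"
      by blast
    then show ?thesis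
      by (auto intro!: closed_INT closed_Collect_all closed_Collect_le continuous_intros)
  qed
  ultimately show ?thesis by (simp add: compact_Int_closed compact_unit_ball)
qed

end

section \<open>Weak* closedness of the range of an M-projection\<close>

locale dual_M_proj = dual_space A Phi + M_proj A P
  for A :: "'a::real_normed_vector set" and Phi :: "'a \<Rightarrow> ('e::banach \<Rightarrow>\<^sub>L real)" and P
begin

definition Q :: "'a \<Rightarrow> 'a" where "Q x = x - P x"

lemma Q_in: "x \<in> A \<Longrightarrow> Q x \<in> A"
  and Q_add: "x \<in> A \<Longrightarrow> y \<in> A \<Longrightarrow> Q (x + y) = Q x + Q y"
  and Q_scaleR: "x \<in> A \<Longrightarrow> Q (r *\<^sub>R x) = r *\<^sub>R Q x"
  and PQ: "x \<in> A \<Longrightarrow> P (Q x) = 0"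
  and QP: "x \<in> A \<Longrightarrow> Q (P x) = 0"
  by (simp_all add: Q_def A_diff P_in P_add P_scaleR P_diff P_idem scaleR_diff_right)

lemma compact_range: "compact (ev ` {x \<in> unit_ball. P x = x})"
proof -
  have "{x \<in> unit_ball. P x = x} = {x \<in> unit_ball. \<forall>y\<in>{y \<in> A. P y = 0 \<and> norm y \<le> 1}. norm (x + y) \<le> 1}"
    using unit_range_iff by (auto simp: unit_ball_def)
  then show ?thesis using compact_translates[of "{y \<in> A. P y = 0 \<and> norm y \<le> 1}"] by auto
qed

lemma compact_kernel: "compact (ev ` {x \<in> unit_ball. P x = 0})"
proof -
  interpret c: dual_M_proj A Phi "\<lambda>x. x - P x"
    using compl dual_space_axioms by (simp add: dual_M_proj_def)
  show ?thesis using c.compact_range by simp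
qed

text \<open>The functional \<open>e (Q x)\<close> is weak*-continuous on the unit ball, since the unit balls of the
  range and of the kernel of \<open>P\<close> are weak*-compact. Hence it is a limit of elements of the predual,
  and belongs to the predual.\<close>

lemma ev_Q_small_on_kernel:
  assumes \<epsilon>: "\<epsilon> > 0"
  shows "\<exists>F. finite F \<and> (\<forall>a\<in>A. (\<forall>f\<in>F. ev a f = 0) \<longrightarrow> ev (Q a) e \<le> \<epsilon> * norm a)"
proof -
  define BM BN where "BM = {x \<in> unit_ball. P x = x}" and "BN = {x \<in> unit_ball. P x = 0}"
  have BM: "compact (ev ` BM)" and BN: "compact (ev ` BN)"
    unfolding BM_def BN_def by (rule compact_range, rule compact_kernel)
  have ball: "P x \<in> BM" "Q x \<in> BN" if "x \<in> unit_ball" for x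
    using that norm_P_le[of x] norm_compl_le[of x]
    by (auto simp: BM_def BN_def unit_ball_def P_in P_idem Q_in PQ) (simp add: Q_def)
  \<comment> \<open>A pair in \<open>Z\<close> at which all evaluations of the sum vanish would
    satisfy m + n = 0 with \<open>n\<close> nonzero at \<open>e\<close>. Range and kernel meet only
    in 0, so the open sets \<open>U f\<close> cover \<open>Z\<close>, and finitely many of them
    suffice.\<close>
  define Z where "Z = ev ` BM \<times> (ev ` BN \<inter> {g. \<epsilon> \<le> g e})"
  have "closed {g :: 'e \<Rightarrow> real. \<epsilon> \<le> g e}" by (intro closed_Collect_le continuous_intros)
  then have Z: "compact Z" unfolding Z_def by (intro compact_Times BM compact_Int_closed BN)
  define U where "U f = {(g, h). g f + h f \<noteq> (0::real)}" for f :: 'e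
  have U_open: "open (U f)" for f
  proof -
    have "continuous_on UNIV (\<lambda>z :: ('e \<Rightarrow> real) \<times> ('e \<Rightarrow> real). fst z f + snd z f)"
      by (intro continuous_on_add continuous_on_compose2[OF continuous_coordinate[of UNIV f]]
          continuous_on_fst continuous_on_snd continuous_on_id) auto
    then have "open ((\<lambda>z. fst z f + snd z f) -` (- {0::real}))"
      by (intro open_vimage) auto
    moreover have "U f = (\<lambda>z. fst z f + snd z f) -` (- {0})" by (auto simp: U_def)
    ultimately show ?thesis by simp
  qed
  have cover: "Z \<subseteq> (\<Union>f\<in>UNIV. U f)"
  proof
    fix z assume "z \<in> Z"
    then obtain m n where mn: "z = (ev m, ev n)" "m \<in> BM" "n \<in> BN" "\<epsilon> \<le> ev n e" by (auto simp: Z_def)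
    then have mnA: "m \<in> A" "n \<in> A" "P m = m" "P n = 0" by (auto simp: BM_def BN_def unit_ball_def)
    have "m + n \<noteq> 0"
    proof
      assume "m + n = 0"
      then have "P (m + n) = 0" by (simp add: P_0)
      then have "m = 0" using mnA by (simp add: P_add)
      then have "n = 0" using \<open>m + n = 0\<close> by simp
      moreover have "ev 0 e = 0" using ev_scaleR[of 0 0 e] subspace_0[OF A_sub] by simp
      ultimately show False using mn \<epsilon> by simp
    qed
    then obtain f where "ev (m + n) f \<noteq> 0" using ev_nonzero mnA by (metis subspace_add A_sub)
    then have "z \<in> U f" using mn(1) mnA(1,2) by (simp add: U_def ev_add)
    then show "z \<in> (\<Union>f\<in>UNIV. U f)" by blast
  qed
  obtain F where F: "finite F" "Z \<subseteq> (\<Union>f\<in>F. U f)"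
    by (rule compactE_image[OF Z U_open cover])
  have "ev (Q a) e \<le> \<epsilon> * norm a" if a: "a \<in> A" and a0: "\<forall>f\<in>F. ev a f = 0" for a
  proof (rule ccontr)
    assume not_le: "\<not> ev (Q a) e \<le> \<epsilon> * norm a"
    have "a \<noteq> 0"
    proof
      assume "a = 0"
      moreover have "ev 0 e = 0" using ev_scaleR[of 0 0 e] subspace_0[OF A_sub] by simp
      ultimately show False using not_le by (simp add: Q_def P_0)
    qed
    define b where "b = (1 / norm a) *\<^sub>R a"
    have b: "b \<in> unit_ball" using a \<open>a \<noteq> 0\<close> by (simp add: b_def unit_ball_def subspace_scale A_sub)
    have "ev (Q b) e = (1 / norm a) * ev (Q a) e"
      using a Q_in by (simp add: b_def Q_scaleR ev_scaleR)
    moreover have "\<epsilon> < ev (Q a) e / norm a"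
      using not_le \<open>a \<noteq> 0\<close> by (simp add: pos_less_divide_eq)
    ultimately have "\<epsilon> \<le> ev (Q b) e" by simp
    then have "(ev (P b), ev (Q b)) \<in> Z" using ball[OF b] by (auto simp: Z_def)
    then obtain f where f: "f \<in> F" "ev (P b) f + ev (Q b) f \<noteq> 0" using F(2) by (auto simp: U_def)
    have bA: "b \<in> A" using b by (simp add: unit_ball_def)
    have "ev (P b) f + ev (Q b) f = ev (P b + Q b) f" using bA P_in Q_in by (simp add: ev_add)
    also have "P b + Q b = b" by (simp add: Q_def)
    also have "ev b f = (1 / norm a) * ev a f" using a by (simp add: b_def ev_scaleR)
    finally show False using f a0 by simp
  qed
  then show ?thesis using F by blast
qed

lemma ev_Q_near_predual:
  assumes \<epsilon>: "\<epsilon> > 0"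
  shows "\<exists>d. \<forall>a\<in>A. ev (Q a) e - ev a d \<le> \<epsilon> * norm a"
proof -
  obtain F where F: "finite F" "\<And>a. a \<in> A \<Longrightarrow> (\<And>f. f \<in> F \<Longrightarrow> ev a f = 0) \<Longrightarrow> ev (Q a) e \<le> \<epsilon> * norm a"
    using ev_Q_small_on_kernel[OF \<epsilon>, of e] by blast
  have "\<exists>c. \<forall>x\<in>A. ev (Q x) e - (\<Sum>f\<in>F. c f * ev x f) \<le> \<epsilon> * norm x"
  proof (rule finite_separation[OF F(1) A_sub])
    show "\<epsilon> * norm (x + y) \<le> \<epsilon> * norm x + \<epsilon> * norm y" for x y :: 'a
      using \<epsilon> norm_triangle_ineq[of x y] by (simp flip: distrib_left)
  qed (use F(2) \<epsilon> Q_in in \<open>auto simp: Q_add Q_scaleR ev_add ev_scaleR\<close>)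
  then obtain c where c: "\<And>x. x \<in> A \<Longrightarrow> ev (Q x) e - (\<Sum>f\<in>F. c f * ev x f) \<le> \<epsilon> * norm x" by blast
  have "(\<Sum>f\<in>F. c f * ev x f) = ev x (\<Sum>f\<in>F. c f *\<^sub>R f)" for x
    by (simp add: ev_def blinfun.sum_right blinfun.scaleR_right)
  then show ?thesis using c by auto
qed

text \<open>The approximants \<open>D k\<close> form a Cauchy sequence, because a norming element of
  the unit ball measures the distance of two of them. Completeness of the predual supplies the
  limit.\<close>

lemma ev_Q_in_predual: "\<exists>d. \<forall>a\<in>A. ev (Q a) e = ev a d"
proof -
  obtain D where D: "\<And>k a. a \<in> A \<Longrightarrow> ev (Q a) e - ev a (D k) \<le> (1/2) ^ k * norm a"
    using ev_Q_near_predual[of "(1/2) ^ k" e for k] by (metis zero_less_divide_1_iff zero_less_numeral zero_less_power)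
  have D_abs: "\<bar>ev (Q a) e - ev a (D k)\<bar> \<le> (1/2) ^ k * norm a" if a: "a \<in> A" for k a
  proof -
    have "ev (Q (- a)) e = - ev (Q a) e" "ev (- a) (D k) = - ev a (D k)"
      using Q_scaleR[OF a, of "-1"] ev_scaleR[OF Q_in[OF a], of "-1" e] ev_scaleR[OF a, of "-1"] by simp_all
    then show ?thesis using D[OF a, of k] D[of "- a" k] a by (simp add: subspace_neg A_sub)
  qed
  have dist_D: "dist (D k) (D l) \<le> (1/2) ^ k + (1/2) ^ l" for k l
  proof -
    obtain a where a: "a \<in> A" "norm a \<le> 1" "ev a (D k - D l) = norm (D k - D l)" by (rule ev_norming)
    have "norm (D k - D l) = (ev (Q a) e - ev a (D l)) - (ev (Q a) e - ev a (D k))"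
      unfolding a(3)[symmetric] by (simp add: ev_def blinfun.diff_right)
    also have "\<dots> \<le> (1/2) ^ l * norm a + (1/2) ^ k * norm a"
      using D_abs[OF a(1), of k] D_abs[OF a(1), of l] by linarith
    also have "\<dots> \<le> (1/2) ^ l * 1 + (1/2) ^ k * 1"
      using a(2) by (intro add_mono mult_left_mono) auto
    finally show ?thesis by (simp add: dist_norm)
  qed
  have "Cauchy D"
  proof (rule metric_CauchyI)
    fix \<epsilon> :: real assume "\<epsilon> > 0"
    then obtain N where N: "(1/2) ^ N < \<epsilon> / 2"
      using real_arch_pow_inv[of "\<epsilon> / 2" "1/2"] by auto
    have "dist (D m) (D n) < \<epsilon>" if "m \<ge> N" "n \<ge> N" for m n
      using dist_D[of m n] power_decreasing[OF that(1), of "1/2::real"] power_decreasing[OF that(2), of "1/2::real"] N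
      by linarith
    then show "\<exists>N. \<forall>m\<ge>N. \<forall>n\<ge>N. dist (D m) (D n) < \<epsilon>" by blast
  qed
  then obtain d where d: "D \<longlonglongrightarrow> d" by (meson Cauchy_convergent convergent_def)
  have "ev (Q a) e = ev a d" if a: "a \<in> A" for a
  proof -
    have "(\<lambda>k. ev a (D k)) \<longlonglongrightarrow> ev a d"
      unfolding ev_def by (intro tendsto_intros d)
    moreover have "(\<lambda>k. ev a (D k)) \<longlonglongrightarrow> ev (Q a) e"
    proof (rule LIMSEQ_I)
      fix \<epsilon> :: real assume \<epsilon>: "\<epsilon> > 0"
      then obtain N where N: "(1/2) ^ N < \<epsilon> / (norm a + 1)"
        using real_arch_pow_inv[of "\<epsilon> / (norm a + 1)" "1/2"] by (auto simp: add_nonneg_pos)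
      have "norm (ev a (D k) - ev (Q a) e) < \<epsilon>" if "k \<ge> N" for k
      proof -
        have "norm (ev a (D k) - ev (Q a) e) \<le> (1/2) ^ k * norm a"
          using D_abs[OF a, of k] by (simp add: abs_minus_commute)
        also have "\<dots> \<le> (1/2) ^ N * (norm a + 1)"
          using power_decreasing[OF that, of "1/2::real"] by (intro mult_mono) auto
        also have "\<dots> < \<epsilon>" using N by (simp add: pos_less_divide_eq add_nonneg_pos)
        finally show ?thesis .
      qed
      then show "\<exists>no. \<forall>n\<ge>no. norm (ev a (D n) - ev (Q a) e) < \<epsilon>" by blast
    qed
    ultimately show ?thesis using LIMSEQ_unique by blast
  qed
  then show ?thesis by blast
qed

text \<open>The range is the common zero set of the functionals \<open>ev (Q a) e\<close>, and each
  of these is the evaluation at a point of the predual.\<close>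

lemma closedin_wstar_range: "closedin wstar (P ` A)"
proof -
  have "openin wstar (A - P ` A)"
  proof (subst openin_subopen, intro ballI)
    fix x assume x: "x \<in> A - P ` A"
    then have "Q x \<noteq> 0" unfolding Q_def by (metis DiffD1 DiffD2 eq_iff_diff_eq_0 imageI)
    then obtain e where e: "ev (Q x) e \<noteq> 0" using ev_nonzero[OF Q_in] x by blast
    obtain d where d: "\<And>a. a \<in> A \<Longrightarrow> ev (Q a) e = ev a d" using ev_Q_in_predual[of e] by blast
    define T where "T = {a \<in> A. blinfun_apply (Phi a) d \<in> - {0}}"
    have "open (- {0::real})" by (rule open_Compl[OF closed_singleton])
    then have "T \<in> {{x \<in> A. blinfun_apply (Phi x) e \<in> U} |e U. open U}"
      unfolding T_def by blast
    then have "openin wstar T"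
      unfolding wstar_topology_def by (rule topology_generated_by_Basis)
    moreover have "x \<in> T" using x e d[of x] unfolding T_def by (simp add: ev_def)
    moreover have "T \<subseteq> A - P ` A"
    proof
      fix a assume a: "a \<in> T"
      then have aA: "a \<in> A" "ev a d \<noteq> 0" by (simp_all add: T_def ev_def)
      have "a \<notin> P ` A"
      proof
        assume "a \<in> P ` A"
        then have "Q a = 0" using QP by auto
        moreover have "ev 0 e = 0" using ev_scaleR[of 0 0 e] subspace_0[OF A_sub] by simp
        ultimately show False using aA d[OF aA(1)] by simp
      qed
      then show "a \<in> A - P ` A" using aA by simp
    qed
    ultimately show "\<exists>T. openin wstar T \<and> x \<in> T \<and> T \<subseteq> A - P ` A"
      by (intro exI[of _ T] conjI)
  qed
  moreover have "P ` A \<subseteq> A" using P_in by blast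
  ultimately show ?thesis by (simp add: closedin_def topspace_wstar)
qed

end

subsection \<open>Triple derivations\<close>

context jbstar
begin

definition triple_derivation :: "('a \<Rightarrow> 'a) \<Rightarrow> bool" where
  "triple_derivation D \<longleftrightarrow> bounded_linear D \<and>
     (\<forall>a b c. D (tr a b c) = tr (D a) b c + tr a (D b) c + tr a b (D c))"

text \<open>The second-order truncation \<open>V\<close> of exp (s D) preserves cubes up to third
  order in \<open>s\<close>. For its operator norm this gives B^3 \<le> B + \<eta>, hence B \<le> 1
  + \<eta>.\<close>

lemma derivation_second_order:
  assumes "triple_derivation D"
  obtains C where "C \<ge> 0"
    "\<And>s x. \<bar>s\<bar> \<le> 1 \<Longrightarrow> norm (x + s *\<^sub>R D x + (s\<^sup>2 / 2) *\<^sub>R D (D x)) \<le> (1 + C * \<bar>s\<bar> ^ 3) * norm x"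
proof -
  have D: "bounded_linear D"
    and der: "\<And>a b c. D (tr a b c) = tr (D a) b c + tr a (D b) c + tr a b (D c)"
    using assms by (auto simp: triple_derivation_def)
  interpret D: bounded_linear D by (rule D)
  obtain d where "d > 0" and d: "\<And>x. norm (D x) \<le> norm x * d" using D.pos_bounded by blast
  define e where "e = (1 + d)\<^sup>2"
  have e: "1 \<le> e" "d \<le> e" "d * d \<le> e"
    using \<open>d > 0\<close> by (simp_all add: e_def power2_eq_square algebra_simps)
  have e1: "norm (D x) \<le> e * norm x" for x
    using d[of x] mult_right_mono[OF e(2) norm_ge_zero[of x]] by (simp add: mult.commute)
  have e2: "norm (D (D x)) \<le> e * norm x" for x
  proof -
    have "norm (D (D x)) \<le> (norm x * d) * d"
      using d[of "D x"] mult_right_mono[OF d[of x], of d] \<open>d > 0\<close> by linarith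
    then show ?thesis using mult_right_mono[OF e(3) norm_ge_zero[of x]] by (simp add: mult_ac)
  qed
  \<comment> \<open>51 = 24 + 3 * 6 + 3 * 3 adds up the leftover terms below: the cube of
    \<open>w\<close>, three products with \<open>x2\<close> and \<open>w\<close>, three with
    \<open>x1\<close> and \<open>x2\<close>.\<close>
  define \<eta> where "\<eta> s = 51 * e ^ 3 * \<bar>s\<bar> ^ 3" for s :: real
  have \<eta>: "\<eta> s \<ge> 0" for s using e by (simp add: \<eta>_def)
  have "norm (x + s *\<^sub>R D x + (s\<^sup>2 / 2) *\<^sub>R D (D x)) \<le> (1 + \<eta> s) * norm x" if s: "\<bar>s\<bar> \<le> 1" for s x
  proof -
    define V where "V x = x + s *\<^sub>R D x + (s\<^sup>2 / 2) *\<^sub>R D (D x)" for x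
    have V: "bounded_linear V"
      unfolding V_def
      by (intro bounded_linear_add bounded_linear_ident bounded_linear_const_scaleR D
          bounded_linear_compose[OF D D])
    have step: "norm (V x) ^ 3 \<le> norm (V (cube x)) + \<eta> s * norm x ^ 3" for x
    proof -
      define x1 x2 where "x1 = s *\<^sub>R D x" and "x2 = (s\<^sup>2 / 2) *\<^sub>R D (D x)"
      define w where "w = x1 + x2"
      let ?\<sigma> = "\<bar>s\<bar>" and ?n = "norm x"
      have V_eq: "V x = x + w" by (simp add: V_def x1_def x2_def w_def)
      have D1: "s *\<^sub>R D (cube x) = tr x1 x x + tr x x1 x + tr x x x1"
        by (simp add: der x1_def tr_scaleR scaleR_add_right)
      have "(s\<^sup>2 / 2) *\<^sub>R D (D (cube x)) = (s\<^sup>2 / 2) *\<^sub>R (tr (D (D x)) x x + tr x (D (D x)) x + tr x x (D (D x))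
          + 2 *\<^sub>R (tr (D x) (D x) x + tr (D x) x (D x) + tr x (D x) (D x)))"
        by (simp add: der D.add scaleR_2 algebra_simps)
      also have "\<dots> = tr x2 x x + tr x x2 x + tr x x x2 + tr x1 x1 x + tr x1 x x1 + tr x x1 x1"
        by (simp add: x1_def x2_def tr_scaleR scaleR_add_right power2_eq_square)
      finally have D2: "(s\<^sup>2 / 2) *\<^sub>R D (D (cube x)) =
          tr x2 x x + tr x x2 x + tr x x x2 + tr x1 x1 x + tr x1 x x1 + tr x x1 x1" .
      \<comment> \<open>The Leibniz rule matches all terms of order at most 2; each remaining
        product carries at least three factors \<open>s\<close>.\<close>
      have "cube (V x) = V (cube x) + (cube w + (tr x2 w x + tr x1 x2 x) + (tr x2 x w + tr x1 x x2)
          + (tr x x2 w + tr x x1 x2))"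
        unfolding V_eq V_def[of "cube x"] D1 D2 unfolding w_def by (simp add: tr_add algebra_simps)
      then have "norm (cube (V x)) \<le> norm (V (cube x)) + norm (cube w + (tr x2 w x + tr x1 x2 x)
          + (tr x2 x w + tr x1 x x2) + (tr x x2 w + tr x x1 x2))"
        by (metis norm_triangle_ineq)
      also have "norm (cube w + (tr x2 w x + tr x1 x2 x) + (tr x2 x w + tr x1 x x2) + (tr x x2 w + tr x x1 x2))
        \<le> norm (cube w) + (norm (tr x2 w x) + norm (tr x1 x2 x)) + (norm (tr x2 x w) + norm (tr x1 x x2))
          + (norm (tr x x2 w) + norm (tr x x1 x2))"
        by (intro order_trans[OF norm_triangle_ineq] add_mono norm_triangle_ineq order_refl)
      also have "\<dots> \<le> \<eta> s * ?n ^ 3"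
      proof -
        have x1: "norm x1 \<le> e * ?\<sigma> * ?n"
          using mult_left_mono[OF e1[of x], of ?\<sigma>] by (simp add: x1_def mult_ac)
        have x2: "norm x2 \<le> e * ?\<sigma>\<^sup>2 * ?n"
        proof -
          have "s\<^sup>2 * norm (D (D x)) \<le> s\<^sup>2 * (e * ?n)" by (intro mult_left_mono e2) simp
          moreover have "norm x2 = s\<^sup>2 * norm (D (D x)) / 2" by (simp add: x2_def)
          ultimately have "norm x2 \<le> s\<^sup>2 * (e * ?n) / 2" by linarith
          moreover have "0 \<le> s\<^sup>2 * (e * ?n)" using e by simp
          ultimately show ?thesis by (simp add: mult_ac)
        qed
        have \<sigma>2: "?\<sigma>\<^sup>2 \<le> ?\<sigma>" using s mult_left_le[of "\<bar>s\<bar>" "\<bar>s\<bar>"] by (simp only: power2_eq_square abs_ge_zero)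
        have w: "norm w \<le> 2 * e * ?\<sigma> * ?n"
        proof -
          have "e * ?\<sigma>\<^sup>2 * ?n \<le> e * ?\<sigma> * ?n" using \<sigma>2 e by (intro mult_right_mono mult_left_mono) auto
          then show ?thesis using x1 x2 norm_triangle_ineq[of x1 x2] unfolding w_def by linarith
        qed
        have "norm (cube w) \<le> 3 * (2 * e * ?\<sigma> * ?n) * (2 * e * ?\<sigma> * ?n) * (2 * e * ?\<sigma> * ?n)"
          using w by (rule norm_tr_le[OF w w])
        also have "\<dots> = 24 * e ^ 3 * (?\<sigma> ^ 3 * ?n ^ 3)" by (simp add: power3_eq_cube)
        finally have 1: "norm (cube w) \<le> 24 * e ^ 3 * (?\<sigma> ^ 3 * ?n ^ 3)" .
        have x2w: "norm (tr p q r) \<le> 6 * e\<^sup>2 * (?\<sigma> ^ 3 * ?n ^ 3)"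
          if "(p, q, r) \<in> {(x2, w, x), (x2, x, w), (x, x2, w)}" for p q r
        proof -
          have "norm (tr x2 w x) \<le> 3 * (e * ?\<sigma>\<^sup>2 * ?n) * (2 * e * ?\<sigma> * ?n) * ?n"
            "norm (tr x2 x w) \<le> 3 * (e * ?\<sigma>\<^sup>2 * ?n) * ?n * (2 * e * ?\<sigma> * ?n)"
            "norm (tr x x2 w) \<le> 3 * ?n * (e * ?\<sigma>\<^sup>2 * ?n) * (2 * e * ?\<sigma> * ?n)"
            by (intro norm_tr_le x2 w order_refl)+
          then show ?thesis using that by (auto simp: power3_eq_cube power2_eq_square mult_ac)
        qed
        have x1x2: "norm (tr p q r) \<le> 3 * e\<^sup>2 * (?\<sigma> ^ 3 * ?n ^ 3)"
          if "(p, q, r) \<in> {(x1, x2, x), (x1, x, x2), (x, x1, x2)}" for p q r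
        proof -
          have "norm (tr x1 x2 x) \<le> 3 * (e * ?\<sigma> * ?n) * (e * ?\<sigma>\<^sup>2 * ?n) * ?n"
            "norm (tr x1 x x2) \<le> 3 * (e * ?\<sigma> * ?n) * ?n * (e * ?\<sigma>\<^sup>2 * ?n)"
            "norm (tr x x1 x2) \<le> 3 * ?n * (e * ?\<sigma> * ?n) * (e * ?\<sigma>\<^sup>2 * ?n)"
            by (intro norm_tr_le x1 x2 order_refl)+
          then show ?thesis using that by (auto simp: power3_eq_cube power2_eq_square mult_ac)
        qed
        have "e\<^sup>2 * (?\<sigma> ^ 3 * ?n ^ 3) \<le> e ^ 3 * (?\<sigma> ^ 3 * ?n ^ 3)"
          using e by (intro mult_right_mono power_increasing) auto
        then show ?thesis
          using 1 x2w[of x2 w x] x2w[of x2 x w] x2w[of x x2 w]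
            x1x2[of x1 x2 x] x1x2[of x1 x x2] x1x2[of x x1 x2]
          unfolding \<eta>_def by (simp add: mult.assoc)
      qed
      finally show ?thesis by (simp add: norm_cube)
    qed
    define B where "B = onorm V"
    have B0: "B \<ge> 0" unfolding B_def by (rule onorm_pos_le[OF V])
    have B: "norm (V x) \<le> B * norm x" for x unfolding B_def by (rule onorm[OF V])
    have "norm (V x) \<le> root 3 (B + \<eta> s) * norm x" for x
    proof -
      have "norm (V x) ^ 3 \<le> B * norm (cube x) + \<eta> s * norm x ^ 3"
        using step[of x] B[of "cube x"] by linarith
      also have "\<dots> = (root 3 (B + \<eta> s) * norm x) ^ 3"
        by (simp add: norm_cube power_mult_distrib odd_real_root_pow distrib_right)
      finally show ?thesis
        by (subst (asm) power_mono_iff) (use B0 \<eta> in auto)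
    qed
    then have "onorm V \<le> root 3 (B + \<eta> s)"
      using B0 \<eta>[of s] by (intro onorm_bound) auto
    then have "B \<le> root 3 (B + \<eta> s)" by (simp flip: B_def)
    then have "B ^ 3 \<le> root 3 (B + \<eta> s) ^ 3" using B0 by (intro power_mono)
    then have B3: "B ^ 3 \<le> B + \<eta> s" by (simp add: odd_real_root_pow)
    have "B \<le> 1 + \<eta> s"
    proof (rule ccontr)
      assume "\<not> B \<le> 1 + \<eta> s"
      then have "B - 1 > \<eta> s" "B > 1" using \<eta>[of s] by auto
      moreover have "(B - 1) * 1 \<le> (B - 1) * (B * (B + 1))"
        using \<open>B > 1\<close> by (intro mult_left_mono) (auto simp: algebra_simps intro: order_trans[of _ B])
      ultimately show False using B3 by (simp add: algebra_simps power3_eq_cube)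
    qed
    then have "B * norm x \<le> (1 + \<eta> s) * norm x" by (rule mult_right_mono) simp
    then show ?thesis using B[of x] by (simp add: V_def)
  qed
  then show thesis using e by (intro that[of "51 * e ^ 3"]) (auto simp: \<eta>_def)
qed

lemma derivation_skew:
  assumes "triple_derivation D"
  shows "skew S D"
proof -
  obtain C where "C \<ge> 0" and C: "\<And>s x. \<bar>s\<bar> \<le> 1 \<Longrightarrow>
      norm (x + s *\<^sub>R D x + (s\<^sup>2 / 2) *\<^sub>R D (D x)) \<le> (1 + C * \<bar>s\<bar> ^ 3) * norm x"
    using derivation_second_order[OF assms] by blast
  interpret D: bounded_linear D using assms by (simp add: triple_derivation_def)
  obtain d where "d > 0" and d: "\<And>x. norm (D x) \<le> norm x * d" using D.pos_bounded by blast
  have "skew UNIV D"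
  proof (rule skewI[of 1 "C + d * d"])
    fix s :: real and x :: 'a assume s: "\<bar>s\<bar> \<le> 1"
    have "\<bar>s\<bar> ^ 3 \<le> \<bar>s\<bar>\<^sup>2" using s by (intro power_decreasing) auto
    then have s3: "C * \<bar>s\<bar> ^ 3 \<le> C * s\<^sup>2" using \<open>C \<ge> 0\<close> by (simp add: mult_left_mono)
    have "norm (D (D x)) \<le> norm x * d * d"
      using d[of "D x"] mult_right_mono[OF d[of x], of d] \<open>d > 0\<close> by linarith
    then have D2: "s\<^sup>2 * norm (D (D x)) \<le> s\<^sup>2 * (norm x * d * d)" by (rule mult_left_mono) simp
    have "norm (x + s *\<^sub>R D x) \<le> norm (x + s *\<^sub>R D x + (s\<^sup>2 / 2) *\<^sub>R D (D x)) + norm ((s\<^sup>2 / 2) *\<^sub>R D (D x))"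
      using norm_triangle_ineq4[of "x + s *\<^sub>R D x + (s\<^sup>2 / 2) *\<^sub>R D (D x)" "(s\<^sup>2 / 2) *\<^sub>R D (D x)"] by simp
    also have "\<dots> \<le> (1 + C * \<bar>s\<bar> ^ 3) * norm x + s\<^sup>2 * norm (D (D x))"
    proof -
      have "0 \<le> s\<^sup>2 * norm (D (D x))" by simp
      moreover have "norm ((s\<^sup>2 / 2) *\<^sub>R D (D x)) = s\<^sup>2 * norm (D (D x)) / 2" by simp
      ultimately show ?thesis using C[OF s, of x] by linarith
    qed
    also have "\<dots> \<le> (1 + C * s\<^sup>2) * norm x + s\<^sup>2 * (norm x * d * d)"
      using s3 by (intro add_mono D2 mult_right_mono) auto
    finally show "norm (x + s *\<^sub>R D x) \<le> (1 + (C + d * d) * s\<^sup>2) * norm x"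
      by (simp add: algebra_simps)
  qed (use \<open>C \<ge> 0\<close> \<open>d > 0\<close> in auto)
  then show ?thesis by (rule skew_mono) simp
qed

lemma jp_tr: "a \<odot> tr x y z = tr (a \<odot> x) y z - tr x (invol a \<odot> y) z + tr x y (a \<odot> z)"
  unfolding tr_def by (subst jp_tri) (simp add: invol_jp)

lemma skew_derivation:
  assumes "invol b = - b"
  shows "triple_derivation ((\<odot>) b)"
  unfolding triple_derivation_def
  by (simp add: jp.bounded_linear_right jp_tr assms jp.minus_left tr_minus)

lemma sa_derivation:
  assumes "invol h = h"
  shows "triple_derivation (\<lambda>x. scaleC \<i> (h \<odot> x))"
proof -
  have "(\<odot>) (scaleC \<i> h) = (\<lambda>x. scaleC \<i> (h \<odot> x))" by (simp add: scaleC_left fun_eq_iff)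
  then show ?thesis
    using skew_derivation[of "scaleC \<i> h"] assms by (simp add: invol_scaleC scaleC_minus_left)
qed

lemma commutator_derivation:
  assumes "invol a = a" "invol b = b"
  shows "triple_derivation (\<lambda>x. a \<odot> (b \<odot> x) - b \<odot> (a \<odot> x))"
  unfolding triple_derivation_def
proof (intro conjI allI)
  show "bounded_linear (\<lambda>x. a \<odot> (b \<odot> x) - b \<odot> (a \<odot> x))"
    by (intro bounded_linear_sub bounded_linear_compose[OF jp.bounded_linear_right] jp.bounded_linear_right)
qed (simp add: jp_tr assms jp.add_right jp.diff_right tr_lin)

lemma sa_jp_skew: "invol h = h \<Longrightarrow> invol b = - b \<Longrightarrow> invol (h \<odot> b) = - (h \<odot> b)"
  by (simp add: invol_jp jp.minus_right)

lemma sa_square_zero: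
  assumes "invol h = h" "h \<odot> (h \<odot> y) = 0"
  shows "h \<odot> y = 0"
proof -
  have "scaleC \<i> (h \<odot> y) = 0"
  proof (rule skew_square_zero[of "\<lambda>x. scaleC \<i> (h \<odot> x)"])
    show "skew UNIV (\<lambda>x. scaleC \<i> (h \<odot> x))" using sa_derivation[OF assms(1)] by (rule derivation_skew)
    show "linear (\<lambda>x. scaleC \<i> (h \<odot> x))"
      using sa_derivation[OF assms(1)] by (simp add: triple_derivation_def bounded_linear.linear)
  qed (simp add: scaleC_right assms)
  then have "scaleC (- \<i>) (scaleC \<i> (h \<odot> y)) = 0" by simp
  then show ?thesis by (simp only: scaleC_scaleC) (simp add: scaleC_one)
qed

lemma skew_square_zero':
  assumes "invol b = - b" "b \<odot> (b \<odot> y) = 0"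
  shows "b \<odot> y = 0"
  using skew_square_zero[OF derivation_skew[OF skew_derivation[OF assms(1)]]
      bounded_linear.linear[OF jp.bounded_linear_right] assms(2)] .

text \<open>Averaging the truncations for \<open>s\<close> and \<open>- s\<close> removes the
  first-order term with its factor \<open>\<i>\<close>. What remains makes sense in a real
  subalgebra and has an error of third order only.\<close>

lemma sa_second_order:
  assumes "invol h = h"
  obtains C where "C \<ge> 0"
    "\<And>s x. \<bar>s\<bar> \<le> 1 \<Longrightarrow> norm (x - (s\<^sup>2 / 2) *\<^sub>R (h \<odot> (h \<odot> x))) \<le> (1 + C * \<bar>s\<bar> ^ 3) * norm x"
proof -
  let ?D = "\<lambda>x. scaleC \<i> (h \<odot> x)"
  obtain C where "C \<ge> 0" and C: "\<And>s x. \<bar>s\<bar> \<le> 1 \<Longrightarrow>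
      norm (x + s *\<^sub>R ?D x + (s\<^sup>2 / 2) *\<^sub>R ?D (?D x)) \<le> (1 + C * \<bar>s\<bar> ^ 3) * norm x"
    using derivation_second_order[OF sa_derivation[OF assms]] by blast
  have DD: "?D (?D x) = - (h \<odot> (h \<odot> x))" for x
    by (simp add: scaleC_right scaleC_scaleC scaleC_minus_left scaleC_one)
  have "norm (x - (s\<^sup>2 / 2) *\<^sub>R (h \<odot> (h \<odot> x))) \<le> (1 + C * \<bar>s\<bar> ^ 3) * norm x" if s: "\<bar>s\<bar> \<le> 1" for s x
  proof -
    let ?z = "x - (s\<^sup>2 / 2) *\<^sub>R (h \<odot> (h \<odot> x))"
    have "2 *\<^sub>R ?z = (?z + s *\<^sub>R ?D x) + (?z + (- s) *\<^sub>R ?D x)" by (simp add: scaleR_2)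
    then have "2 * norm ?z \<le> norm (?z + s *\<^sub>R ?D x) + norm (?z + (- s) *\<^sub>R ?D x)"
      by (metis norm_scaleR abs_numeral norm_triangle_ineq)
    moreover have "norm (?z + s *\<^sub>R ?D x) \<le> (1 + C * \<bar>s\<bar> ^ 3) * norm x"
      using C[OF s, of x] unfolding DD by (simp add: algebra_simps)
    moreover have "norm (?z + (- s) *\<^sub>R ?D x) \<le> (1 + C * \<bar>s\<bar> ^ 3) * norm x"
      using C[of "- s" x] s unfolding DD by (simp add: algebra_simps)
    ultimately show ?thesis by linarith
  qed
  then show thesis using \<open>C \<ge> 0\<close> that by blast
qed

subsection \<open>Powers of self-adjoint elements\<close>

text \<open>\<open>pw x k\<close> is the power with exponent \<open>k + 1\<close>, as there may be
  no unit; this causes the shifts by 1 and 2 in the product formulas.\<close>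

definition pw :: "'a \<Rightarrow> nat \<Rightarrow> 'a" where
  "pw x k = ((\<odot>) x ^^ k) x"

lemma pw_0: "pw x 0 = x"
  and pw_Suc: "pw x (Suc k) = x \<odot> pw x k"
  by (simp_all add: pw_def)

lemma jp_triple: "(x \<odot> (x \<odot> w)) \<odot> z = (w \<odot> z) \<odot> (x \<odot> x) + 2 *\<^sub>R ((x \<odot> w) \<odot> (x \<odot> z))
    - x \<odot> (x \<odot> (w \<odot> z)) - w \<odot> (x \<odot> (x \<odot> z))"
  using jordan_linear[of w z x x]
  by (simp add: comm scaleR_2 algebra_simps)

text \<open>Induction in steps of two: \<open>jp_triple\<close> expresses the multiplication by
  \<open>x \<odot> (x \<odot> w)\<close> through multiplications that already commute with the one
  by \<open>x\<close>.\<close>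

lemma pw_commute: "pw x n \<odot> (x \<odot> d) = x \<odot> (pw x n \<odot> d)"
proof (induction n arbitrary: d rule: less_induct)
  case (less n)
  consider "n = 0" | "n = 1" | k where "n = Suc (Suc k)"
    by (metis One_nat_def not0_implies_Suc)
  then show ?case
  proof cases
    case 1
    then show ?thesis by (simp add: pw_0)
  next
    case 2
    then show ?thesis using jordan[of x d] by (simp add: pw_0 pw_Suc comm)
  next
    case (3 k)
    define w where "w = pw x k"
    have n: "pw x n = x \<odot> (x \<odot> w)" by (simp add: 3 pw_Suc w_def)
    have w: "w \<odot> (x \<odot> z) = x \<odot> (w \<odot> z)" for z
      using less.IH[of k] 3 by (simp add: w_def)
    have xw: "(x \<odot> w) \<odot> (x \<odot> z) = x \<odot> ((x \<odot> w) \<odot> z)" for z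
      using less.IH[of "Suc k"] 3 by (simp add: w_def pw_Suc)
    show ?thesis
      unfolding n jp_triple[of x w "x \<odot> d"] jp_triple[of x w d] by (simp add: w xw jordan bil)
  qed
qed

lemma pw_mult: "pw x i \<odot> pw x j = pw x (i + j + 1)"
proof (induction j)
  case 0
  then show ?case by (simp add: pw_0 pw_Suc comm)
next
  case (Suc j)
  then show ?case by (simp add: pw_Suc pw_commute)
qed

lemma invol_pw: "invol x = x \<Longrightarrow> invol (pw x k) = pw x k"
  by (induction k) (simp_all add: pw_0 pw_Suc invol_jp)

lemma tr_pw: "invol x = x \<Longrightarrow> tr (pw x i) (pw x j) (pw x k) = pw x (i + j + k + 2)"
  by (simp add: tr_def jordan_triple_def invol_pw pw_mult add_ac)

lemma cube_sa: "invol x = x \<Longrightarrow> cube x = x \<odot> (x \<odot> x)"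
  by (simp add: tr_def jordan_triple_def comm)

lemma norm_cube_sa: "invol x = x \<Longrightarrow> norm (x \<odot> (x \<odot> x)) = norm x ^ 3"
  using norm_cube[of x] by (simp add: cube_sa)

lemma power_multiplier:
  assumes sa: "invol x = x" and le: "norm x \<le> 1"
  obtains C where "multiplier jp invol C ((\<odot>) x)" "x \<in> C" "\<And>w. w \<in> C \<Longrightarrow> (x \<odot> x) \<odot> w = x \<odot> (x \<odot> w)"
proof -
  define C where "C = span {scaleC c (pw x k) | c k. True}"
  have "centroid jp invol C ((\<odot>) x)"
    unfolding C_def by (rule centroid_span[where m = 2])
      (simp_all add: add_right scaleC_right pw_Suc tr_pw[OF sa])
  moreover have "norm (x \<odot> y) \<le> norm y" for y
    using jp_norm[of x y] mult_right_mono[OF le norm_ge_zero[of y]] by simp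
  ultimately have "multiplier jp invol C ((\<odot>) x)"
    by (simp add: multiplier_def multiplier_axioms_def)
  moreover have "x \<in> C"
    unfolding C_def by (rule span_base, rule CollectI, rule exI[of _ 1], rule exI[of _ 0]) (simp add: scaleC_one pw_0)
  moreover have "(x \<odot> x) \<odot> w = x \<odot> (x \<odot> w)" if "w \<in> C" for w
    using that unfolding C_def
  proof (induction rule: span_induct_alt)
    case (step r v y)
    then obtain c k where v: "v = scaleC c (pw x k)" by blast
    have "(x \<odot> x) \<odot> pw x k = x \<odot> (x \<odot> pw x k)"
      using pw_mult[of x 1 k] by (simp add: pw_0 pw_Suc)
    then have "(x \<odot> x) \<odot> v = x \<odot> (x \<odot> v)" by (simp add: v scaleC_right)
    then show ?case using step by (simp only: jp.add_right jp.scaleR_right)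
  qed (simp only: jp.zero_right)
  ultimately show thesis by (rule that)
qed

text \<open>The first and third bounds transfer scalar inequalities on [-1, 1]: the cube of q(x) is
  q^2 Z applied to q(x), so an operator bound for q^2 Z bounds the squared norm of q(x). The second
  is convexity.\<close>

lemma sa_cubic_bounds:
  assumes sa: "invol x = x" and le: "norm x \<le> 1"
  shows "0 \<le> c \<Longrightarrow> c \<le> 1/2 \<Longrightarrow> norm (x + c *\<^sub>R (x - x \<odot> (x \<odot> x))) \<le> 1 + c\<^sup>2"
    and "0 \<le> c \<Longrightarrow> c \<le> 1 \<Longrightarrow> norm (x - c *\<^sub>R (x - x \<odot> (x \<odot> x))) \<le> 1"
    and "norm (x - x \<odot> (x \<odot> x)) \<le> 1/2"
proof -
  obtain C where C: "multiplier jp invol C ((\<odot>) x)" and xC: "x \<in> C"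
    using power_multiplier[OF assms] by blast
  interpret m: multiplier jp invol C "(\<odot>) x" by (rule C)
  let ?x3 = "x \<odot> (x \<odot> x)"
  define X :: "real poly" where "X = [:0, 1:]"
  define Z where "Z = X * X"
  define Y where "Y = 1 - Z"
  have X: "m.bnd X 1" unfolding X_def by (rule m.bnd_X)
  have Z: "m.bnd Z 1" unfolding Z_def using m.bnd_mult[OF X X] by simp
  have Y: "m.bnd Y 1" unfolding Y_def Z_def using X by (rule m.bnd_one_minus_sq)
  have pZ: "m.peval Z x = ?x3"
    unfolding Z_def X_def using xC by (simp only: m.peval_mult m.peval_X)
  have pY: "m.peval Y x = x - ?x3"
    unfolding Y_def using xC by (simp add: m.peval_diff_poly pZ)
  have cube_peval: "cube (m.peval q x) = m.peval (q * q * Z) (m.peval q x)" for q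
  proof -
    have "cube (m.peval q x) = m.peval (q * q * q) (m.peval Z x)"
      using xC by (simp only: m.tr_peval cube_sa[OF sa] pZ)
    also have "\<dots> = m.peval (q * q * Z * q) x"
      using xC by (simp only: m.peval_mult[symmetric] mult_ac)
    finally show ?thesis using xC by (simp only: m.peval_mult)
  qed
  have cubeb: "norm (m.peval q x) ^ 2 \<le> b" if "m.bnd (q * q * Z) b" "0 \<le> b" for q b
  proof (cases "m.peval q x = 0")
    case False
    have "norm (m.peval q x) ^ 3 \<le> b * norm (m.peval q x)"
      unfolding norm_cube[symmetric] cube_peval by (rule m.bndD[OF that(1) m.peval_in[OF xC]])
    then have "norm (m.peval q x) ^ 2 * norm (m.peval q x) \<le> b * norm (m.peval q x)"
      by (simp add: power2_eq_square power3_eq_cube)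
    then show ?thesis using False by simp
  qed (use that in simp)
  show "norm (x + c *\<^sub>R (x - ?x3)) \<le> 1 + c\<^sup>2" if c: "0 \<le> c" "c \<le> 1/2"
  proof -
    define q where "q = 1 + smult c Y"
    define d where "d = [:c:]"
    \<comment> \<open>Here (1 + c Y)^2 Z = Z + 2 c Y Z + c^2 Z Y^2, and Y Z = (1 - Y^2) - Z because
      Z = 1 - Y. The weight 1 - 2 c is nonnegative for c \<le> 1/2.\<close>
    have "m.bnd (smult (1 - 2 * c) Z + smult (2 * c) (1 - Y * Y) + smult (c\<^sup>2) (Z * (Y * Y)))
      (\<bar>1 - 2 * c\<bar> * 1 + \<bar>2 * c\<bar> * 1 + \<bar>c\<^sup>2\<bar> * (1 * (1 * 1)))"
      using Y Z by (intro m.bnd_add m.bnd_smult m.bnd_mult m.bnd_one_minus_sq) auto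
    also have "smult (1 - 2 * c) Z + smult (2 * c) (1 - Y * Y) + smult (c\<^sup>2) (Z * (Y * Y)) = q * q * Z"
    proof -
      have sm: "smult r p = [:r:] * p" for r :: real and p by simp
      have eqs: "[:1 - 2 * c:] = 1 - (d + d)" "[:2 * c:] = d + d" "[:c\<^sup>2:] = d * d"
        by (simp_all add: d_def one_pCons power2_eq_square)
      show ?thesis
        unfolding q_def sm eqs d_def[symmetric] Y_def by (simp add: algebra_simps)
    qed
    finally have "m.bnd (q * q * Z) (1 + c\<^sup>2)" using c by simp
    then have "norm (m.peval q x) ^ 2 \<le> 1 + c\<^sup>2" by (rule cubeb) simp
    also have "\<dots> \<le> (1 + c\<^sup>2) ^ 2" by (rule self_le_power) simp_all
    finally have "norm (m.peval q x) \<le> 1 + c\<^sup>2" by (rule power2_le_imp_le) simp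
    moreover have "m.peval q x = x + c *\<^sub>R (x - ?x3)"
      unfolding q_def using xC by (simp add: m.peval_add_poly m.peval_smult pY)
    ultimately show ?thesis by simp
  qed
  show "norm (x - c *\<^sub>R (x - ?x3)) \<le> 1" if c: "0 \<le> c" "c \<le> 1"
  proof -
    have "norm ?x3 \<le> 1" using le by (simp add: norm_cube_sa[OF sa] power_le_one)
    have "x - c *\<^sub>R (x - ?x3) = (1 - c) *\<^sub>R x + c *\<^sub>R ?x3" by (simp add: algebra_simps)
    then have "norm (x - c *\<^sub>R (x - ?x3)) \<le> (1 - c) * norm x + c * norm ?x3"
      using norm_triangle_ineq[of "(1 - c) *\<^sub>R x" "c *\<^sub>R ?x3"] c by simp
    also have "\<dots> \<le> (1 - c) * 1 + c * 1"
      using c le \<open>norm ?x3 \<le> 1\<close> by (intro add_mono mult_left_mono) auto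
    finally show ?thesis by simp
  qed
  \<comment> \<open>The scalar inequality t (1 - t) \<le> 1/4, written as 4 Y Z = 1 - (1 - 2
    X^2)^2.\<close>
  have "m.bnd (Y * Z) (1/4)"
  proof -
    define g where "g = 1 - smult 2 (X * X)"
    have "m.bnd (smult (1/4) (1 - g * g)) (\<bar>1/4\<bar> * 1)"
      unfolding g_def by (intro m.bnd_smult m.bnd_one_minus_sq m.bnd_one_minus_2sq X)
    moreover have "1 - g * g = smult 4 (Y * Z)"
    proof -
      have "smult 4 p = p + p + p + p" for p :: "real poly"
        using smult_add_left[of 2 2 p] by (simp add: smult_2)
      then show ?thesis by (simp add: g_def Y_def Z_def smult_2 algebra_simps)
    qed
    ultimately show ?thesis by simp
  qed
  then have "m.bnd (Y * (Y * Z)) (1 * (1/4))" by (intro m.bnd_mult Y) auto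
  then have "m.bnd (Y * Y * Z) (1/4)" by (simp add: mult.assoc)
  then have "norm (m.peval Y x) ^ 2 \<le> (1/2)\<^sup>2" using cubeb[of Y "1/4"] by (simp add: power2_eq_square)
  then have "norm (m.peval Y x) \<le> 1/2" by (rule power2_le_imp_le) simp
  then show "norm (x - ?x3) \<le> 1/2" by (simp add: pY)
qed

text \<open>For a unit vector \<open>u\<close> the difference u - u^3 has norm at most 1/2, so
  adding a multiple of the cube gains at least half of that multiple in norm.\<close>

lemma sa_cubic_lower:
  assumes sa: "invol x = x" and \<epsilon>: "\<epsilon> \<ge> 0"
  shows "norm x + \<epsilon> * norm x ^ 3 / 2 \<le> norm (x + \<epsilon> *\<^sub>R (x \<odot> (x \<odot> x)))"
proof (cases "x = 0")
  case False
  define r where "r = norm x"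
  define u where "u = (1 / r) *\<^sub>R x"
  have r: "r > 0" using False by (simp add: r_def)
  have x: "x = r *\<^sub>R u" using r by (simp add: u_def)
  have u: "norm u = 1" "invol u = u" using r sa by (simp_all add: u_def r_def invol_scaleR)
  define \<delta> where "\<delta> = \<epsilon> * r\<^sup>2"
  have \<delta>: "\<delta> \<ge> 0" using \<epsilon> by (simp add: \<delta>_def)
  have "(1 + \<delta>) *\<^sub>R u = (u + \<delta> *\<^sub>R (u \<odot> (u \<odot> u))) + \<delta> *\<^sub>R (u - u \<odot> (u \<odot> u))"
    by (simp add: algebra_simps)
  then have "norm ((1 + \<delta>) *\<^sub>R u) \<le> norm (u + \<delta> *\<^sub>R (u \<odot> (u \<odot> u))) + norm (\<delta> *\<^sub>R (u - u \<odot> (u \<odot> u)))"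
    by (metis norm_triangle_ineq)
  moreover have "\<delta> * norm (u - u \<odot> (u \<odot> u)) \<le> \<delta> * (1/2)"
    using sa_cubic_bounds(3)[of u] u \<delta> by (intro mult_left_mono) auto
  ultimately have "1 + \<delta> / 2 \<le> norm (u + \<delta> *\<^sub>R (u \<odot> (u \<odot> u)))" using \<delta> u by simp
  then have "r * (1 + \<delta> / 2) \<le> r * norm (u + \<delta> *\<^sub>R (u \<odot> (u \<odot> u)))"
    using r by (intro mult_left_mono) auto
  also have "\<dots> = norm (r *\<^sub>R (u + \<delta> *\<^sub>R (u \<odot> (u \<odot> u))))" using r by simp
  also have "r *\<^sub>R (u + \<delta> *\<^sub>R (u \<odot> (u \<odot> u))) = x + \<epsilon> *\<^sub>R (x \<odot> (x \<odot> x))"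
    by (simp add: x bil \<delta>_def scaleR_add_right power2_eq_square mult_ac)
  finally show ?thesis by (simp add: r_def[symmetric] \<delta>_def algebra_simps power2_eq_square power3_eq_cube)
qed (simp)

text \<open>The means \<open>B / n\<close> of the powers of \<open>1 - x\<^sup>2\<close> have constant coefficient \<open>1\<close> as
  polynomials in \<open>x\<^sup>2\<close>, and they almost annihilate \<open>x\<close>.\<close>

lemma sa_approx_unit:
  assumes sa: "invol x = x" and le: "norm x \<le> 1"
    and S: "subspace S" "x \<in> S" "\<And>w. w \<in> S \<Longrightarrow> x \<odot> (x \<odot> w) \<in> S" and e: "e > 0"
  shows "\<exists>w\<in>S. (x \<odot> x) \<odot> w = x \<odot> (x \<odot> w) \<and> norm (x - x \<odot> (x \<odot> w)) < e"
proof -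
  obtain C where C: "multiplier jp invol C ((\<odot>) x)" and xC: "x \<in> C"
    and sq: "\<And>w. w \<in> C \<Longrightarrow> (x \<odot> x) \<odot> w = x \<odot> (x \<odot> w)"
    using power_multiplier[OF assms(1,2)] by blast
  interpret m: multiplier jp invol C "(\<odot>) x" by (rule C)
  define X :: "real poly" where "X = [:0, 1:]"
  define Z where "Z = X * X"
  define Y where "Y = 1 - Z"
  have X: "m.bnd X 1" unfolding X_def by (rule m.bnd_X)
  have Y: "m.bnd Y 1" unfolding Y_def Z_def using X by (rule m.bnd_one_minus_sq)
  have pZ: "m.peval Z w = x \<odot> (x \<odot> w)" if "w \<in> C" for w
    unfolding Z_def X_def using that by (simp only: m.peval_mult m.peval_X)
  define good where "good p \<longleftrightarrow> (\<forall>w\<in>C \<inter> S. m.peval p w \<in> S)" for p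
  have good_add: "good (p + q)" if "good p" "good q" for p q
    using that S(1) by (auto simp: good_def m.peval_add_poly subspace_add)
  have good_Y: "good (Y * p)" if "good p" for p
    using that S by (auto simp: good_def Y_def m.peval_diff_poly m.peval_mult pZ m.peval_in subspace_diff)
  have Yn: "m.bnd (Y ^ n) 1" for n
    by (induction n) (use m.bnd_1 m.bnd_mult[OF Y] in auto)
  \<comment> \<open>\<open>B\<close> is the sum of the powers of \<open>Y\<close> below
    \<open>n\<close>, and \<open>W\<close> is n - B divided by \<open>Z\<close>. Both are
    polynomials in x^2 and so preserve \<open>S\<close>, which is closed under multiplying twice by
    \<open>x\<close> but perhaps not once.\<close>
  have ex: "\<exists>B W. good B \<and> good W \<and> Z * B = 1 - Y ^ n \<and> Z * W = of_nat n - B \<and> m.bnd B (real n)" for n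
  proof (induction n)
    case 0
    show ?case using S(1) by (intro exI[of _ 0]) (auto simp: good_def m.bnd_0 subspace_0)
  next
    case (Suc n)
    then obtain B W where BW: "good B" "good W" "Z * B = 1 - Y ^ n" "Z * W = of_nat n - B" "m.bnd B (real n)"
      by blast
    have "good (1 + Y * B)" by (intro good_add good_Y BW) (simp add: good_def)
    moreover have "good (W + B)" by (intro good_add BW)
    moreover have "Z * (1 + Y * B) = Z + Y * (Z * B)" by (simp add: algebra_simps)
    then have "Z * (1 + Y * B) = 1 - Y ^ Suc n" unfolding BW(3) by (simp add: Y_def algebra_simps)
    moreover have "Z * (W + B) = of_nat (Suc n) - (1 + Y * B)"
    proof -
      have "Z * (W + B) = of_nat n - B + Z * B" by (simp add: distrib_left BW(4))
      also have "Z * B = B - Y * B" by (simp add: Y_def algebra_simps)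
      finally show ?thesis by simp
    qed
    moreover have "m.bnd (1 + Y * B) (1 + 1 * real n)"
      by (intro m.bnd_add m.bnd_1 m.bnd_mult Y BW) auto
    ultimately show ?case by (intro exI[of _ "1 + Y * B"] exI[of _ "W + B"]) (simp add: add.commute)
  qed
  obtain n where n: "n > 0" "2 / real n < e ^ 3"
  proof -
    obtain n where "2 / e ^ 3 < real n" using reals_Archimedean2 by blast
    moreover have "2 / e ^ 3 > 0" using e by simp
    ultimately have "n > 0" by (metis le_less_trans less_imp_le of_nat_0_less_iff)
    moreover have "2 / real n < e ^ 3"
      using \<open>2 / e ^ 3 < real n\<close> \<open>n > 0\<close> e by (simp add: field_simps)
    ultimately show thesis using that by blast
  qed
  obtain B W where BW: "good B" "good W" "Z * B = 1 - Y ^ n" "Z * W = of_nat n - B" "m.bnd B (real n)"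
    using ex by blast
  define A where "A = smult (1 / real n) B"
  define w where "w = (1 / real n) *\<^sub>R m.peval W x"
  have wS: "w \<in> S" using BW(2) xC S by (auto simp: w_def good_def subspace_scale)
  have wC: "w \<in> C" using xC by (simp add: w_def subspace_scale m.C_sub m.peval_in)
  have "m.bnd A (\<bar>1 / real n\<bar> * real n)" unfolding A_def by (intro m.bnd_smult BW)
  then have A1: "m.bnd A 1" using n(1) by simp
  have ZA: "m.bnd (Z * A) (\<bar>1 / real n\<bar> * (1 + 1))"
    unfolding A_def mult_smult_right BW(3) by (intro m.bnd_smult m.bnd_diff m.bnd_1 Yn)
  have "x - x \<odot> (x \<odot> w) = m.peval A x"
  proof -
    have "smult (1 / real n) (of_nat n) = (1 :: real poly)" using n(1) by (simp add: of_nat_poly one_pCons)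
    then have "A = 1 - smult (1 / real n) (Z * W)"
      unfolding A_def BW(4) smult_diff_right by simp
    then have "m.peval A x = x - (1 / real n) *\<^sub>R m.peval Z (m.peval W x)"
      using xC by (simp add: m.peval_diff_poly m.peval_smult m.peval_mult)
    then show ?thesis
      using xC wC by (simp add: w_def m.peval_scaleR m.peval_in flip: pZ)
  qed
  moreover have "norm (m.peval A x) < e"
  proof -
    \<comment> \<open>Only \<open>Z * A\<close> is known to be small. Cubing supplies the missing
      factor \<open>Z\<close>, because the cube of \<open>x\<close> is \<open>Z\<close> applied to
      \<open>x\<close>.\<close>
    have "cube (m.peval A x) = m.peval (A * A * A) (m.peval Z x)"
      using xC by (simp only: m.tr_peval cube_sa[OF sa] pZ)
    also have "\<dots> = m.peval (A * A * (Z * A)) x"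
      using xC by (simp only: m.peval_mult[symmetric] mult_ac)
    finally have "norm (m.peval A x) ^ 3 = norm (m.peval (A * A * (Z * A)) x)" by (simp flip: norm_cube)
    also have "m.bnd (A * A * (Z * A)) (1 * 1 * (\<bar>1 / real n\<bar> * (1 + 1)))"
      by (intro m.bnd_mult A1 ZA) auto
    then have "norm (m.peval (A * A * (Z * A)) x) \<le> (1 * 1 * (\<bar>1 / real n\<bar> * (1 + 1))) * norm x"
      using xC by (rule m.bndD)
    also have "\<dots> \<le> 2 / real n * 1" using le n(1) by (simp add: divide_right_mono)
    also have "\<dots> < e ^ 3" using n by simp
    finally show ?thesis using e by (simp add: power_less_imp_less_base)
  qed
  ultimately show ?thesis using wS sq[OF wC] by auto
qed

lemma sa_approx:
  assumes sa: "invol x = x"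
    and S: "subspace S" "x \<in> S" "\<And>w. w \<in> S \<Longrightarrow> x \<odot> (x \<odot> w) \<in> S" and e: "e > 0"
  shows "\<exists>w\<in>S. (x \<odot> x) \<odot> w = x \<odot> (x \<odot> w) \<and> norm (x - x \<odot> (x \<odot> w)) < e"
proof (cases "x = 0")
  case False
  define r where "r = norm x"
  define u where "u = (1 / r) *\<^sub>R x"
  have r: "r > 0" using False by (simp add: r_def)
  have x: "x = r *\<^sub>R u" using r by (simp add: u_def)
  have u: "norm u \<le> 1" "invol u = u" "u \<in> S"
    using r sa S by (simp_all add: u_def r_def invol_scaleR subspace_scale)
  have "u \<odot> (u \<odot> w) \<in> S" if "w \<in> S" for w
    using S(3)[OF that] S(1) by (simp add: u_def bil subspace_scale)
  then obtain w where w: "w \<in> S" "(u \<odot> u) \<odot> w = u \<odot> (u \<odot> w)" "norm (u - u \<odot> (u \<odot> w)) < e / r"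
    using sa_approx_unit[OF u(2,1) S(1) u(3), of "e / r"] e r by auto
  define v where "v = (1 / r) *\<^sub>R w"
  have "v \<in> S" using w(1) S(1) by (simp add: v_def subspace_scale)
  moreover have "(x \<odot> x) \<odot> v = x \<odot> (x \<odot> v)" using w(2) by (simp add: x v_def bil)
  moreover have "x - x \<odot> (x \<odot> v) = r *\<^sub>R (u - u \<odot> (u \<odot> w))"
    using r by (simp add: x v_def bil scaleR_diff_right)
  then have "norm (x - x \<odot> (x \<odot> v)) = r * norm (u - u \<odot> (u \<odot> w))" using r by simp
  then have "norm (x - x \<odot> (x \<odot> v)) < e" using w(3) r by (simp add: field_simps)
  ultimately show ?thesis by blast
next
  case True
  show ?thesis
    by (rule bexI[of _ 0]) (simp_all add: True jp.zero_left jp.zero_right e subspace_0[OF S(1)])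
qed

end

subsection \<open>M-summands are ideals\<close>

locale jb_M_proj = jbstar jp invol + M_proj A P
  for jp :: "'a::complex_banach \<Rightarrow> 'a \<Rightarrow> 'a" (infixl "\<odot>" 70) and invol and A P +
  assumes A_jp: "x \<in> A \<Longrightarrow> y \<in> A \<Longrightarrow> x \<odot> y \<in> A" and A_invol: "x \<in> A \<Longrightarrow> invol x \<in> A"
begin

lemma compl': "jb_M_proj jp invol A (\<lambda>x. x - P x)"
  using compl by (simp add: jb_M_proj_def jb_M_proj_axioms_def jbstar_axioms A_jp A_invol)

lemma P_derivation:
  assumes "triple_derivation D" "\<And>x. x \<in> A \<Longrightarrow> D x \<in> A" "x \<in> A"
  shows "P (D x) = D (P x)"
  using assms derivation_skew[OF assms(1)]
  by (intro skew_commute) (simp_all add: triple_derivation_def bounded_linear.linear)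

lemma P_jp_skew:
  assumes "invol b = - b" "b \<in> A" "x \<in> A"
  shows "P (b \<odot> x) = b \<odot> P x"
  by (rule P_derivation[OF skew_derivation[OF assms(1)]]) (simp_all add: assms A_jp)

lemma P_commutator:
  assumes "invol a = a" "invol b = b" "a \<in> A" "b \<in> A" "x \<in> A"
  shows "P (a \<odot> (b \<odot> x)) - P (b \<odot> (a \<odot> x)) = a \<odot> (b \<odot> P x) - b \<odot> (a \<odot> P x)"
proof -
  have "P (a \<odot> (b \<odot> x) - b \<odot> (a \<odot> x)) = a \<odot> (b \<odot> P x) - b \<odot> (a \<odot> P x)"
    by (rule P_derivation[OF commutator_derivation[OF assms(1,2)]]) (simp_all add: assms A_jp A_diff)
  then show ?thesis using assms by (simp add: P_diff A_jp)
qed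

text \<open>Writing \<open>y = a + b\<close> with \<open>a\<close> self-adjoint and \<open>b\<close> skew, one finds
  \<open>a (a b) = b\<^sup>3\<close>; with \<open>b = i \<beta>\<close> the operator \<open>-L(a)\<^sup>2\<close> would increase the norm of \<open>\<beta>\<close> to
  second order.\<close>

lemma P_mixed_zero:
  assumes y: "y \<in> A" "P y = y" "P (invol y) = 0"
  shows "y = 0"
proof -
  define a where "a = (1/2) *\<^sub>R (y + invol y)"
  define b where "b = (1/2) *\<^sub>R (y - invol y)"
  have iyA: "invol y \<in> A" using y A_invol by simp
  have a: "a \<in> A" "invol a = a" and b: "b \<in> A" "invol b = - b"
    using y(1) iyA by (simp_all add: a_def b_def A_add A_diff A_scaleR invol_scaleR invol_add invol.diff
        add.commute flip: scaleR_minus_right)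
  have two: "z = (1/2) *\<^sub>R (z + z)" for z :: 'a by (simp flip: scaleR_2)
  have y_eq: "y = a + b" unfolding a_def b_def
    using two[of y] by (simp add: algebra_simps)
  have iy_eq: "invol y = a - b" unfolding a_def b_def
    using two[of "invol y"] by (simp add: algebra_simps)
  \<comment> \<open>\<open>d\<close> is skew, so multiplying by \<open>d\<close>, or twice by
    \<open>b\<close>, commutes with \<open>P\<close>. Combinations of the two send both
    \<open>y\<close> and \<open>invol y\<close> to \<open>t\<close>, which therefore lies in the
    range and in the kernel.\<close>
  define d where "d = a \<odot> b"
  have d: "d \<in> A" "invol d = - d" using a b by (simp_all add: d_def A_jp sa_jp_skew)
  have *: "P (d \<odot> z - b \<odot> (b \<odot> z)) = d \<odot> P z - b \<odot> (b \<odot> P z)" if "z \<in> A" for z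
    using that b d by (simp add: P_diff P_jp_skew A_jp)
  define t where "t = d \<odot> a - b \<odot> (b \<odot> b)"
  have "d \<odot> y - b \<odot> (b \<odot> y) = t"
    by (simp add: t_def y_eq d_def bil comm)
  then have "P t = t" using *[OF y(1)] y(2) by simp
  have iy_t: "d \<odot> invol y + b \<odot> (b \<odot> invol y) = t"
    by (simp add: t_def iy_eq d_def bil comm)
  have "P (d \<odot> invol y + b \<odot> (b \<odot> invol y)) = 0"
    using iyA b d y(3) by (simp add: P_add P_jp_skew A_jp jp.zero_right)
  then have "P t = 0" unfolding iy_t .
  then have "t = 0" using \<open>P t = t\<close> by simp
  define \<beta> where "\<beta> = scaleC (- \<i>) b"
  have \<beta>: "invol \<beta> = \<beta>"
  proof -
    have "- b = scaleC (- 1) b" by (simp add: scaleC_minus_left scaleC_one)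
    then show ?thesis unfolding \<beta>_def invol_scaleC b(2) by (simp add: scaleC_scaleC)
  qed
  have b_eq: "b = scaleC \<i> \<beta>" by (simp add: \<beta>_def scaleC_scaleC scaleC_one)
  have bbb: "b \<odot> (b \<odot> b) = scaleC (- \<i>) (\<beta> \<odot> (\<beta> \<odot> \<beta>))"
    by (simp add: b_eq scaleC_left scaleC_right scaleC_scaleC)
  have da: "d \<odot> a = scaleC \<i> (a \<odot> (a \<odot> \<beta>))"
    by (simp add: d_def b_eq scaleC_left scaleC_right comm)
  have "scaleC \<i> (a \<odot> (a \<odot> \<beta>)) = scaleC (- \<i>) (\<beta> \<odot> (\<beta> \<odot> \<beta>))"
    using \<open>t = 0\<close> by (simp add: t_def bbb da)
  then have "scaleC (- \<i>) (scaleC \<i> (a \<odot> (a \<odot> \<beta>))) = scaleC (- \<i>) (scaleC (- \<i>) (\<beta> \<odot> (\<beta> \<odot> \<beta>)))"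
    by simp
  then have aab: "a \<odot> (a \<odot> \<beta>) = - (\<beta> \<odot> (\<beta> \<odot> \<beta>))"
    by (simp only: scaleC_scaleC) (simp add: scaleC_one scaleC_minus_left)
  obtain C where "C \<ge> 0" and C: "\<And>s x. \<bar>s\<bar> \<le> 1 \<Longrightarrow>
      norm (x - (s\<^sup>2 / 2) *\<^sub>R (a \<odot> (a \<odot> x))) \<le> (1 + C * \<bar>s\<bar> ^ 3) * norm x"
    using sa_second_order[OF a(2)] by blast
  have "\<beta> = 0"
  proof (rule ccontr)
    assume "\<beta> \<noteq> 0"
    then have r: "norm \<beta> > 0" by simp
    have "(norm \<beta>)\<^sup>2 \<le> 4 * C * s" if s: "0 < s" "s \<le> 1" for s
    proof -
      have "norm \<beta> + (s\<^sup>2 / 2) * norm \<beta> ^ 3 / 2 \<le> norm (\<beta> + (s\<^sup>2 / 2) *\<^sub>R (\<beta> \<odot> (\<beta> \<odot> \<beta>)))"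
        by (rule sa_cubic_lower[OF \<beta>]) simp
      also have "\<dots> \<le> (1 + C * \<bar>s\<bar> ^ 3) * norm \<beta>"
        using C[of s \<beta>] s by (simp add: aab)
      finally have "(s\<^sup>2 * norm \<beta>) * (norm \<beta>)\<^sup>2 \<le> (s\<^sup>2 * norm \<beta>) * (4 * C * s)"
        using s by (simp add: algebra_simps power2_eq_square power3_eq_cube)
      then show ?thesis using s r by simp
    qed
    note le = this
    \<comment> \<open>For this \<open>s\<close> the third-order error is at most half of the
      second-order gain.\<close>
    define s where "s = min 1 ((norm \<beta>)\<^sup>2 / (8 * (C + 1)))"
    have s: "0 < s" "s \<le> 1" "s \<le> (norm \<beta>)\<^sup>2 / (8 * (C + 1))"
      using r \<open>C \<ge> 0\<close> by (simp_all add: s_def)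
    have "(norm \<beta>)\<^sup>2 \<le> 4 * C * s" by (rule le[OF s(1,2)])
    also have "\<dots> \<le> 4 * (C + 1) * ((norm \<beta>)\<^sup>2 / (8 * (C + 1)))"
      using s \<open>C \<ge> 0\<close> by (intro mult_mono) auto
    also have "\<dots> = (norm \<beta>)\<^sup>2 / 2" using \<open>C \<ge> 0\<close> by (simp add: field_simps)
    finally show False using r by simp
  qed
  then have "b = 0" by (simp add: b_eq)
  then have "invol y = y" unfolding iy_eq by (subst y_eq) simp
  then have "P y = 0" using y(3) by (simp only:)
  then show ?thesis using y(2) by simp
qed

text \<open>Conjugating \<open>P\<close> with the involution gives an M-projection \<open>P'\<close>
  that preserves the range of \<open>P\<close>. The part of \<open>x\<close> in the kernel of
  \<open>P'\<close> is an element of the range of \<open>P\<close> with adjoint in the kernel, to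
  which \<open>P_mixed_zero\<close> applies.\<close>

lemma P_invol_range:
  assumes x: "x \<in> A" "P x = x"
  shows "P (invol x) = invol x"
proof -
  define P' where "P' z = invol (P (invol z))" for z
  have P'A: "M_proj A P'"
  proof
    show "M_projection A P'"
      unfolding M_projection_def
    proof (intro conjI ballI allI)
      show "P' ` A \<subseteq> A" by (auto simp: P'_def A_invol P_in)
      show "norm z = max (norm (P' z)) (norm (z - P' z))" if "z \<in> A" for z
      proof -
        have "z - P' z = invol (invol z - P (invol z))" by (simp add: P'_def invol.diff)
        then have "norm (z - P' z) = norm (invol z - P (invol z))" by simp
        then show ?thesis using P_norm[of "invol z"] that by (simp add: P'_def A_invol)
      qed
    qed (simp_all add: P'_def invol_add invol_scaleR P_add P_scaleR P_idem A_invol P_in)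
  qed (rule A_sub)
  interpret p: M_proj A P' by (rule P'A)
  define y where "y = x - P' x"
  have yA: "y \<in> A" using x by (simp add: y_def A_diff p.P_in)
  have "P y = y" using x M_proj_commute[OF P'A x] by (simp add: y_def P_diff p.P_in)
  moreover have "P' y = 0" using x by (simp add: y_def p.P_diff p.P_in p.P_idem)
  then have "invol (P' y) = 0" by (simp add: invol.zero)
  then have "P (invol y) = 0" by (simp add: P'_def)
  ultimately have "y = 0" using P_mixed_zero yA by blast
  then have "invol x = invol (P' x)" by (simp add: y_def)
  then show ?thesis by (simp add: P'_def)
qed

lemma P_invol:
  assumes x: "x \<in> A"
  shows "P (invol x) = invol (P x)"
proof -
  interpret c: jb_M_proj jp invol A "\<lambda>x. x - P x" by (rule compl')
  have "P (invol (P x)) = invol (P x)" using x by (intro P_invol_range) (simp_all add: P_in P_idem)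
  moreover have "P (invol (x - P x)) = 0"
    using c.P_invol_range[of "x - P x"] x by (simp add: A_diff P_in P_diff P_idem)
  ultimately show ?thesis using x by (simp add: invol.diff P_diff A_invol P_in)
qed

section \<open>Products of self-adjoint elements of the range and of the kernel\<close>

definition Ms :: "'a set" where "Ms = {x \<in> A. P x = x \<and> invol x = x}"
definition Ns :: "'a set" where "Ns = {x \<in> A. P x = 0 \<and> invol x = x}"

lemma MsD: "m \<in> Ms \<Longrightarrow> m \<in> A" "m \<in> Ms \<Longrightarrow> P m = m" "m \<in> Ms \<Longrightarrow> invol m = m"
  and NsD: "n \<in> Ns \<Longrightarrow> n \<in> A" "n \<in> Ns \<Longrightarrow> P n = 0" "n \<in> Ns \<Longrightarrow> invol n = n"
  by (simp_all add: Ms_def Ns_def)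

lemma P_in_Ms: "z \<in> A \<Longrightarrow> invol z = z \<Longrightarrow> P z \<in> Ms"
  and compl_in_Ns: "z \<in> A \<Longrightarrow> invol z = z \<Longrightarrow> z - P z \<in> Ns"
  using P_invol[of z] by (simp_all add: Ms_def Ns_def P_in P_idem A_diff P_diff invol.diff)

lemma Ns_subspace: "subspace Ns"
  unfolding subspace_def Ns_def
  by (auto simp: subspace_0[OF A_sub] P_0 invol.zero A_add P_add invol_add A_scaleR P_scaleR invol_scaleR)

lemma Ms_subspace: "subspace Ms"
  unfolding subspace_def Ms_def
  by (auto simp: subspace_0[OF A_sub] P_0 invol.zero A_add P_add invol_add A_scaleR P_scaleR invol_scaleR)

lemma compl_Ms: "jb_M_proj.Ms invol A (\<lambda>x. x - P x) = Ns"
  and compl_Ns: "jb_M_proj.Ns invol A (\<lambda>x. x - P x) = Ms"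
proof -
  interpret c: jb_M_proj jp invol A "\<lambda>x. x - P x" by (rule compl')
  show "c.Ms = Ns" by (auto simp: c.Ms_def Ns_def)
  show "c.Ns = Ms" by (auto simp: c.Ns_def Ms_def)
qed

text \<open>\<open>x\<close> lies in the unit ball, and there a step \<open>c\<close> along x - x^3
  in either direction exceeds norm 1 by at most c^2; \<open>P\<close> carries this over to the
  range. Varying \<open>n\<close> then isolates single coefficients of the cubic.\<close>

lemma cube_direction:
  assumes m: "m \<in> Ms" "norm m \<le> 1" and n: "n \<in> Ns" "norm n \<le> 1" and c: "0 \<le> c" "c \<le> 1/2"
  defines "x \<equiv> m + n"
  defines "u \<equiv> m - P (x \<odot> (x \<odot> x))"
  shows "norm (m + c *\<^sub>R u) \<le> 1 + c\<^sup>2" "norm (m - c *\<^sub>R u) \<le> 1 + c\<^sup>2"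
proof -
  have xA: "x \<in> A" and xs: "invol x = x" and Px: "P x = m"
    using MsD m NsD n by (simp_all add: x_def A_add invol_add P_add)
  have x1: "norm x \<le> 1"
    unfolding x_def using norm_sum[of m n] MsD m NsD n by simp
  let ?d = "x - x \<odot> (x \<odot> x)"
  have x3A: "x \<odot> (x \<odot> x) \<in> A" by (intro A_jp xA)
  have dA: "?d \<in> A" by (intro A_diff xA x3A)
  have Pd: "P ?d = u" by (simp add: P_diff xA x3A Px u_def)
  have "m + c *\<^sub>R u = P (x + c *\<^sub>R ?d)"
    by (simp add: P_add P_scaleR xA dA A_scaleR Pd Px)
  also have "norm \<dots> \<le> norm (x + c *\<^sub>R ?d)" by (intro norm_P_le A_add A_scaleR xA dA)
  also have "\<dots> \<le> 1 + c\<^sup>2" using c by (rule sa_cubic_bounds(1)[OF xs x1])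
  finally show "norm (m + c *\<^sub>R u) \<le> 1 + c\<^sup>2" .
  have "m - c *\<^sub>R u = P (x - c *\<^sub>R ?d)"
    by (simp add: P_diff P_scaleR xA dA A_scaleR Pd Px)
  also have "norm \<dots> \<le> norm (x - c *\<^sub>R ?d)" by (intro norm_P_le A_diff A_scaleR xA dA)
  also have "\<dots> \<le> 1" using c by (intro sa_cubic_bounds(2)[OF xs x1]) auto
  also have "\<dots> \<le> 1 + c\<^sup>2" by simp
  finally show "norm (m - c *\<^sub>R u) \<le> 1 + c\<^sup>2" .
qed

lemma P_cube_expand:
  fixes t :: real
  assumes m: "m \<in> Ms" and n: "n \<in> Ns"
  defines "x \<equiv> m + t *\<^sub>R n"
  shows "P (x \<odot> (x \<odot> x)) = P (m \<odot> (m \<odot> m)) + t *\<^sub>R P (2 *\<^sub>R (m \<odot> (m \<odot> n)) + n \<odot> (m \<odot> m))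
    + t\<^sup>2 *\<^sub>R P (2 *\<^sub>R (n \<odot> (n \<odot> m)) + (n \<odot> n) \<odot> m) + t ^ 3 *\<^sub>R P (n \<odot> (n \<odot> n))"
proof -
  have "x \<odot> (x \<odot> x) = m \<odot> (m \<odot> m) + t *\<^sub>R (2 *\<^sub>R (m \<odot> (m \<odot> n)) + n \<odot> (m \<odot> m))
    + t\<^sup>2 *\<^sub>R (2 *\<^sub>R (n \<odot> (n \<odot> m)) + (n \<odot> n) \<odot> m) + t ^ 3 *\<^sub>R (n \<odot> (n \<odot> n))"
  proof -
    define k where "k = t *\<^sub>R n"
    have "x \<odot> (x \<odot> x) = m \<odot> (m \<odot> m) + (2 *\<^sub>R (m \<odot> (m \<odot> k)) + k \<odot> (m \<odot> m))
      + (2 *\<^sub>R (k \<odot> (k \<odot> m)) + (k \<odot> k) \<odot> m) + k \<odot> (k \<odot> k)"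
      unfolding x_def k_def[symmetric]
      by (simp add: add_left add_right scaleR_2 comm[of k m] comm[of "k \<odot> k" m] add_ac)
    then show ?thesis
      by (simp add: k_def jp.scaleR_left jp.scaleR_right scaleR_add_right power2_eq_square
          power3_eq_cube mult_ac)
  qed
  then show ?thesis
    using MsD(1)[OF m] NsD(1)[OF n] by (simp add: P_add P_scaleR A_jp A_add A_scaleR)
qed

text \<open>The combination of the four values \<open>t = \<plusminus>1, \<plusminus>1/2\<close> extracts the leading coefficient of the
  cubic polynomial \<open>P ((m + t n)\<^sup>3)\<close>, where \<open>m\<close> points into the direction of this coefficient.\<close>

lemma P_cube_zero_unit:
  assumes n: "n \<in> Ns" "norm n \<le> 1"
  shows "P (n \<odot> (n \<odot> n)) = 0"
proof (rule ccontr)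
  define p where "p = P (n \<odot> (n \<odot> n))"
  assume "P (n \<odot> (n \<odot> n)) \<noteq> 0"
  then have p0: "norm p > 0" by (simp add: p_def)
  define m where "m = (1 / norm p) *\<^sub>R p"
  have "p \<in> Ms"
    unfolding p_def using NsD[OF n(1)] by (intro P_in_Ms) (simp_all add: A_jp invol_jp)
  then have m: "m \<in> Ms" "norm m \<le> 1" using p0 by (simp_all add: m_def subspace_scale Ms_subspace)
  have pm: "p = norm p *\<^sub>R m" using p0 by (simp add: m_def)
  define u where "u t = m - P ((m + t *\<^sub>R n) \<odot> ((m + t *\<^sub>R n) \<odot> (m + t *\<^sub>R n)))" for t
  define g0 where "g0 = P (m \<odot> (m \<odot> m))"
  define g1 where "g1 = P (2 *\<^sub>R (m \<odot> (m \<odot> n)) + n \<odot> (m \<odot> m))"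
  define g2 where "g2 = P (2 *\<^sub>R (n \<odot> (n \<odot> m)) + (n \<odot> n) \<odot> m)"
  have u: "u t = m - (g0 + t *\<^sub>R g1 + t\<^sup>2 *\<^sub>R g2 + t ^ 3 *\<^sub>R p)" for t
    unfolding u_def P_cube_expand[OF m(1) n(1)] g0_def g1_def g2_def p_def by simp
  have "norm p \<le> 4 * c" if c: "0 < c" "c \<le> 1/2" for c
  proof -
    have b: "norm (m + c *\<^sub>R u t) \<le> 1 + c\<^sup>2" "norm (m - c *\<^sub>R u t) \<le> 1 + c\<^sup>2" if "\<bar>t\<bar> \<le> 1" for t
    proof -
      have "t *\<^sub>R n \<in> Ns" by (intro subspace_scale Ns_subspace n)
      moreover have "norm (t *\<^sub>R n) \<le> 1" using that n(2) by (simp add: mult_le_one)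
      ultimately show "norm (m + c *\<^sub>R u t) \<le> 1 + c\<^sup>2" "norm (m - c *\<^sub>R u t) \<le> 1 + c\<^sup>2"
        unfolding u_def using cube_direction[OF m, of "t *\<^sub>R n" c] c by auto
    qed
    \<comment> \<open>The weights 2 at distance 1 and 4 at distance 1/2 cancel the linear
      coefficient, symmetry cancels the even ones, and 4 - 1 = 3 copies of the cubic one
      remain.\<close>
    have "12 *\<^sub>R m + (3 * c) *\<^sub>R p = (2 *\<^sub>R (m - c *\<^sub>R u 1) + 2 *\<^sub>R (m + c *\<^sub>R u (-1)))
        + (4 *\<^sub>R (m + c *\<^sub>R u (1/2)) + 4 *\<^sub>R (m - c *\<^sub>R u (-1/2)))" (is "?l = ?r")
    proof -
      have "2 *\<^sub>R u 1 - 2 *\<^sub>R u (-1) - 4 *\<^sub>R u (1/2) + 4 *\<^sub>R u (-1/2) = - (3 *\<^sub>R p)"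
        unfolding u by (simp add: power2_eq_square power3_eq_cube scaleR_add_right scaleR_diff_right
            flip: scaleR_minus_left scaleR_add_left scaleR_diff_left)
      then have "3 *\<^sub>R p = 2 *\<^sub>R u (-1) - 2 *\<^sub>R u 1 + 4 *\<^sub>R u (1/2) - 4 *\<^sub>R u (-1/2)"
        by (simp add: algebra_simps)
      then have "c *\<^sub>R 3 *\<^sub>R p = c *\<^sub>R (2 *\<^sub>R u (-1) - 2 *\<^sub>R u 1 + 4 *\<^sub>R u (1/2) - 4 *\<^sub>R u (-1/2))"
        by simp
      moreover have "12 *\<^sub>R m = 2 *\<^sub>R m + 2 *\<^sub>R m + 4 *\<^sub>R m + 4 *\<^sub>R m" by (simp flip: scaleR_add_left)
      ultimately show ?thesis by (simp add: algebra_simps)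
    qed
    then have "norm (12 *\<^sub>R m + (3 * c) *\<^sub>R p) = norm ?r" by simp
    also have "\<dots> \<le> (2 * (1 + c\<^sup>2) + 2 * (1 + c\<^sup>2)) + (4 * (1 + c\<^sup>2) + 4 * (1 + c\<^sup>2))"
      by (intro order_trans[OF norm_triangle_ineq] add_mono)
        (simp_all only: norm_scaleR abs_numeral, (intro mult_left_mono b; simp)+)
    finally have "norm (12 *\<^sub>R m + (3 * c) *\<^sub>R p) \<le> 12 * (1 + c\<^sup>2)" by simp
    moreover have "12 *\<^sub>R m + (3 * c) *\<^sub>R p = (12 + 3 * c * norm p) *\<^sub>R m"
      by (subst pm) (simp add: scaleR_add_left)
    moreover have "norm m = 1" using p0 by (simp add: m_def)
    ultimately have "12 + 3 * c * norm p \<le> 12 * (1 + c\<^sup>2)" using c by simp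
    then have "c * norm p \<le> c * (4 * c)" by (simp add: power2_eq_square)
    then show ?thesis using c by simp
  qed
  note le = this
  define c where "c = min (1/2) (norm p / 8)"
  have "0 < c" "c \<le> 1/2" "c \<le> norm p / 8" using p0 by (simp_all add: c_def)
  then show False using le[of c] p0 by simp
qed

lemma P_cube_zero:
  assumes n: "n \<in> Ns"
  shows "P (n \<odot> (n \<odot> n)) = 0"
proof -
  define r where "r = norm n + 1"
  have r: "r > 0" by (simp add: r_def add_nonneg_pos)
  define v where "v = (1 / r) *\<^sub>R n"
  have v: "v \<in> Ns" "norm v \<le> 1" using n r by (simp_all add: v_def subspace_scale Ns_subspace) (simp add: r_def)
  have "n = r *\<^sub>R v" using r by (simp add: v_def)
  then have "P (n \<odot> (n \<odot> n)) = (r * r * r) *\<^sub>R P (v \<odot> (v \<odot> v))"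
    using NsD[OF v(1)] by (simp add: bil P_scaleR A_jp mult_ac)
  then show ?thesis using P_cube_zero_unit[OF v] by simp
qed

text \<open>\<open>T\<close> is symmetric in the last two arguments by commutativity, and in the
  first two because the commutator of two multiplications commutes with \<open>P\<close>, which
  kills \<open>c\<close>. A symmetric trilinear map that vanishes on the diagonal is zero.\<close>

lemma P_NNN:
  assumes "a \<in> Ns" "b \<in> Ns" "c \<in> Ns"
  shows "P (a \<odot> (b \<odot> c)) = 0"
proof -
  define T where "T a b c = P (a \<odot> (b \<odot> c))" for a b c
  have comm23: "T a b c = T a c b" for a b c by (simp add: T_def comm)
  have comm12: "T a b c = T b a c" if "a \<in> Ns" "b \<in> Ns" "c \<in> Ns" for a b c
    using P_commutator[of a b c] NsD[OF that(1)] NsD[OF that(2)] NsD[OF that(3)]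
    by (simp add: T_def jp.zero_right)
  have add: "T (a + a') b c = T a b c + T a' b c" "T a (b + b') c = T a b c + T a b' c"
    "T a b (c + c') = T a b c + T a b c'"
    "T (a - a') b c = T a b c - T a' b c" "T a (b - b') c = T a b c - T a b' c"
    "T a b (c - c') = T a b c - T a b c'"
    if "a \<in> Ns" "a' \<in> Ns" "b \<in> Ns" "b' \<in> Ns" "c \<in> Ns" "c' \<in> Ns" for a a' b b' c c'
    using NsD(1)[OF that(1)] NsD(1)[OF that(2)] NsD(1)[OF that(3)] NsD(1)[OF that(4)] NsD(1)[OF that(5)] NsD(1)[OF that(6)]
    by (simp_all add: T_def bil P_add P_diff A_jp)
  have cube: "T a a a = 0" if "a \<in> Ns" for a using P_cube_zero[OF that] by (simp add: T_def)
  have sq: "T a b b = 0" if a: "a \<in> Ns" and b: "b \<in> Ns" for a b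
  proof -
    have ab: "a + b \<in> Ns" "a - b \<in> Ns" using a b by (simp_all add: subspace_add subspace_diff Ns_subspace)
    have s: "T a b a = T a a b" "T b a a = T a a b" "T b a b = T a b b" "T b b a = T a b b"
      using comm23 comm12 a b by metis+
    have "0 = T (a + b) (a + b) (a + b) + T (a - b) (a - b) (a - b) - 2 *\<^sub>R T a a a"
      using cube a ab by simp
    also have "\<dots> = 6 *\<^sub>R T a b b"
    proof -
      have three: "3 *\<^sub>R z = z + z + z" for z :: 'a
        using scaleR_left.add[of 1 2 z] by (simp add: scaleR_2)
      have six: "6 *\<^sub>R z = z + z + z + (z + z + z)" for z :: 'a
        using scaleR_left.add[of 3 3 z] by (simp add: three)
      have e1: "T (a + b) (a + b) (a + b) = T a a a + 3 *\<^sub>R T a a b + 3 *\<^sub>R T a b b + T b b b"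
        using a b ab by (simp add: add s three)
      have e2: "T (a - b) (a - b) (a - b) = T a a a - 3 *\<^sub>R T a a b + 3 *\<^sub>R T a b b - T b b b"
        using a b ab by (simp add: add s three algebra_simps)
      show ?thesis unfolding e1 e2 using cube[OF a] cube[OF b] by (simp add: three six)
    qed
    finally show ?thesis by simp
  qed
  have "b + c \<in> Ns" using assms by (simp add: subspace_add Ns_subspace)
  then have "T a (b + c) (b + c) = 0" using sq assms by blast
  then have "2 *\<^sub>R T a b c = 0"
    using assms \<open>b + c \<in> Ns\<close> sq[OF assms(1,2)] sq[OF assms(1,3)]
    by (simp add: add comm23[of a c b] scaleR_2)
  then show ?thesis by (simp add: T_def)
qed

lemma NNN_in:
  assumes "a \<in> Ns" "b \<in> Ns" "c \<in> Ns"
  shows "a \<odot> (b \<odot> c) \<in> Ns"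
  using P_NNN[OF assms] NsD[OF assms(1)] NsD[OF assms(2)] NsD[OF assms(3)]
  by (simp add: Ns_def A_jp invol_jp)

text \<open>The commutator of the multiplications by \<open>m\<close> and \<open>n\<close> commutes
  with \<open>P\<close> and is applied to \<open>w\<close>, which \<open>P\<close> kills.\<close>

lemma P_assoc:
  assumes n: "n \<in> Ns" "w \<in> Ns" and m: "m \<in> Ms"
  shows "P ((n \<odot> w) \<odot> m) = P (n \<odot> (w \<odot> m))"
proof -
  have "P (m \<odot> (n \<odot> w)) - P (n \<odot> (m \<odot> w)) = 0"
    using P_commutator[of m n w] NsD[OF n(1)] NsD[OF n(2)] MsD[OF m] by (simp add: jp.zero_right)
  then show ?thesis by (simp add: comm)
qed

lemma P_assoc':
  assumes n: "n \<in> Ns" "w \<in> Ns" and m: "m \<in> Ms"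
  shows "P (w \<odot> (n \<odot> m)) = P (n \<odot> (w \<odot> m))"
  using P_assoc[OF n m] P_assoc[OF n(2,1) m] by (simp add: comm[of w n])

lemma P_NNA:
  assumes n: "n \<in> Ns" "w \<in> Ns" and z: "z \<in> A" "invol z = z"
  shows "P (n \<odot> (w \<odot> z)) = P (n \<odot> (w \<odot> P z))" "P ((n \<odot> w) \<odot> z) = P (n \<odot> (w \<odot> P z))"
proof -
  have N: "z - P z \<in> Ns" and M: "P z \<in> Ms" using z by (auto intro: compl_in_Ns P_in_Ms)
  have A: "n \<in> A" "w \<in> A" "P z \<in> A" using n NsD z P_in by auto
  have "P (n \<odot> (w \<odot> (z - P z))) = 0" by (intro P_NNN n N)
  then show "P (n \<odot> (w \<odot> z)) = P (n \<odot> (w \<odot> P z))"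
    using A z by (simp add: jp.diff_right P_diff A_jp)
  have "P ((z - P z) \<odot> (n \<odot> w)) = 0" by (intro P_NNN n N)
  then have "P ((n \<odot> w) \<odot> z) = P ((n \<odot> w) \<odot> P z)"
    using A z by (simp add: jp.diff_right P_diff A_jp comm[of _ "n \<odot> w"])
  then show "P ((n \<odot> w) \<odot> z) = P (n \<odot> (w \<odot> P z))" using P_assoc[OF n M] by simp
qed

text \<open>The coefficient of t^2 in the projected cube of m + t n is three times this operator. A
  symmetric second difference isolates it from values that \<open>cube_direction\<close> controls up
  to c^2.\<close>

lemma skew_nn_unit:
  assumes n: "n \<in> Ns" "norm n \<le> 1"
  shows "skew Ms (\<lambda>m. P (n \<odot> (n \<odot> m)))"
proof (rule skewI[of "3/4" 1])
  fix s :: real and m assume s: "\<bar>s\<bar> \<le> 3/4" and m: "m \<in> Ms"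
  define E where "E m = P (n \<odot> (n \<odot> m))" for m
  have unit: "norm (v + s *\<^sub>R E v) \<le> 1 + s\<^sup>2" if s: "\<bar>s\<bar> \<le> 3/4" and v: "v \<in> Ms" "norm v \<le> 1" for s v
  proof -
    define u where "u t = v - P ((v + t *\<^sub>R n) \<odot> ((v + t *\<^sub>R n) \<odot> (v + t *\<^sub>R n)))" for t
    define g0 where "g0 = P (v \<odot> (v \<odot> v))"
    define g1 where "g1 = P (2 *\<^sub>R (v \<odot> (v \<odot> n)) + n \<odot> (v \<odot> v))"
    have "P (2 *\<^sub>R (n \<odot> (n \<odot> v)) + (n \<odot> n) \<odot> v) = 2 *\<^sub>R E v + E v"
      using MsD[OF v(1)] NsD[OF n(1)] P_assoc[OF n(1,1) v(1)]
      by (simp add: P_add P_scaleR A_jp A_scaleR E_def)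
    then have u: "u t = v - (g0 + t *\<^sub>R g1 + t\<^sup>2 *\<^sub>R (2 *\<^sub>R E v + E v))" for t
      unfolding u_def P_cube_expand[OF v(1) n(1)] g0_def g1_def using P_cube_zero[OF n(1)] by simp
    have b: "norm (v + c *\<^sub>R u t) \<le> 1 + c\<^sup>2" "norm (v - c *\<^sub>R u t) \<le> 1 + c\<^sup>2"
      if "\<bar>t\<bar> \<le> 1" "0 \<le> c" "c \<le> 1/2" for t c
    proof -
      have "t *\<^sub>R n \<in> Ns" by (intro subspace_scale Ns_subspace n)
      moreover have "norm (t *\<^sub>R n) \<le> 1" using that n(2) by (simp add: mult_le_one)
      ultimately show "norm (v + c *\<^sub>R u t) \<le> 1 + c\<^sup>2" "norm (v - c *\<^sub>R u t) \<le> 1 + c\<^sup>2"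
        unfolding u_def using cube_direction[OF v, of "t *\<^sub>R n" c] that by auto
    qed
    \<comment> \<open>The average of the four vectors combined below is \<open>v\<close> moved by
      (3/2) c along \<open>E v\<close>; the range of \<open>s\<close> is chosen so that
      \<open>c\<close> is at most 1/2.\<close>
    define c where "c = (2/3) * \<bar>s\<bar>"
    have c: "0 \<le> c" "c \<le> 1/2" "c\<^sup>2 \<le> s\<^sup>2"
      using s by (simp_all add: c_def power_mult_distrib power2_eq_square)
    have u1: "u 1 + u (-1) - 2 *\<^sub>R u 0 = - (2 *\<^sub>R (2 *\<^sub>R E v + E v))"
      unfolding u by (simp add: scaleR_2)
    have four: "4 *\<^sub>R z = (z + z) + (z + z)" for z :: 'a
      using scaleR_left.add[of 2 2 z] by (simp add: scaleR_2)
    have six: "6 *\<^sub>R E v = 2 *\<^sub>R (2 *\<^sub>R E v + E v)"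
      using scaleR_left.add[of 2 1 "E v", symmetric] by simp
    have combine: "4 * norm (v + (r * (3/2) * c) *\<^sub>R E v) \<le> 4 * (1 + c\<^sup>2)" if r: "r = 1 \<or> r = -1" for r
    proof -
      have "4 *\<^sub>R (v + (r * (3/2) * c) *\<^sub>R E v) = 4 *\<^sub>R v + (r * c) *\<^sub>R 6 *\<^sub>R E v"
        by (simp add: scaleR_add_right mult_ac)
      also have "\<dots> = 4 *\<^sub>R v - (r * c) *\<^sub>R (u 1 + u (-1) - 2 *\<^sub>R u 0)"
        unfolding six u1 by simp
      also have "\<dots> = ((v - (r * c) *\<^sub>R u 1) + (v - (r * c) *\<^sub>R u (-1)))
        + ((v + (r * c) *\<^sub>R u 0) + (v + (r * c) *\<^sub>R u 0))"
        by (simp add: four scaleR_2 algebra_simps)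
      finally have eq: "4 *\<^sub>R (v + (r * (3/2) * c) *\<^sub>R E v) = \<dots>" .
      have b': "norm (v - (r * c) *\<^sub>R u t) \<le> 1 + c\<^sup>2" "norm (v + (r * c) *\<^sub>R u t) \<le> 1 + c\<^sup>2" if "\<bar>t\<bar> \<le> 1" for t
        using b[OF that c(1,2)] r by auto
      have "4 * norm (v + (r * (3/2) * c) *\<^sub>R E v) = norm (4 *\<^sub>R (v + (r * (3/2) * c) *\<^sub>R E v))" by simp
      also have "\<dots> \<le> ((1 + c\<^sup>2) + (1 + c\<^sup>2)) + ((1 + c\<^sup>2) + (1 + c\<^sup>2))"
        unfolding eq by (intro order_trans[OF norm_triangle_ineq] add_mono b') auto
      finally show ?thesis by simp
    qed
    have "s = (if s \<ge> 0 then 1 else -1) * (3/2) * c" by (simp add: c_def)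
    then obtain r where r: "r = 1 \<or> r = -1" "s = r * (3/2) * c" by metis
    have "norm (v + s *\<^sub>R E v) \<le> 1 + c\<^sup>2" using combine[OF r(1)] unfolding r(2)[symmetric] by simp
    then show ?thesis using c(3) by linarith
  qed
  show "norm (m + s *\<^sub>R P (n \<odot> (n \<odot> m))) \<le> (1 + 1 * s\<^sup>2) * norm m"
  proof (cases "m = 0")
    case False
    define v where "v = (1 / norm m) *\<^sub>R m"
    have v: "v \<in> Ms" "norm v \<le> 1" using False m by (simp_all add: v_def subspace_scale Ms_subspace)
    have mv: "m = norm m *\<^sub>R v" using False by (simp add: v_def)
    have "m + s *\<^sub>R E m = norm m *\<^sub>R (v + s *\<^sub>R E v)"
      using MsD[OF m] NsD[OF n(1)] False
      by (simp add: v_def E_def jp.scaleR_right P_scaleR A_jp scaleR_add_right mult.left_commute)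
    then have "norm (m + s *\<^sub>R E m) = norm m * norm (v + s *\<^sub>R E v)" by simp
    also have "\<dots> \<le> norm m * (1 + s\<^sup>2)" by (intro mult_left_mono unit s v norm_ge_zero)
    finally show ?thesis by (simp add: E_def mult.commute)
  qed (simp add: jp.zero_right P_0)
qed auto

lemma skew_nn:
  assumes n: "n \<in> Ns"
  shows "skew Ms (\<lambda>m. P (n \<odot> (n \<odot> m)))"
proof -
  define r where "r = norm n + 1"
  have r: "r > 0" by (simp add: r_def add_nonneg_pos)
  define v where "v = (1 / r) *\<^sub>R n"
  have v: "v \<in> Ns" "norm v \<le> 1"
    using n r by (simp_all add: v_def subspace_scale Ns_subspace) (simp add: r_def)
  have n_eq: "n = r *\<^sub>R v" using r by (simp add: v_def)
  have "P (n \<odot> (n \<odot> m)) = (r * r) *\<^sub>R P (v \<odot> (v \<odot> m))" if "m \<in> Ms" for m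
    unfolding n_eq using NsD[OF v(1)] MsD[OF that] by (simp add: jp.scaleR_left jp.scaleR_right P_scaleR A_jp)
  then show ?thesis using skew_scaleR[OF skew_nn_unit[OF v], of "r * r"] by (subst skew_cong) auto
qed

lemma skew_nw:
  assumes n: "n \<in> Ns" "w \<in> Ns"
  shows "skew Ms (\<lambda>m. P (n \<odot> (w \<odot> m)))"
proof -
  have nw: "n + w \<in> Ns" using n by (simp add: subspace_add Ns_subspace)
  have "P (n \<odot> (w \<odot> m)) = (1/2) *\<^sub>R (P ((n + w) \<odot> ((n + w) \<odot> m)) - P (n \<odot> (n \<odot> m)) - P (w \<odot> (w \<odot> m)))"
    if m: "m \<in> Ms" for m
    using NsD(1)[OF n(1)] NsD(1)[OF n(2)] MsD(1)[OF m] P_assoc'[OF n m]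
    by (simp add: add_left add_right P_add A_jp A_add flip: scaleR_2)
  then show ?thesis
    using skew_scaleR[OF skew_diff[OF skew_diff[OF skew_nn[OF nw] skew_nn[OF n(1)]] skew_nn[OF n(2)]], of "1/2"]
    by (subst skew_cong) auto
qed

text \<open>Trades one application of the operator for raising the power of \<open>n\<close> by two.
  Among the four terms from \<open>jp_triple\<close>, the first and third cancel by
  \<open>P_NNA\<close>; the second, with coefficient 2, and the fourth leave one copy of the
  right-hand side.\<close>

lemma P_nwm_step:
  assumes n: "n \<in> Ns" "w \<in> Ns" and m: "m \<in> Ms"
  shows "P (n \<odot> ((n \<odot> (n \<odot> w)) \<odot> m)) = P (n \<odot> (w \<odot> P (n \<odot> (n \<odot> m))))"
proof -
  define z where "z = n \<odot> m"
  note D = NsD[OF n(1)] NsD[OF n(2)] MsD[OF m]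
  have z: "z \<in> A" "invol z = z" using D by (simp_all add: z_def A_jp invol_jp)
  define W where "W = n \<odot> (n \<odot> w)"
  have W: "W \<in> Ns" unfolding W_def by (intro NNN_in n)
  have nz: "n \<odot> z \<in> A" "invol (n \<odot> z) = n \<odot> z" and wz: "w \<odot> z \<in> A" "invol (w \<odot> z) = w \<odot> z"
    using D z by (simp_all add: A_jp invol_jp)
  have Pwz: "P (w \<odot> z) = P (n \<odot> (w \<odot> m))" unfolding z_def by (rule P_assoc'[OF n m])
  have "P (n \<odot> (W \<odot> m)) = P (W \<odot> z)" unfolding z_def by (rule P_assoc'[OF n(1) W m, symmetric])
  also have "W \<odot> z = (n \<odot> n) \<odot> (w \<odot> z) + 2 *\<^sub>R ((n \<odot> w) \<odot> (n \<odot> z)) - n \<odot> (n \<odot> (w \<odot> z)) - w \<odot> (n \<odot> (n \<odot> z))"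
    unfolding W_def jp_triple[of n w z] comm[of "w \<odot> z" "n \<odot> n"] ..
  also have "P \<dots> = P ((n \<odot> n) \<odot> (w \<odot> z)) + 2 *\<^sub>R P ((n \<odot> w) \<odot> (n \<odot> z))
      - P (n \<odot> (n \<odot> (w \<odot> z))) - P (w \<odot> (n \<odot> (n \<odot> z)))"
    using D z by (simp add: P_add P_diff P_scaleR A_jp A_add A_diff A_scaleR)
  also have "\<dots> = P (n \<odot> (w \<odot> P (n \<odot> z)))"
    using P_NNA(1)[OF n(1,1) wz] P_NNA(2)[OF n(1,1) wz] P_NNA(2)[OF n nz] P_NNA(1)[OF n(2,1) nz]
      P_assoc'[OF n P_in_Ms[OF nz]]
    by (simp add: scaleR_2)
  finally show ?thesis by (simp add: W_def z_def)
qed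

lemma P_nnm:
  assumes n: "n \<in> Ns" and m: "m \<in> Ms"
  shows "P (n \<odot> (n \<odot> m)) = 0"
proof -
  define E where "E m = P (n \<odot> (n \<odot> m))" for m
  have E_in: "E m \<in> Ms" if "m \<in> Ms" for m
    unfolding E_def using NsD[OF n] MsD[OF that] by (intro P_in_Ms) (simp_all add: A_jp invol_jp)
  interpret E: normed_lin_endo Ms E
  proof
    show "E (x + y) = E x + E y" if "x \<in> Ms" "y \<in> Ms" for x y
      using that MsD(1) NsD(1)[OF n] by (simp add: E_def add_right P_add A_jp)
    show "E (r *\<^sub>R x) = r *\<^sub>R E x" if "x \<in> Ms" for r x
      using that MsD(1) NsD(1)[OF n] by (simp add: E_def jp.scaleR_right P_scaleR A_jp)
  qed (simp_all add: Ms_subspace E_in)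
  have pw_Ns: "pw n (2 * k) \<in> Ns" for k
    by (induction k) (simp_all add: pw_0 pw_Suc n NNN_in)
  \<comment> \<open>Each power of \<open>E\<close> is again a product with two kernel factors, so
    \<open>skew_nw\<close> applies to it. Only odd powers of \<open>n\<close> occur, and these stay
    in \<open>Ns\<close>.\<close>
  have iter: "(E ^^ Suc k) v = P (n \<odot> (pw n (2 * k) \<odot> v))" if "v \<in> Ms" for k v
    using that
  proof (induction k arbitrary: v)
    case (Suc k)
    have "(E ^^ Suc (Suc k)) v = (E ^^ Suc k) (E v)" by (simp only: funpow_Suc_right comp_apply)
    also have "\<dots> = P (n \<odot> (pw n (2 * k) \<odot> E v))" by (rule Suc.IH[OF E_in[OF Suc.prems]])
    also have "\<dots> = P (n \<odot> (pw n (2 * Suc k) \<odot> v))"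
      using P_nwm_step[OF n pw_Ns Suc.prems, of k] by (simp add: E_def pw_Suc)
    finally show ?case .
  qed (simp add: E_def pw_0)
  have "skew Ms (E ^^ Suc k)" for k
    using skew_nw[OF n pw_Ns, of k] iter by (subst skew_cong) auto
  then have "E m = 0" by (rule E.skew_powers_zero[OF _ m])
  then show ?thesis by (simp add: E_def)
qed

lemma P_NNA_zero:
  assumes n: "n \<in> Ns" "w \<in> Ns" and z: "z \<in> A" "invol z = z"
  shows "P (n \<odot> (w \<odot> z)) = 0" "P ((n \<odot> w) \<odot> z) = 0"
proof -
  have nw: "n + w \<in> Ns" using n by (simp add: subspace_add Ns_subspace)
  have m: "P z \<in> Ms" using z by (rule P_in_Ms)
  have "P (n \<odot> (w \<odot> P z)) + P (n \<odot> (w \<odot> P z)) = 0"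
    using P_nnm[OF nw m] P_nnm[OF n(1) m] P_nnm[OF n(2) m] P_assoc'[OF n m]
      NsD(1)[OF n(1)] NsD(1)[OF n(2)] MsD(1)[OF m]
    by (simp add: add_left add_right P_add A_jp A_add)
  then have "P (n \<odot> (w \<odot> P z)) = 0" by (simp flip: scaleR_2)
  then show "P (n \<odot> (w \<odot> z)) = 0" "P ((n \<odot> w) \<odot> z) = 0"
    using P_NNA[OF n z] by simp_all
qed

lemma P_MMA:
  assumes m: "m \<in> Ms" "w \<in> Ms" and z: "z \<in> A" "invol z = z"
  shows "P (m \<odot> (w \<odot> z)) = m \<odot> (w \<odot> z)" "P ((m \<odot> w) \<odot> z) = (m \<odot> w) \<odot> z"
  using jb_M_proj.P_NNA_zero[OF compl', unfolded compl_Ns, OF m z] by simp_all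

text \<open>On a triple product of kernel elements, multiplication by m^2 gives terms with two
  kernel factors, which \<open>P\<close> kills, while \<open>P_MMA\<close> puts the result into the
  range. Elements n (n w) of this kind approximate \<open>n\<close> by
  \<open>sa_approx\<close>.\<close>

lemma MM_N_zero:
  assumes m: "m \<in> Ms" and n: "n \<in> Ns"
  shows "(m \<odot> m) \<odot> n = 0"
proof -
  note M = MsD[OF m]
  have triple: "(m \<odot> m) \<odot> tri n w n = 0" if w: "w \<in> Ns" for w
  proof -
    note N = NsD[OF n] NsD[OF w]
    have T: "tri n w n \<in> A" "invol (tri n w n) = tri n w n"
      using N by (simp_all add: jordan_triple_def A_add A_diff A_jp invol_add invol.diff invol_jp)
    have P_tri: "P (tri a v b) = 0" if "a \<in> Ns \<and> v \<in> Ns \<or> b \<in> Ns \<and> v \<in> Ns \<or> a \<in> Ns \<and> b \<in> Ns"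
      "a \<in> A" "invol a = a" "b \<in> A" "invol b = b" "v \<in> A" "invol v = v" for a b v
    proof -
      have P3: "P ((p \<odot> q) \<odot> r) = 0"
        if "p \<in> Ns \<and> q \<in> Ns \<or> p \<in> Ns \<and> r \<in> Ns \<or> q \<in> Ns \<and> r \<in> Ns"
          "p \<in> A \<and> invol p = p" "q \<in> A \<and> invol q = q" "r \<in> A \<and> invol r = r" for p q r
        using that P_NNA_zero(2)[of p q r] P_NNA_zero(1)[of r p q] P_NNA_zero(1)[of r q p]
          comm[of "p \<odot> q" r] comm[of q p] by metis
      have "P ((a \<odot> v) \<odot> b) = 0" "P ((b \<odot> v) \<odot> a) = 0" "P ((a \<odot> b) \<odot> v) = 0"
        using that by (auto intro!: P3)
      then show ?thesis using that by (simp add: jordan_triple_def P_add P_diff A_add A_jp)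
    qed
    have k: "(m \<odot> m) \<odot> v \<in> A" "invol ((m \<odot> m) \<odot> v) = (m \<odot> m) \<odot> v" if "v \<in> Ns" for v
      using M NsD[OF that] by (simp_all add: A_jp invol_jp)
    have "(m \<odot> m) \<odot> tri n w n = tri ((m \<odot> m) \<odot> n) w n - tri n ((m \<odot> m) \<odot> w) n + tri n w ((m \<odot> m) \<odot> n)"
      by (rule jp_tri)
    moreover have "P (tri ((m \<odot> m) \<odot> n) w n) = 0" "P (tri n ((m \<odot> m) \<odot> w) n) = 0"
      "P (tri n w ((m \<odot> m) \<odot> n)) = 0"
      using n w N k by (auto intro!: P_tri)
    moreover have "tri ((m \<odot> m) \<odot> n) w n \<in> A" "tri n ((m \<odot> m) \<odot> w) n \<in> A" "tri n w ((m \<odot> m) \<odot> n) \<in> A"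
      using N k[OF n] k[OF w] by (simp_all add: jordan_triple_def A_add A_diff A_jp)
    ultimately have "P ((m \<odot> m) \<odot> tri n w n) = 0" by (simp add: P_add P_diff A_diff)
    then show ?thesis using P_MMA(2)[OF m m T] by simp
  qed
  have "norm ((m \<odot> m) \<odot> n) \<le> 0"
  proof (rule field_le_epsilon)
    fix e :: real assume "e > 0"
    define k where "k = norm (m \<odot> m) + 1"
    have k: "k > 0" by (simp add: k_def add_nonneg_pos)
    obtain w where w: "w \<in> Ns" "(n \<odot> n) \<odot> w = n \<odot> (n \<odot> w)" "norm (n - n \<odot> (n \<odot> w)) < e / k"
      using sa_approx[OF NsD(3)[OF n] Ns_subspace n NNN_in[OF n n], of "e / k"] \<open>e > 0\<close> k by auto
    have "tri n w n = n \<odot> (n \<odot> w)"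
      using w(2) by (simp add: jordan_triple_def comm)
    then have "(m \<odot> m) \<odot> n = (m \<odot> m) \<odot> (n - n \<odot> (n \<odot> w))"
      using triple[OF w(1)] by (simp add: jp.diff_right)
    then have "norm ((m \<odot> m) \<odot> n) \<le> norm (m \<odot> m) * norm (n - n \<odot> (n \<odot> w))"
      using jp_norm by metis
    also have "\<dots> \<le> k * (e / k)" using w(3) k by (intro mult_mono) (auto simp: k_def)
    finally show "norm ((m \<odot> m) \<odot> n) \<le> 0 + e" using k by simp
  qed
  then show ?thesis by simp
qed

lemma NN_M_zero:
  assumes "m \<in> Ms" "n \<in> Ns"
  shows "(n \<odot> n) \<odot> m = 0"
  using jb_M_proj.MM_N_zero[OF compl', unfolded compl_Ns compl_Ms, OF assms(2,1)] .

text \<open>Multiplication by n^2 kills \<open>m\<close> and m (m w), so the triple product of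
  \<open>m\<close> with n^2 w vanishes. Approximating \<open>n\<close> by such elements gives m (m
  n) = 0, and \<open>sa_square_zero\<close> removes one factor.\<close>

lemma M_N_zero:
  assumes m: "m \<in> Ms" and n: "n \<in> Ns"
  shows "m \<odot> n = 0"
proof -
  note M = MsD[OF m]
  have tri_m: "tri m w m = 2 *\<^sub>R (m \<odot> (m \<odot> w))" if "w \<in> Ns" for w
    using MM_N_zero[OF m that] by (simp add: jordan_triple_def comm scaleR_2)
  have triple: "tri m ((n \<odot> n) \<odot> w) m = 0" if w: "w \<in> Ns" for w
  proof -
    have "m \<odot> (m \<odot> w) \<in> Ms"
      using P_MMA(1)[OF m m NsD(1,3)[OF w]] M NsD[OF w] by (simp add: Ms_def A_jp invol_jp)
    then have "(n \<odot> n) \<odot> tri m w m = 0"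
      unfolding tri_m[OF w] using NN_M_zero[OF _ n] by (simp add: jp.scaleR_right)
    moreover have "tri 0 w m = 0" "tri m w 0 = 0"
      by (simp_all add: jordan_triple_def jp.zero_left jp.zero_right)
    ultimately show ?thesis
      using jp_tri[of "n \<odot> n" m w m] by (simp add: NN_M_zero[OF m n])
  qed
  have "norm (tri m n m) \<le> 0"
  proof (rule field_le_epsilon)
    fix e :: real assume "e > 0"
    define k where "k = 3 * norm m * norm m + 1"
    have k: "k > 0" by (simp add: k_def add_nonneg_pos)
    obtain w where w: "w \<in> Ns" "(n \<odot> n) \<odot> w = n \<odot> (n \<odot> w)" "norm (n - n \<odot> (n \<odot> w)) < e / k"
      using sa_approx[OF NsD(3)[OF n] Ns_subspace n NNN_in[OF n n], of "e / k"] \<open>e > 0\<close> k by auto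
    have "tri m n m = tri m (n - n \<odot> (n \<odot> w)) m"
      using triple[OF w(1)] w(2) by (simp add: tri_bilinear)
    then have "norm (tri m n m) \<le> 3 * norm m * norm (n - n \<odot> (n \<odot> w)) * norm m"
      using norm_tri by metis
    also have "\<dots> = (3 * norm m * norm m) * norm (n - n \<odot> (n \<odot> w))" by simp
    also have "\<dots> \<le> k * (e / k)" using w(3) k by (intro mult_mono) (auto simp: k_def)
    finally show "norm (tri m n m) \<le> 0 + e" using k by simp
  qed
  then have "m \<odot> (m \<odot> n) = 0" using tri_m[OF n] by simp
  then show ?thesis by (rule sa_square_zero[OF M(3)])
qed

text \<open>The kernel part \<open>r\<close> of a^2 is annihilated by a^2 and by the range part of
  a^2, hence by their difference \<open>r\<close>; its cube vanishes. Polarisation gives mixed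
  products.\<close>

lemma MM_in:
  assumes a: "a \<in> Ms" and b: "b \<in> Ms"
  shows "P (a \<odot> b) = a \<odot> b"
proof -
  have sq: "P (a \<odot> a) = a \<odot> a" if a: "a \<in> Ms" for a
  proof -
    note M = MsD[OF a]
    have aa: "a \<odot> a \<in> A" "invol (a \<odot> a) = a \<odot> a" using M by (simp_all add: A_jp invol_jp)
    define r where "r = a \<odot> a - P (a \<odot> a)"
    have r: "r \<in> Ns" unfolding r_def by (rule compl_in_Ns[OF aa])
    have "r \<odot> r = (a \<odot> a) \<odot> r - P (a \<odot> a) \<odot> r" by (simp add: r_def jp.diff_left)
    also have "\<dots> = 0" using MM_N_zero[OF a r] M_N_zero[OF P_in_Ms[OF aa] r] by simp
    finally have "cube r = 0" by (simp add: cube_sa NsD(3)[OF r] jp.zero_right)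
    then have "r = 0" by (rule cube_eq_0D)
    then show ?thesis by (simp add: r_def)
  qed
  have "P ((a + b) \<odot> (a + b)) = (a + b) \<odot> (a + b)"
    using a b by (intro sq subspace_add Ms_subspace)
  then have "2 *\<^sub>R P (a \<odot> b) = 2 *\<^sub>R (a \<odot> b)"
    using sq[OF a] sq[OF b] MsD(1)[OF a] MsD(1)[OF b]
    by (simp add: add_left add_right P_add A_jp A_add comm[of b a] scaleR_2)
  then show ?thesis by simp
qed

text \<open>Multiplications by the skew elements \<open>b\<close> and \<open>b \<odot> n\<close>
  both commute with \<open>P\<close>: one puts b (b n) into the kernel, the other into the
  range.\<close>

lemma skew_M_N_zero:
  assumes b: "b \<in> A" "invol b = - b" "P b = b" and n: "n \<in> Ns"
  shows "b \<odot> n = 0"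
proof -
  note N = NsD[OF n]
  have bn: "b \<odot> n \<in> A" "invol (b \<odot> n) = - (b \<odot> n)" using b N by (simp_all add: A_jp invol_jp jp.minus_left)
  have "P (b \<odot> (b \<odot> n)) = 0"
    using b N bn by (simp add: P_jp_skew jp.zero_right)
  moreover have "P ((b \<odot> n) \<odot> b) = (b \<odot> n) \<odot> b" using P_jp_skew[OF bn(2,1) b(1)] b(3) by simp
  ultimately have "b \<odot> (b \<odot> n) = 0" by (simp add: comm[of "b \<odot> n" b])
  then show ?thesis by (rule skew_square_zero'[OF b(2)])
qed

text \<open>Multiplication by a skew element of \<open>A\<close> commutes with \<open>P\<close>,
  which settles the skew part of \<open>y\<close>. For the self-adjoint part, the orthogonality
  lemmas first remove its component in the kernel.\<close>

lemma range_ideal: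
  assumes x: "x \<in> A" "P x = x" and y: "y \<in> A"
  shows "P (x \<odot> y) = x \<odot> y"
proof -
  have split: "\<exists>a b. z = a + b \<and> a \<in> A \<and> b \<in> A \<and> invol a = a \<and> invol b = - b \<and> (P z = z \<longrightarrow> P a = a \<and> P b = b)"
    if z: "z \<in> A" for z
  proof (intro exI conjI impI)
    have two: "z = (1/2) *\<^sub>R (z + z)" by (simp flip: scaleR_2)
    show "z = (1/2) *\<^sub>R (z + invol z) + (1/2) *\<^sub>R (z - invol z)"
      using two by (simp add: algebra_simps)
    show "invol ((1/2) *\<^sub>R (z - invol z)) = - ((1/2) *\<^sub>R (z - invol z))"
      by (simp add: invol_scaleR invol.diff flip: scaleR_minus_right)
  qed (use z P_invol[OF z] in \<open>simp_all add: A_scaleR A_add A_diff A_invol invol_scaleR invol_add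
      P_scaleR P_add P_diff add.commute\<close>)
  obtain a b where ab: "x = a + b" "a \<in> A" "b \<in> A" "invol a = a" "invol b = - b" "P a = a" "P b = b"
    using split[OF x(1)] x(2) by blast
  obtain c d where cd: "y = c + d" "c \<in> A" "d \<in> A" "invol c = c" "invol d = - d"
    using split[OF y] by blast
  have a: "a \<in> Ms" using ab by (simp add: Ms_def)
  have Pc: "P c \<in> Ms" and Qc: "c - P c \<in> Ns" using cd by (auto intro: P_in_Ms compl_in_Ns)
  have ac: "a \<odot> c = a \<odot> P c" using M_N_zero[OF a Qc] by (simp add: jp.diff_right)
  have bc: "b \<odot> c = b \<odot> P c"
    using skew_M_N_zero[OF ab(3,5,7) Qc] by (simp add: jp.diff_right)
  have "x \<odot> y = a \<odot> c + b \<odot> c + d \<odot> x" by (simp add: ab(1) cd(1) add_left add_right comm[of d])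
  moreover have "P (a \<odot> c) = a \<odot> c" unfolding ac by (rule MM_in[OF a Pc])
  moreover have "P (b \<odot> c) = b \<odot> c" using P_jp_skew[OF ab(5,3) cd(2)] bc by simp
  moreover have "P (d \<odot> x) = d \<odot> x" using P_jp_skew[OF cd(5,3) x(1)] x(2) by simp
  ultimately show ?thesis using ab(2,3) cd(2,3) x(1) by (simp add: P_add A_add A_jp)
qed

end

theorem theorem4p2:
  fixes jp :: "'a::complex_banach \<Rightarrow> 'a \<Rightarrow> 'a"
    and invol :: "'a \<Rightarrow> 'a"
    and A M :: "'a set"
    and Phi :: "'a \<Rightarrow> ('e::banach \<Rightarrow>\<^sub>L real)"
  assumes "jbstar_algebra jp invol"
    and "real_jbstar_subalgebra jp invol A"
    and "predual_iso A Phi"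
    and "M \<subseteq> A" and "subspace M" and "closed M"
  shows "M_summand A M \<longleftrightarrow> jordan_ideal jp A M \<and> closedin (wstar_topology A Phi) M"
proof -
  interpret jbstar jp invol by unfold_locales (rule assms(1))
  have A: "subspace A" "\<And>x y. x \<in> A \<Longrightarrow> y \<in> A \<Longrightarrow> jp x y \<in> A" "\<And>x. x \<in> A \<Longrightarrow> invol x \<in> A"
    using assms(2) by (simp_all add: real_jbstar_subalgebra_def)
  interpret dual: dual_space A Phi by unfold_locales (rule A(1), rule assms(3))
  show ?thesis
  proof (intro iffI conjI)
    assume "M_summand A M"
    then obtain P where P: "M_projection A P" "M = P ` A" by (auto simp: M_summand_def)
    interpret jb_M_proj jp invol A P
      by unfold_locales (simp_all add: A P)
    interpret dual_M_proj A Phi P ..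
    have "jp x a \<in> M" if "x \<in> M" "a \<in> A" for x a
    proof -
      have x: "x \<in> A" "P x = x" using that(1) by (auto simp: P(2) P_in P_idem)
      then have "jp x a = P (jp x a)" using range_ideal that(2) by simp
      then show ?thesis unfolding P(2) using A(2)[OF x(1) that(2)] by (rule image_eqI)
    qed
    then show "jordan_ideal jp A M" using assms(4-6) by (simp add: jordan_ideal_def)
    show "closedin (wstar_topology A Phi) M"
      unfolding P(2) by (rule closedin_wstar_range)
  next
    assume M: "jordan_ideal jp A M \<and> closedin (wstar_topology A Phi) M"
    then have ideal: "jp x a \<in> M" "jp a x \<in> M" if "x \<in> M" "a \<in> A" for x a
      using that comm[of a x] by (simp_all add: jordan_ideal_def)
    obtain u where u: "u \<in> M" "norm u \<le> 1"
      "\<And>v. v \<in> M \<Longrightarrow> norm (u + v) \<le> 1 \<Longrightarrow> norm (u - v) \<le> 1 \<Longrightarrow> v = 0"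
      using dual.extreme_point_exists[OF assms(5)] M by blast
    show "M_summand A M"
    proof (rule M_summand_of_extreme_point[OF A(1) assms(5,4) _ _ u])
      show "tr x y z \<in> A" if "x \<in> A" "y \<in> A" "z \<in> A" for x y z
        using that A by (simp add: tr_def jordan_triple_def subspace_add subspace_diff)
      show "tr x y z \<in> M" if "x \<in> M" "y \<in> A" "z \<in> A" for x y z
        using that A(2,3) ideal
        by (simp add: tr_def jordan_triple_def subspace_add[OF assms(5)] subspace_diff[OF assms(5)])
    qed
  qed
qed

end
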